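(* Let $d\ge 1$, $\beta>0$, and let $Z=(Z(t))_{t\ge 0}$ be a strictly dyadic branching Brownian motion in $\mathbb{R}^d$ with constant branching rate $\beta$, started from a single particle at the origin. Let $0<\theta<1$, and for $t\ge0$ let $x_t=\theta\sqrt{2\beta}\,t$ and let $\widehat B_t=B(0,x_t)$ be the open ball of radius $x_t$ centered at the origin, with complement $\widehat B_t^c=\mathbb{R}^d\setminus\widehat B_t$. Then, for every $0\le a<1-\theta^2$, $$\lim_{t\to\infty}\frac1t\log P\left(Z_t(\widehat B_t^c)<e^{\beta a t}\right)=-\beta\left[1-\frac a2-\sqrt{\theta^2+\left(\frac a2\right)^2}\right].$$
   Context: Strictly dyadic branching Brownian motion (BBM) with constant branching rate $\beta>0$: the process starts with a single particle, which performs a standard Brownian motion in $\mathbb{R}^d$ for a random exponential time of parameter $\beta$; it then dies and simultaneously gives birth to exactly two offspring at its death position; each offspring, independently of everything else, repeats the same procedure started from that position, and so on. All Brownian motions and exponential lifetimes are independent. $P$ is the law of $Z$ when started with a single particle at the origin. For a Borel set $A\subseteq\mathbb{R}^d$, $Z_t(A)$ is the number of particles located in $A$ at time $t$. *)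

theory Defs
  imports "HOL-Probability.Probability"
begin

text \<open>
  Standard Brownian motion started at the origin of a Euclidean space \<open>'a\<close> of dimension
  \<open>d = DIM('a) \<ge> 1\<close>. Time is restricted to the nonnegative reals: values of \<open>W\<close> at negative
  times are irrelevant. The product of one-dimensional densities over the orthonormal basis
  is the density of the normal law with mean \<open>0\<close> and covariance matrix \<open>(t - s) I\<close>.
\<close>

definition standard_brownian_motion ::
  "'w measure \<Rightarrow> (real \<Rightarrow> 'w \<Rightarrow> 'a::euclidean_space) \<Rightarrow> bool" where
  "standard_brownian_motion M W \<longleftrightarrow>
     (\<forall>t\<ge>0. W t \<in> borel_measurable M) \<and>
     (\<forall>\<omega>\<in>space M. W 0 \<omega> = 0) \<and>
     (\<forall>\<omega>\<in>space M. continuous_on {0..} (\<lambda>t. W t \<omega>)) \<and>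
     (\<forall>s t. 0 \<le> s \<longrightarrow> s < t \<longrightarrow>
        distributed M lborel (\<lambda>\<omega>. W t \<omega> - W s \<omega>)
          (\<lambda>x. ennreal (\<Prod>b\<in>Basis. normal_density 0 (sqrt (t - s)) (x \<bullet> b)))) \<and>
     (\<forall>n (t :: nat \<Rightarrow> real). 0 \<le> t 0 \<longrightarrow> (\<forall>i<n. t i < t (Suc i)) \<longrightarrow>
        prob_space.indep_vars M (\<lambda>_. borel) (\<lambda>i \<omega>. W (t (Suc i)) \<omega> - W (t i) \<omega>) {..<n})"

text \<open>
  Particles are labelled by finite binary words: the initial particle is \<open>[]\<close>, the two offspring
  of \<open>u\<close> are \<open>u @ [False]\<close> and \<open>u @ [True]\<close>, and the proper ancestors of \<open>u\<close> are \<open>take k u\<close> for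
  \<open>k < length u\<close>. Particle \<open>u\<close> has lifetime \<open>\<tau> u\<close> and moves relative to its place of birth along
  the path \<open>W u\<close>, run from time \<open>0\<close> and used up to time \<open>\<tau> u\<close> only.
\<close>

type_synonym particle = "bool list"

locale dyadic_bbm = prob_space M
  for M :: "'w measure" and \<beta> :: real
    and \<tau> :: "particle \<Rightarrow> 'w \<Rightarrow> real"
    and W :: "particle \<Rightarrow> real \<Rightarrow> 'w \<Rightarrow> 'a::euclidean_space" +
  assumes rate_pos: "0 < \<beta>"
    and lifetime_nonneg: "\<And>u \<omega>. \<omega> \<in> space M \<Longrightarrow> 0 \<le> \<tau> u \<omega>"
    and lifetime_exponential: "\<And>u. distributed M lborel (\<tau> u) (exponential_density \<beta>)"
    and motion_brownian: "\<And>u. standard_brownian_motion M (W u)"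
    and independence:
      "indep_sets
         (\<lambda>i. case i of
            Inl u \<Rightarrow> sets (vimage_algebra (space M) (\<tau> u) borel)
          | Inr u \<Rightarrow> sets (vimage_algebra (space M) (\<lambda>\<omega>. \<lambda>t\<in>{0..}. W u t \<omega>)
                             (\<Pi>\<^sub>M t\<in>{0..}. borel)))
         (UNIV :: (particle + particle) set)"

definition birth_time :: "(particle \<Rightarrow> 'w \<Rightarrow> real) \<Rightarrow> particle \<Rightarrow> 'w \<Rightarrow> real" where
  "birth_time \<tau> u \<omega> = (\<Sum>k<length u. \<tau> (take k u) \<omega>)"

definition alive :: "(particle \<Rightarrow> 'w \<Rightarrow> real) \<Rightarrow> real \<Rightarrow> 'w \<Rightarrow> particle set" where
  "alive \<tau> t \<omega> = {u. birth_time \<tau> u \<omega> \<le> t \<and> t < birth_time \<tau> u \<omega> + \<tau> u \<omega>}"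

definition birth_position ::
  "(particle \<Rightarrow> 'w \<Rightarrow> real) \<Rightarrow> (particle \<Rightarrow> real \<Rightarrow> 'w \<Rightarrow> 'a::euclidean_space) \<Rightarrow>
   particle \<Rightarrow> 'w \<Rightarrow> 'a" where
  "birth_position \<tau> W u \<omega> = (\<Sum>k<length u. W (take k u) (\<tau> (take k u) \<omega>) \<omega>)"

definition position ::
  "(particle \<Rightarrow> 'w \<Rightarrow> real) \<Rightarrow> (particle \<Rightarrow> real \<Rightarrow> 'w \<Rightarrow> 'a::euclidean_space) \<Rightarrow>
   real \<Rightarrow> particle \<Rightarrow> 'w \<Rightarrow> 'a" where
  "position \<tau> W t u \<omega> = birth_position \<tau> W u \<omega> + W u (t - birth_time \<tau> u \<omega>) \<omega>"

text \<open>
  \<open>Z\<^sub>t(A)\<close>. The counting measure is used instead of \<^const>\<open>card\<close> so that an infinite population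
  (an event of probability zero) counts as infinite rather than as empty.
\<close>

definition particle_count ::
  "(particle \<Rightarrow> 'w \<Rightarrow> real) \<Rightarrow> (particle \<Rightarrow> real \<Rightarrow> 'w \<Rightarrow> 'a::euclidean_space) \<Rightarrow>
   real \<Rightarrow> 'a set \<Rightarrow> 'w \<Rightarrow> ennreal" where
  "particle_count \<tau> W t A \<omega> =
     emeasure (count_space UNIV) {u \<in> alive \<tau> t \<omega>. position \<tau> W t u \<omega> \<in> A}"

end

theory Submission
  imports Defs "HOL-Real_Asymp.Real_Asymp"
begin

text \<open>
  Put \<open>u\<^sub>0 = a / 2 + sqrt (\<theta>\<^sup>2 + (a / 2)\<^sup>2)\<close>, the positive root of \<open>u\<^sup>2 = a u + \<theta>\<^sup>2\<close>; the rate is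
  \<open>\<beta> (1 - u\<^sub>0)\<close>. The cheapest way of having few particles outside the ball is to suppress branching
  during \<open>[0, (1 - u\<^sub>0) t]\<close>.

  Lower bound: let \<open>u < u\<^sub>0\<close> and \<open>r = (1 - u) t\<close>. With probability about \<open>exp (- \<beta> r)\<close> the first
  particle is still alive at time \<open>r\<close>, within distance \<open>\<epsilon> t\<close> of the origin. Given this, the
  exponential Markov inequality over a finite net of directions shows that the expected number of
  particles outside the ball is at most \<open>exp ((\<beta> u - \<beta> \<theta>\<^sup>2 / u + o 1) t)\<close>, which is much smaller than
  \<open>exp (\<beta> a t)\<close>.

  Upper bound: let \<open>u > u\<^sub>0\<close>. By the branching property the functionals \<open>g \<mapsto> E (\<Prod> g (position))\<close>
  compose along the time axis. For \<open>g = exp (- 1 / K)\<close> outside the ball, \<open>g = 1\<close> inside and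
  \<open>K = exp (\<beta> a t)\<close>, it bounds \<open>P (Z < K)\<close> up to a factor \<open>e\<close>. Over time steps of a fixed length \<open>T\<close>,
  particles that advance at speed \<open>c = \<theta> sqrt (2 \<beta>) / u\<close> into a half-space multiply the deficit
  \<open>1 - E (\<Prod> g)\<close> by more than \<open>exp (\<beta> a T / u)\<close> until it reaches a constant \<open>q\<close>; after time \<open>u t\<close> it is at
  least \<open>q\<close> from every starting point, because one of two opposite half-spaces is always available.
  In the remaining time the generating function of the Yule process at \<open>1 - q\<close> is at most
  \<open>exp (- \<beta> (1 - u) t) / q\<close>.
\<close>

subsection \<open>Measurability and independence\<close>

context dyadic_bbm
begin

definition source_events :: "particle + particle \<Rightarrow> 'w set set" where
  "source_events i = (case i of
      Inl u \<Rightarrow> sets (vimage_algebra (space M) (\<tau> u) borel)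
    | Inr u \<Rightarrow> sets (vimage_algebra (space M) (\<lambda>\<omega>. \<lambda>t\<in>{0..}. W u t \<omega>) (\<Pi>\<^sub>M t\<in>{0..}. borel)))"

text \<open>A sub-sigma-algebra of \<open>M\<close>, packaged as a measure on the same space, so
  that dependence on the lifetimes and paths indexed by \<open>A\<close> alone becomes a
  measurability statement that composes with other maps.\<close>

definition info :: "(particle + particle) set \<Rightarrow> 'w measure" where
  "info A = sigma (space M) (\<Union>i\<in>A. source_events i)"

lemma source_events_subset: "source_events i \<subseteq> sets M"
  using independence unfolding indep_sets_def source_events_def by auto

lemma space_info [simp]: "space (info A) = space M"
  by (simp add: info_def space_measure_of_conv)

lemma sets_info: "sets (info A) = sigma_sets (space M) (\<Union>i\<in>A. source_events i)"
  unfolding info_def using source_events_subset sets.sets_into_space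
  by (intro sets_measure_of) blast

lemma sets_info_subset: "sets (info A) \<subseteq> sets M"
  unfolding sets_info using source_events_subset by (intro sets.sigma_sets_subset) blast

lemma measurable_infoD: "f \<in> measurable (info A) N \<Longrightarrow> f \<in> measurable M N"
  using sets_info_subset[of A] by (auto simp: measurable_def)

lemma lifetime_measurable_info:
  assumes "Inl u \<in> A" shows "\<tau> u \<in> borel_measurable (info A)"
proof (rule measurableI)
  fix B :: "real set" assume "B \<in> sets borel"
  then have "\<tau> u -` B \<inter> space M \<in> source_events (Inl u)"
    by (auto simp: source_events_def intro!: in_vimage_algebra)
  then show "\<tau> u -` B \<inter> space (info A) \<in> sets (info A)"
    using assms unfolding sets_info by (auto intro!: sigma_sets.Basic)
qed auto

lemma motion_measurable_info:
  assumes "Inr u \<in> A" "0 \<le> t" shows "W u t \<in> borel_measurable (info A)"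
proof -
  let ?N = "vimage_algebra (space M) (\<lambda>\<omega>. \<lambda>t\<in>{0..}. W u t \<omega>) (\<Pi>\<^sub>M t\<in>{0..}. (borel :: 'a measure))"
  have "(\<lambda>\<omega>. (\<lambda>t\<in>{0..}. W u t \<omega>) t) \<in> borel_measurable ?N"
    using assms(2) by (intro measurable_compose[OF measurable_vimage_algebra1]
      measurable_component_singleton) (auto simp: space_PiM split: if_splits)
  then have "W u t \<in> borel_measurable ?N" using assms(2) by simp
  moreover have "sets ?N \<subseteq> sets (info A)"
    using assms(1) unfolding sets_info by (auto simp: source_events_def intro!: sigma_sets.Basic)
  ultimately show ?thesis by (auto simp: measurable_def)
qed

text \<open>The paths are unconstrained at negative times, hence the truncation.\<close>

definition V :: "particle \<Rightarrow> real \<Rightarrow> 'w \<Rightarrow> 'a" where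
  "V u s \<omega> = W u (max 0 s) \<omega>"

lemma V_0 [simp]: "\<omega> \<in> space M \<Longrightarrow> V u 0 \<omega> = 0"
  using motion_brownian[of u] by (simp add: V_def standard_brownian_motion_def)

text \<open>Joint measurability in time and randomness relies on path continuity, hence the dyadic
  approximation.\<close>

lemma V_measurable_info:
  assumes u: "Inr u \<in> A"
  shows "(\<lambda>p. V u (fst p) (snd p)) \<in> borel_measurable (borel \<Otimes>\<^sub>M info A)"
proof (rule borel_measurable_LIMSEQ_metric)
  fix k :: nat
  show "(\<lambda>p. V u (real_of_int \<lfloor>(2::real) ^ k * fst p\<rfloor> / 2 ^ k) (snd p)) \<in> borel_measurable (borel \<Otimes>\<^sub>M info A)"
    (is "?f \<in> _")
  proof -
    have "(\<lambda>p. (\<lambda>i p. V u (real_of_int i / 2 ^ k) (snd p)) \<lfloor>(2::real) ^ k * fst p\<rfloor> p) 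
        \<in> borel_measurable (borel \<Otimes>\<^sub>M info A)"
    proof (rule measurable_compose_countable[where f = "\<lambda>i p. V u (real_of_int i / 2 ^ k) (snd p)"])
      fix i :: int
      show "(\<lambda>p. V u (real_of_int i / 2 ^ k) (snd p)) \<in> borel_measurable (borel \<Otimes>\<^sub>M info A)"
        unfolding V_def by (rule measurable_compose[OF measurable_snd motion_measurable_info[OF u]]) auto
    qed measurable
    then show ?thesis by simp
  qed
next
  fix p assume p: "p \<in> space ((borel :: real measure) \<Otimes>\<^sub>M info A)"
  then have w: "snd p \<in> space M" by (auto simp: space_pair_measure)
  have c: "continuous_on {0..} (\<lambda>t. W u t (snd p))"
    using motion_brownian[of u] w by (simp add: standard_brownian_motion_def)
  have "(\<lambda>k. real_of_int \<lfloor>(2::real) ^ k * fst p\<rfloor> / 2 ^ k) \<longlonglongrightarrow> fst p"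
  proof (rule real_tendsto_sandwich)
    show "\<forall>\<^sub>F k in sequentially. fst p - 1 / 2 ^ k \<le> real_of_int \<lfloor>(2::real) ^ k * fst p\<rfloor> / 2 ^ k"
    proof (intro always_eventually allI)
      fix k :: nat
      have "2 ^ k * fst p - 1 \<le> real_of_int \<lfloor>(2::real) ^ k * fst p\<rfloor>" by linarith
      then show "fst p - 1 / 2 ^ k \<le> real_of_int \<lfloor>(2::real) ^ k * fst p\<rfloor> / 2 ^ k"
        using divide_right_mono[of "2 ^ k * fst p - 1" "real_of_int \<lfloor>2 ^ k * fst p\<rfloor>" "2 ^ k"]
        by (simp add: diff_divide_distrib)
    qed
    show "\<forall>\<^sub>F k in sequentially. real_of_int \<lfloor>(2::real) ^ k * fst p\<rfloor> / 2 ^ k \<le> fst p"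
      by (intro always_eventually allI) (simp add: field_simps)
    have "(\<lambda>k. fst p - (1/2) ^ k) \<longlonglongrightarrow> fst p - 0"
      by (intro tendsto_intros LIMSEQ_realpow_zero) auto
    then show "(\<lambda>k. fst p - 1 / 2 ^ k) \<longlonglongrightarrow> fst p" by (simp add: power_divide)
  qed simp
  then have "(\<lambda>k. max 0 (real_of_int \<lfloor>(2::real) ^ k * fst p\<rfloor> / 2 ^ k)) \<longlonglongrightarrow> max 0 (fst p)"
    by (intro tendsto_intros)
  then show "(\<lambda>k. V u (real_of_int \<lfloor>(2::real) ^ k * fst p\<rfloor> / 2 ^ k) (snd p)) \<longlonglongrightarrow> V u (fst p) (snd p)"
    unfolding V_def by (rule continuous_on_tendsto_compose[OF c]) auto
qed

lemma V_measurable_info_comp: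
  assumes "Inr u \<in> A" "f \<in> borel_measurable N" "g \<in> measurable N (info A)"
  shows "(\<lambda>p. V u (f p) (g p)) \<in> borel_measurable N"
  using measurable_compose[OF measurable_Pair[OF assms(2,3)] V_measurable_info[OF assms(1)]] by simp

lemma V_measurable [measurable (raw)]:
  assumes "f \<in> borel_measurable N" "g \<in> measurable N M"
  shows "(\<lambda>p. V u (f p) (g p)) \<in> borel_measurable N"
proof (rule V_measurable_info_comp)
  show "g \<in> measurable N (info {Inr u})"
    using assms(2) sets_info_subset by (auto simp: measurable_def)
qed (use assms in auto)

lemma lifetime_measurable [measurable]: "\<tau> u \<in> borel_measurable M"
  using lifetime_measurable_info[of u UNIV] by (auto dest: measurable_infoD)

text \<open>The generators \<open>source_events i\<close> are stable under intersection, so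
  independence passes to the sigma-algebras generated by disjoint blocks. Reading the identity with
  two different target sigma-algebras turns this into independence of two random variables, whose
  joint law is a product.\<close>

lemma indep_info:
  assumes "A \<inter> B = {}"
  shows "indep_var (info A) (\<lambda>\<omega>. \<omega>) (info B) (\<lambda>\<omega>. \<omega>)"
proof -
  have id: "(\<lambda>\<omega>. \<omega>) \<in> measurable M (info C)" for C
    using sets_info_subset[of C] by (auto simp: measurable_def)
  have st: "Int_stable (source_events i)" for i
    unfolding source_events_def by (cases i) (auto intro!: sets.Int_stable)
  have "indep_sets (\<lambda>j. sigma_sets (space M) (\<Union>i\<in>case_bool A B j. source_events i)) UNIV"
  proof (rule indep_sets_collect_sigma)
    show "indep_sets source_events (\<Union>j\<in>UNIV. case_bool A B j)"
      using independence unfolding source_events_def[abs_def] by (rule indep_sets_mono_index[rotated]) simp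
    show "disjoint_family_on (case_bool A B) UNIV"
      using assms by (auto simp: disjoint_family_on_def split: bool.splits)
  qed (rule st)
  then have *: "indep_sets (\<lambda>j. sets (info (case_bool A B j))) UNIV"
    by (simp add: sets_info)
  have im: "{(\<lambda>\<omega>. \<omega>) -` S \<inter> space M |S. S \<in> sets (info C)} = sets (info C)" for C
    using sets.sets_into_space[of _ "info C"] by (auto simp: Int_absorb2)
  show ?thesis
    unfolding indep_var_def indep_vars_def2
  proof (intro conjI ballI)
    fix i show "random_variable (case i of True \<Rightarrow> info A | False \<Rightarrow> info B) (case i of True \<Rightarrow> \<lambda>\<omega>. \<omega> | False \<Rightarrow> \<lambda>\<omega>. \<omega>)"
      using id by (cases i) auto
    have "(\<lambda>i. {(case i of True \<Rightarrow> \<lambda>\<omega>. \<omega> | False \<Rightarrow> \<lambda>\<omega>. \<omega>) -` S \<inter> space M |S.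
              S \<in> sets (case i of True \<Rightarrow> info A | False \<Rightarrow> info B)}) =
       (\<lambda>j. sets (info (case_bool A B j)))"
      using im by (intro ext) (auto split: bool.split)
    then show "indep_sets (\<lambda>i. {(case i of True \<Rightarrow> \<lambda>\<omega>. \<omega> | False \<Rightarrow> \<lambda>\<omega>. \<omega>) -` S \<inter> space M |S.
              S \<in> sets (case i of True \<Rightarrow> info A | False \<Rightarrow> info B)}) UNIV"
      using * by simp
  qed
qed

text \<open>This takes the place of conditional expectation: the image of \<open>M\<close> under the
  diagonal map is a product measure on \<open>info A\<close> and \<open>info B\<close>, so by
  Tonelli the sources in \<open>B\<close> can be averaged first while those in \<open>A\<close> are
  held fixed.\<close>

lemma nn_integral_freeze:
  assumes AB: "A \<inter> B = {}" and h: "h \<in> borel_measurable (info A \<Otimes>\<^sub>M info B)"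
  shows "(\<integral>\<^sup>+\<omega>. h (\<omega>, \<omega>) \<partial>M) = (\<integral>\<^sup>+\<omega>. \<integral>\<^sup>+\<omega>'. h (\<omega>, \<omega>') \<partial>M \<partial>M)"
proof -
  have id: "(\<lambda>\<omega>. \<omega>) \<in> measurable M (info C)" for C
    using sets_info_subset[of C] by (auto simp: measurable_def)
  let ?D = "\<lambda>C. distr M (info C) (\<lambda>\<omega>. \<omega>)"
  interpret B: prob_space "?D B" by (rule prob_space_distr[OF id])
  have eq: "?D A \<Otimes>\<^sub>M ?D B = distr M (info A \<Otimes>\<^sub>M info B) (\<lambda>\<omega>. (\<omega>, \<omega>))"
    using indep_info[OF AB] by (simp add: indep_var_distribution_eq)
  have h': "h \<in> borel_measurable (?D A \<Otimes>\<^sub>M ?D B)"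
    using h by (simp cong: measurable_cong_sets)
  have hs: "(\<lambda>\<omega>'. h (\<omega>, \<omega>')) \<in> borel_measurable (info B)" if "\<omega> \<in> space M" for \<omega>
    using h that by (intro measurable_compose[OF measurable_Pair1' h]) simp
  have "(\<integral>\<^sup>+\<omega>. h (\<omega>, \<omega>) \<partial>M) = (\<integral>\<^sup>+p. h p \<partial>(?D A \<Otimes>\<^sub>M ?D B))"
    unfolding eq using h id by (subst nn_integral_distr) auto
  also have "\<dots> = (\<integral>\<^sup>+\<omega>. \<integral>\<^sup>+\<omega>'. h (\<omega>, \<omega>') \<partial>?D B \<partial>?D A)"
    using B.nn_integral_fst[OF h'] by simp
  also have "\<dots> = (\<integral>\<^sup>+\<omega>. \<integral>\<^sup>+\<omega>'. h (\<omega>, \<omega>') \<partial>?D B \<partial>M)"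
    by (subst nn_integral_distr[OF id]) (use B.borel_measurable_nn_integral_fst[OF h'] in \<open>simp_all cong: measurable_cong_sets\<close>)
  also have "\<dots> = (\<integral>\<^sup>+\<omega>. \<integral>\<^sup>+\<omega>'. h (\<omega>, \<omega>') \<partial>M \<partial>M)"
    by (intro nn_integral_cong nn_integral_distr[OF id]) (simp add: hs)
  finally show ?thesis .
qed

lemma indep_nn_integral_mult:
  assumes "A \<inter> B = {}" and [measurable]: "\<phi> \<in> borel_measurable (info A)" "\<psi> \<in> borel_measurable (info B)"
  shows "(\<integral>\<^sup>+\<omega>. \<phi> \<omega> * \<psi> \<omega> \<partial>M) = (\<integral>\<^sup>+\<omega>. \<phi> \<omega> \<partial>M) * (\<integral>\<^sup>+\<omega>. \<psi> \<omega> \<partial>M)"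
proof -
  have [measurable]: "\<phi> \<in> borel_measurable M" "\<psi> \<in> borel_measurable M"
    using measurable_infoD[OF assms(2)] measurable_infoD[OF assms(3)] by auto
  have "(\<integral>\<^sup>+\<omega>. \<phi> \<omega> * \<psi> \<omega> \<partial>M) = (\<integral>\<^sup>+\<omega>. \<integral>\<^sup>+\<omega>'. \<phi> \<omega> * \<psi> \<omega>' \<partial>M \<partial>M)"
    using nn_integral_freeze[OF assms(1), of "\<lambda>p. \<phi> (fst p) * \<psi> (snd p)"] by simp
  also have "\<dots> = (\<integral>\<^sup>+\<omega>. \<phi> \<omega> \<partial>M) * (\<integral>\<^sup>+\<omega>. \<psi> \<omega> \<partial>M)"
    by (simp add: nn_integral_cmult nn_integral_multc)
  finally show ?thesis .
qed

lemma increment_integral: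
  assumes "0 \<le> r" "r < s" "f \<in> borel_measurable borel"
  shows "(\<integral>\<^sup>+\<omega>. f (V u s \<omega> - V u r \<omega>) \<partial>M) =
    (\<integral>\<^sup>+x. ennreal (\<Prod>b\<in>Basis. normal_density 0 (sqrt (s - r)) (x \<bullet> b)) * f x \<partial>lborel)"
proof -
  have "distributed M lborel (\<lambda>\<omega>. W u s \<omega> - W u r \<omega>)
          (\<lambda>x. ennreal (\<Prod>b\<in>Basis. normal_density 0 (sqrt (s - r)) (x \<bullet> b)))"
    using motion_brownian[of u] assms by (auto simp: standard_brownian_motion_def)
  from distributed_nn_integral[OF this, of f] show ?thesis
    using assms by (simp add: V_def max_def)
qed

lemma V_integral:
  assumes "0 < s" "f \<in> borel_measurable borel"
  shows "(\<integral>\<^sup>+\<omega>. f (V u s \<omega>) \<partial>M) =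
    (\<integral>\<^sup>+x. ennreal (\<Prod>b\<in>Basis. normal_density 0 (sqrt s) (x \<bullet> b)) * f x \<partial>lborel)"
proof -
  have "(\<integral>\<^sup>+\<omega>. f (V u s \<omega>) \<partial>M) = (\<integral>\<^sup>+\<omega>. f (V u s \<omega> - V u 0 \<omega>) \<partial>M)"
    by (intro nn_integral_cong) simp
  then show ?thesis using increment_integral[of 0 s f u] assms by simp
qed

subsection \<open>The heat semigroup\<close>

text \<open>The Brownian semigroup. The path of the initial particle represents all paths, since
  every \<open>V u s\<close> has the same law. By the truncation in \<open>V\<close> it is the
  identity for \<open>s \<le> 0\<close>.\<close>

definition heat :: "real \<Rightarrow> ('a \<Rightarrow> ennreal) \<Rightarrow> 'a \<Rightarrow> ennreal" where
  "heat s f y = (\<integral>\<^sup>+\<omega>. f (y + V [] s \<omega>) \<partial>M)"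

lemma V_nonpos: "\<omega> \<in> space M \<Longrightarrow> s \<le> 0 \<Longrightarrow> V u s \<omega> = 0"
  using V_0[of \<omega> u] by (simp add: V_def max_def split: if_splits)

lemma V_integral_heat:
  assumes [measurable]: "f \<in> borel_measurable borel"
  shows "(\<integral>\<^sup>+\<omega>. f (y + V u s \<omega>) \<partial>M) = heat s f y"
proof (cases "0 < s")
  case True
  then show ?thesis unfolding heat_def
    using V_integral[OF True, of "\<lambda>x. f (y + x)"] by simp
next
  case False
  then show ?thesis unfolding heat_def
    by (intro nn_integral_cong) (simp add: V_nonpos)
qed

lemma increment_integral_heat:
  assumes [measurable]: "f \<in> borel_measurable borel" and rs: "0 \<le> r" "r \<le> s"
  shows "(\<integral>\<^sup>+\<omega>. f (V u s \<omega> - V u r \<omega>) \<partial>M) = heat (s - r) f 0"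
proof (cases "r = s")
  case True
  then have "(\<integral>\<^sup>+\<omega>. f (V u s \<omega> - V u r \<omega>) \<partial>M) = (\<integral>\<^sup>+\<omega>. f 0 \<partial>M)" by simp
  also have "\<dots> = heat (s - r) f 0"
    unfolding heat_def using True by (intro nn_integral_cong) (simp add: V_nonpos)
  finally show ?thesis .
next
  case False
  then show ?thesis using rs increment_integral[of r s f u] V_integral[of "s - r" f "[]"]
    by (simp add: heat_def)
qed

lemma heat_measurable [measurable (raw)]:
  assumes [measurable]: "case_prod f \<in> borel_measurable (N \<Otimes>\<^sub>M borel)"
    "s \<in> borel_measurable N" "y \<in> borel_measurable N"
  shows "(\<lambda>x. heat (s x) (f x) (y x)) \<in> borel_measurable N"
  unfolding heat_def by measurable

lemma heat_mono:
  assumes "\<And>z. f z \<le> g z"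
  shows "heat s f y \<le> heat s g y"
  unfolding heat_def by (intro nn_integral_mono) (simp add: assms)

lemma heat_const [simp]: "heat s (\<lambda>_. c) y = c"
  by (simp add: heat_def emeasure_space_1)

lemma heat_translate: "heat s (\<lambda>z. f (y + z)) x = heat s f (y + x)"
  by (simp add: heat_def add.assoc)

lemma indep_var_of_indep_vars:
  assumes "indep_vars (\<lambda>_. N) X I" "i \<in> I" "j \<in> I" "i \<noteq> j"
  shows "indep_var N (X i) N (X j)"
proof -
  have "indep_var N ((\<lambda>f. f i) \<circ> (\<lambda>\<omega>. \<lambda>k\<in>{i}. X k \<omega>)) N ((\<lambda>f. f j) \<circ> (\<lambda>\<omega>. \<lambda>k\<in>{j}. X k \<omega>))"
    using assms by (intro indep_var_compose[OF indep_var_restrict[OF assms(1)]]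
      measurable_component_singleton) auto
  then show ?thesis by (simp add: comp_def)
qed

lemma indep_increments:
  assumes "0 < s" "0 < t"
  shows "indep_var borel (V u s) borel (\<lambda>\<omega>. V u (s + t) \<omega> - V u s \<omega>)"
proof -
  \<comment> \<open>The time grid 0, \<open>s\<close>, \<open>s + t\<close>; its two increments
    carry the indices 0 and 1.\<close>
  define T where "T i = (if i = 0 then 0 else if i = 1 then s else s + t)" for i :: nat
  have "\<forall>n (t :: nat \<Rightarrow> real). 0 \<le> t 0 \<longrightarrow> (\<forall>i<n. t i < t (Suc i)) \<longrightarrow>
        indep_vars (\<lambda>_. borel) (\<lambda>i \<omega>. W u (t (Suc i)) \<omega> - W u (t i) \<omega>) {..<n}"
    using motion_brownian[of u] unfolding standard_brownian_motion_def by blast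
  moreover have "\<forall>i<2. T i < T (Suc i)"
    using assms by (auto simp: T_def less_Suc_eq numeral_2_eq_2)
  moreover have "0 \<le> T 0" by (simp add: T_def)
  ultimately have "indep_vars (\<lambda>_. borel) (\<lambda>i \<omega>. W u (T (Suc i)) \<omega> - W u (T i) \<omega>) {..<2}"
    by blast
  then have "indep_var borel (\<lambda>\<omega>. W u (T (Suc 0)) \<omega> - W u (T 0) \<omega>) borel (\<lambda>\<omega>. W u (T (Suc 1)) \<omega> - W u (T 1) \<omega>)"
    by (rule indep_var_of_indep_vars) auto
  then have I: "indep_var borel (\<lambda>\<omega>. W u s \<omega> - W u 0 \<omega>) borel (\<lambda>\<omega>. W u (s + t) \<omega> - W u s \<omega>)"
    by (simp add: T_def)
  have eq: "distr M borel (V u s) = distr M borel (\<lambda>\<omega>. W u s \<omega> - W u 0 \<omega>)"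
    "distr M (borel \<Otimes>\<^sub>M borel) (\<lambda>\<omega>. (V u s \<omega>, V u (s + t) \<omega> - V u s \<omega>)) =
     distr M (borel \<Otimes>\<^sub>M borel) (\<lambda>\<omega>. (W u s \<omega> - W u 0 \<omega>, W u (s + t) \<omega> - W u s \<omega>))"
    using assms V_0[of _ u] by (auto intro!: distr_cong simp: V_def)
  have "(\<lambda>\<omega>. V u (s + t) \<omega> - V u s \<omega>) = (\<lambda>\<omega>. W u (s + t) \<omega> - W u s \<omega>)"
    using assms by (auto simp: V_def)
  then show ?thesis using I eq unfolding indep_var_distribution_eq by simp
qed

text \<open>The displacement up to time \<open>s + t\<close> is the sum of two independent pieces,
  and the second is distributed like a displacement over time \<open>t\<close>. Zero times are split
  off because increments are described only over intervals of positive length.\<close>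

lemma heat_heat:
  assumes st: "0 \<le> s" "0 \<le> t" and [measurable]: "f \<in> borel_measurable borel"
  shows "heat s (heat t f) y = heat (s + t) f y"
proof -
  consider "s = 0" | "t = 0" | "0 < s" "0 < t" using st by fastforce
  then show ?thesis
  proof cases
    assume [simp]: "s = 0"
    have "heat 0 (heat t f) y = (\<integral>\<^sup>+\<omega>. heat t f y \<partial>M)"
      unfolding heat_def[of 0] by (intro nn_integral_cong) (simp add: V_nonpos)
    then show ?thesis by (simp add: emeasure_space_1)
  next
    assume [simp]: "t = 0"
    have "heat 0 f = f"
    proof
      fix z have "heat 0 f z = (\<integral>\<^sup>+\<omega>. f z \<partial>M)"
        unfolding heat_def[of 0] by (intro nn_integral_cong) (simp add: V_nonpos)
      then show "heat 0 f z = f z" by (simp add: emeasure_space_1)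
    qed
    then show ?thesis by simp
  next
    assume st: "0 < s" "0 < t"
    let ?X = "V [] s" and ?Y = "\<lambda>\<omega>. V [] (s + t) \<omega> - V [] s \<omega>"
    have [measurable]: "?X \<in> borel_measurable M" "?Y \<in> borel_measurable M" by measurable
    interpret Y: prob_space "distr M borel ?Y" by (rule prob_space_distr) measurable
    have D: "distr M borel ?X \<Otimes>\<^sub>M distr M borel ?Y = distr M (borel \<Otimes>\<^sub>M borel) (\<lambda>\<omega>. (?X \<omega>, ?Y \<omega>))"
      using indep_increments[OF st, of "[]"] by (simp add: indep_var_distribution_eq)
    have m: "(\<lambda>p. f (y + fst p + snd p)) \<in> borel_measurable (borel \<Otimes>\<^sub>M borel)" by measurable
    have "heat (s + t) f y = (\<integral>\<^sup>+\<omega>. (\<lambda>p. f (y + fst p + snd p)) (?X \<omega>, ?Y \<omega>) \<partial>M)"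
      by (simp add: heat_def algebra_simps)
    also have "\<dots> = (\<integral>\<^sup>+p. f (y + fst p + snd p) \<partial>(distr M borel ?X \<Otimes>\<^sub>M distr M borel ?Y))"
      unfolding D by (subst nn_integral_distr) (use m in auto)
    also have "\<dots> = (\<integral>\<^sup>+x. (\<integral>\<^sup>+z. f (y + x + z) \<partial>distr M borel ?Y) \<partial>distr M borel ?X)"
      using m by (subst Y.nn_integral_fst[symmetric]) (simp_all cong: measurable_cong_sets)
    also have "\<dots> = (\<integral>\<^sup>+x. heat t f (y + x) \<partial>distr M borel ?X)"
    proof (intro nn_integral_cong)
      fix x
      have "(\<integral>\<^sup>+z. f (y + x + z) \<partial>distr M borel ?Y) = (\<integral>\<^sup>+\<omega>. f (y + x + ?Y \<omega>) \<partial>M)"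
        by (subst nn_integral_distr) auto
      also have "\<dots> = heat t f (y + x)"
        using increment_integral_heat[of "\<lambda>z. f (y + x + z)" s "s + t" "[]"] st
        by (simp add: heat_translate)
      finally show "(\<integral>\<^sup>+z. f (y + x + z) \<partial>distr M borel ?Y) = heat t f (y + x)" .
    qed
    also have "\<dots> = heat s (heat t f) y"
      by (subst nn_integral_distr) (auto simp: heat_def[of s])
    finally show ?thesis by simp
  qed
qed

subsection \<open>Averaging over an exponential lifetime\<close>

text \<open>The expected payoff at an exponential clock of rate \<beta>: \<open>F s\<close> if it
  rings at a time \<open>s \<le> t\<close>, and \<open>c\<close> if it has not rung by time
  \<open>t\<close>.\<close>

definition lifetime_mean :: "real \<Rightarrow> ennreal \<Rightarrow> (real \<Rightarrow> ennreal) \<Rightarrow> ennreal" where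
  "lifetime_mean t c F = ennreal (exp (- \<beta> * t)) * c +
     (\<integral>\<^sup>+s. ennreal (\<beta> * exp (- \<beta> * s)) * F s * indicator {0..t} s \<partial>lborel)"

lemma lifetime_integral:
  assumes [measurable]: "F \<in> borel_measurable borel" and t: "0 \<le> t"
  shows "(\<integral>\<^sup>+\<omega>. (if t < \<tau> u \<omega> then c else F (\<tau> u \<omega>)) \<partial>M) = lifetime_mean t c F"
proof -
  have sp: "(\<integral>\<^sup>+\<omega>. (if t < \<tau> u \<omega> then c else F (\<tau> u \<omega>)) \<partial>M) =
    (\<integral>\<^sup>+\<omega>. c * indicator {\<omega>\<in>space M. t < \<tau> u \<omega>} \<omega> + F (\<tau> u \<omega>) * indicator {..t} (\<tau> u \<omega>) \<partial>M)"
    by (intro nn_integral_cong) (auto simp: indicator_def)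
  also have "\<dots> = c * emeasure M {\<omega>\<in>space M. t < \<tau> u \<omega>} + (\<integral>\<^sup>+\<omega>. F (\<tau> u \<omega>) * indicator {..t} (\<tau> u \<omega>) \<partial>M)"
    by (subst nn_integral_add) (auto simp: nn_integral_cmult)
  also have "emeasure M {\<omega>\<in>space M. t < \<tau> u \<omega>} = ennreal (exp (- \<beta> * t))"
    using exponential_distributedD_gt[OF lifetime_exponential t rate_pos, of u]
    by (simp add: emeasure_eq_measure mult.commute)
  also have "(\<integral>\<^sup>+\<omega>. F (\<tau> u \<omega>) * indicator {..t} (\<tau> u \<omega>) \<partial>M) =
      (\<integral>\<^sup>+s. ennreal (exponential_density \<beta> s) * (F s * indicator {..t} s) \<partial>lborel)"
    by (rule distributed_nn_integral[OF lifetime_exponential, symmetric]) measurable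
  also have "\<dots> = (\<integral>\<^sup>+s. ennreal (\<beta> * exp (- \<beta> * s)) * F s * indicator {0..t} s \<partial>lborel)"
    by (intro nn_integral_cong) (auto simp: exponential_density_def indicator_def mult.commute)
  finally show ?thesis by (simp add: lifetime_mean_def mult.commute)
qed

lemma lifetime_mean_measurable [measurable (raw)]:
  assumes [measurable]: "t \<in> borel_measurable N" "c \<in> borel_measurable N" "case_prod F \<in> borel_measurable (N \<Otimes>\<^sub>M borel)"
  shows "(\<lambda>x. lifetime_mean (t x) (c x) (F x)) \<in> borel_measurable N"
proof -
  have [measurable]: "Measurable.pred (N \<Otimes>\<^sub>M borel) (\<lambda>p. snd p \<in> {0..t (fst p)})"
    unfolding atLeastAtMost_iff by measurable
  have [measurable]: "(\<lambda>p. indicator {0..t (fst p)} (snd p) :: ennreal) \<in> borel_measurable (N \<Otimes>\<^sub>M borel)"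
    unfolding indicator_def by measurable
  have "(\<lambda>p. ennreal (\<beta> * exp (- \<beta> * snd p)) * F (fst p) (snd p) * indicator {0..t (fst p)} (snd p))
     \<in> borel_measurable (N \<Otimes>\<^sub>M lborel)" by measurable
  then show ?thesis unfolding lifetime_mean_def
    by (intro borel_measurable_add borel_measurable_times lborel.borel_measurable_nn_integral)
       (auto simp: case_prod_beta')
qed

lemma lifetime_mean_mono: "c \<le> c' \<Longrightarrow> (\<And>s. 0 \<le> s \<Longrightarrow> s \<le> t \<Longrightarrow> F s \<le> F' s) \<Longrightarrow> lifetime_mean t c F \<le> lifetime_mean t c' F'"
  unfolding lifetime_mean_def
  by (intro add_mono mult_left_mono nn_integral_mono) (auto simp: indicator_def mult_left_mono)

text \<open>Lifetime and path of one particle are different sources. With the lifetime frozen,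
  evaluating the path at the random death time becomes an application of the semigroup at a fixed
  time.\<close>

lemma root_integral:
  assumes [measurable]: "f \<in> borel_measurable borel" "case_prod F \<in> borel_measurable (borel \<Otimes>\<^sub>M borel)"
    and t: "0 \<le> t"
  shows "(\<integral>\<^sup>+\<omega>. (if t < \<tau> u \<omega> then f (y + V u t \<omega>) else F (\<tau> u \<omega>) (y + V u (\<tau> u \<omega>) \<omega>)) \<partial>M)
    = lifetime_mean t (heat t f y) (\<lambda>s. heat s (F s) y)"
proof -
  have [measurable]: "\<tau> u \<in> borel_measurable (info {Inl u})"
    by (rule lifetime_measurable_info) simp
  note [measurable (raw)] = V_measurable_info_comp[where u = u and A = "{Inr u}", simplified]
  let ?h = "\<lambda>p. if t < \<tau> u (fst p) then f (y + V u t (snd p))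
    else F (\<tau> u (fst p)) (y + V u (\<tau> u (fst p)) (snd p))"
  have "?h \<in> borel_measurable (info {Inl u} \<Otimes>\<^sub>M info {Inr u})" by measurable
  from nn_integral_freeze[OF _ this]
  have "(\<integral>\<^sup>+\<omega>. (if t < \<tau> u \<omega> then f (y + V u t \<omega>) else F (\<tau> u \<omega>) (y + V u (\<tau> u \<omega>) \<omega>)) \<partial>M)
     = (\<integral>\<^sup>+\<omega>. \<integral>\<^sup>+\<omega>'. ?h (\<omega>, \<omega>') \<partial>M \<partial>M)" by (simp cong: if_cong)
  also have "\<dots> = (\<integral>\<^sup>+\<omega>. (if t < \<tau> u \<omega> then heat t f y else heat (\<tau> u \<omega>) (F (\<tau> u \<omega>)) y) \<partial>M)"
    by (intro nn_integral_cong) (simp add: V_integral_heat)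
  also have "\<dots> = lifetime_mean t (heat t f y) (\<lambda>s. heat s (F s) y)"
    using t by (intro lifetime_integral) measurable
  finally show ?thesis .
qed

subsection \<open>Truncation to finitely many generations\<close>

text \<open>Number of descendants of \<open>u\<close> in \<open>A\<close> at time \<open>t\<close> among the first \<open>n\<close> generations, when \<open>u\<close> is born at
  time \<open>0\<close> at the position \<open>y\<close>.\<close>

primrec trunc_count :: "nat \<Rightarrow> 'a set \<Rightarrow> particle \<Rightarrow> real \<Rightarrow> 'a \<Rightarrow> 'w \<Rightarrow> real" where
  "trunc_count 0 A u t y \<omega> = 0"
| "trunc_count (Suc n) A u t y \<omega> =
    (if t < \<tau> u \<omega> then indicator A (y + V u t \<omega>)
     else trunc_count n A (u @ [False]) (t - \<tau> u \<omega>) (y + V u (\<tau> u \<omega>) \<omega>) \<omega>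
        + trunc_count n A (u @ [True]) (t - \<tau> u \<omega>) (y + V u (\<tau> u \<omega>) \<omega>) \<omega>)"

text \<open>The sources on which the population descending from \<open>u\<close> depends. The
  subtrees of two siblings are disjoint from each other and from the two sources of their parent;
  the branching property rests on this.\<close>

definition subtree :: "particle \<Rightarrow> (particle + particle) set" where
  "subtree u = range (\<lambda>w. Inl (u @ w)) \<union> range (\<lambda>w. Inr (u @ w))"

lemma subtree_root: "Inl u \<in> subtree u" "Inr u \<in> subtree u"
  by (auto simp: subtree_def intro: image_eqI[where x = "[]"])

lemma subtree_child: "subtree (u @ [x]) \<subseteq> subtree u"
  by (auto simp: subtree_def)

lemma subtree_disjoint: "subtree (u @ [False]) \<inter> subtree (u @ [True]) = {}"
  by (auto simp: subtree_def)

lemma root_subtree_disjoint: "{Inl u, Inr u} \<inter> (subtree (u @ [False]) \<union> subtree (u @ [True])) = {}"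
  by (auto simp: subtree_def)

lemma trunc_count_nonneg [simp]: "0 \<le> trunc_count n A u t y \<omega>"
  by (induction n arbitrary: u t y) auto

text \<open>The start data \<open>f\<close>, \<open>h\<close> and the sample point \<open>k\<close>
  may vary independently, because the induction restarts the children at a random time and place
  that belong to the sources of the parent.\<close>

lemma trunc_count_measurable_info:
  assumes [measurable]: "A \<in> sets borel"
    and B: "subtree u \<subseteq> B" and k: "k \<in> measurable N (info B)"
    and f: "f \<in> borel_measurable N" and h: "h \<in> borel_measurable N"
  shows "(\<lambda>x. trunc_count n A u (f x) (h x) (k x)) \<in> borel_measurable N"
  using f h B
proof (induction n arbitrary: u f h)
  case (Suc n)
  have u: "Inl u \<in> B" "Inr u \<in> B" using Suc.prems(3) subtree_root[of u] by auto
  have sub: "subtree (u @ [x]) \<subseteq> B" for x using Suc.prems(3) subtree_child[of u x] by auto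
  note Suc.prems(1,2)[measurable]
  have [measurable]: "(\<lambda>x. \<tau> u (k x)) \<in> borel_measurable N"
    by (rule measurable_compose[OF k lifetime_measurable_info[OF u(1)]])
  have V [measurable (raw)]: "(\<lambda>x. V u (a x) (k x)) \<in> borel_measurable N"
    if "a \<in> borel_measurable N" for a
    by (rule V_measurable_info_comp[OF u(2) that k])
  have [measurable]: "(\<lambda>x. trunc_count n A (u @ [i]) (f x - \<tau> u (k x)) (h x + V u (\<tau> u (k x)) (k x)) (k x))
     \<in> borel_measurable N" for i
    by (intro Suc.IH sub) measurable
  have "(\<lambda>x. if f x < \<tau> u (k x) then indicator A (h x + V u (f x) (k x))
     else trunc_count n A (u @ [False]) (f x - \<tau> u (k x)) (h x + V u (\<tau> u (k x)) (k x)) (k x)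
        + trunc_count n A (u @ [True]) (f x - \<tau> u (k x)) (h x + V u (\<tau> u (k x)) (k x)) (k x) :: real)
     \<in> borel_measurable N" by measurable
  then show ?case by simp
qed simp

lemma trunc_count_measurable [measurable (raw)]:
  assumes "k \<in> measurable N M" "f \<in> borel_measurable N" "h \<in> borel_measurable N" "A \<in> sets borel"
  shows "(\<lambda>x. trunc_count n A u (f x) (h x) (k x)) \<in> borel_measurable N"
proof (rule trunc_count_measurable_info[OF assms(4) subset_UNIV _ assms(2,3)])
  show "k \<in> measurable N (info UNIV)"
    using assms(1) sets_info_subset by (auto simp: measurable_def)
qed

text \<open>The expectation of the product of \<open>g\<close> over the positions at time \<open>t\<close> of the particles of the
  first \<open>n\<close> generations, for an initial particle at \<open>y\<close>, written as a recursion over the first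
  branching time; later generations contribute the factor \<open>1\<close>.\<close>

primrec trunc_pgf :: "nat \<Rightarrow> ('a \<Rightarrow> ennreal) \<Rightarrow> real \<Rightarrow> 'a \<Rightarrow> ennreal" where
  "trunc_pgf 0 g = (\<lambda>t y. 1)"
| "trunc_pgf (Suc n) g = (\<lambda>t y. lifetime_mean t (heat t g y) (\<lambda>s. heat s (\<lambda>z. (trunc_pgf n g (t - s) z)\<^sup>2) y))"

lemma trunc_pgf_measurable [measurable (raw)]:
  assumes [measurable]: "g \<in> borel_measurable borel" and f: "f \<in> borel_measurable N" "h \<in> borel_measurable N"
  shows "(\<lambda>x. trunc_pgf n g (f x) (h x)) \<in> borel_measurable N"
proof -
  have "(\<lambda>p. trunc_pgf n g (fst p) (snd p)) \<in> borel_measurable (borel \<Otimes>\<^sub>M borel)"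
  proof (induction n)
    case (Suc n)
    have [measurable (raw)]: "(\<lambda>x. trunc_pgf n g (f x) (h x)) \<in> borel_measurable N"
      if "f \<in> borel_measurable N" "h \<in> borel_measurable N" for f h and N :: "'x measure"
      using measurable_compose[OF measurable_Pair[OF that] Suc] by simp
    show ?case unfolding trunc_pgf.simps by measurable
  qed simp
  from measurable_compose[OF measurable_Pair[OF f] this] show ?thesis by simp
qed

text \<open>Freezing the lifetime and path of \<open>u\<close> leaves two independent subtrees. By
  induction each contributes the same value at the branching point, hence the square in the
  recursion; averaging over the root is \<open>root_integral\<close>.\<close>

lemma exp_trunc_count_integral:
  assumes [measurable]: "A \<in> sets borel" and t: "0 \<le> t"
  shows "(\<integral>\<^sup>+\<omega>. ennreal (exp (- \<kappa> * trunc_count n A u t y \<omega>)) \<partial>M)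
    = trunc_pgf n (\<lambda>z. ennreal (exp (- \<kappa> * indicator A z))) t y"
  using t
proof (induction n arbitrary: u t y)
  case 0
  then show ?case by (simp add: emeasure_space_1)
next
  case (Suc n)
  let ?g = "\<lambda>z. ennreal (exp (- \<kappa> * indicator A z))"
  let ?B = "subtree (u @ [False]) \<union> subtree (u @ [True])"
  let ?c = "\<lambda>i p. ennreal (exp (- \<kappa> * trunc_count n A (u @ [i]) (t - \<tau> u (fst p)) (y + V u (\<tau> u (fst p)) (fst p)) (snd p)))"
  let ?h = "\<lambda>p. if t < \<tau> u (fst p) then ?g (y + V u t (fst p)) else ?c False p * ?c True p"
  let ?A = "{Inl u, Inr u}"
  have g [measurable]: "?g \<in> borel_measurable borel" by measurable
  have [measurable]: "\<tau> u \<in> borel_measurable (info ?A)"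
    by (rule lifetime_measurable_info) simp
  note V [measurable (raw)] = V_measurable_info_comp[where u = u and A = ?A, simplified]
  have sub: "subtree (u @ [i]) \<subseteq> ?B" for i by (cases i) auto
  have C [measurable]: "(\<lambda>p. trunc_count n A (u @ [i]) (t - \<tau> u (fst p)) (y + V u (\<tau> u (fst p)) (fst p)) (snd p))
      \<in> borel_measurable (info ?A \<Otimes>\<^sub>M info ?B)" for i
    by (rule trunc_count_measurable_info[OF _ sub]) measurable
  have "?h \<in> borel_measurable (info ?A \<Otimes>\<^sub>M info ?B)" by measurable
  from nn_integral_freeze[OF root_subtree_disjoint this]
  have "(\<integral>\<^sup>+\<omega>. ?h (\<omega>, \<omega>) \<partial>M) = (\<integral>\<^sup>+\<omega>. \<integral>\<^sup>+\<omega>'. ?h (\<omega>, \<omega>') \<partial>M \<partial>M)" .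
  also have "\<dots> = (\<integral>\<^sup>+\<omega>. (if t < \<tau> u \<omega> then ?g (y + V u t \<omega>)
      else (\<lambda>s z. (trunc_pgf n ?g (t - s) z)\<^sup>2) (\<tau> u \<omega>) (y + V u (\<tau> u \<omega>) \<omega>)) \<partial>M)"
  proof (intro nn_integral_cong)
    fix \<omega> assume "\<omega> \<in> space M"
    show "(\<integral>\<^sup>+\<omega>'. ?h (\<omega>, \<omega>') \<partial>M) = (if t < \<tau> u \<omega> then ?g (y + V u t \<omega>)
      else (\<lambda>s z. (trunc_pgf n ?g (t - s) z)\<^sup>2) (\<tau> u \<omega>) (y + V u (\<tau> u \<omega>) \<omega>))"
    proof (cases "t < \<tau> u \<omega>")
      case True
      then show ?thesis by (simp add: emeasure_space_1)
    next
      case False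
      have "(\<integral>\<^sup>+\<omega>'. ?c False (\<omega>, \<omega>') * ?c True (\<omega>, \<omega>') \<partial>M) = 
         (\<integral>\<^sup>+\<omega>'. ?c False (\<omega>, \<omega>') \<partial>M) * (\<integral>\<^sup>+\<omega>'. ?c True (\<omega>, \<omega>') \<partial>M)"
      proof -
        have c: "(\<lambda>\<omega>'. trunc_count n A (u @ [i]) a b \<omega>') \<in> borel_measurable (info (subtree (u @ [i])))" for i a b
          by (rule trunc_count_measurable_info[where B = "subtree (u @ [i])"]) auto
        have "(\<lambda>\<omega>'. ?c i (\<omega>, \<omega>')) \<in> borel_measurable (info (subtree (u @ [i])))" for i
          using measurable_compose[OF c[of i "t - \<tau> u \<omega>" "y + V u (\<tau> u \<omega>) \<omega>"],
            of "\<lambda>x. ennreal (exp (- \<kappa> * x))" borel] by simp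
        from indep_nn_integral_mult[OF subtree_disjoint this this] show ?thesis .
      qed
      also have "\<dots> = (trunc_pgf n ?g (t - \<tau> u \<omega>) (y + V u (\<tau> u \<omega>) \<omega>))\<^sup>2"
        using False by (simp add: Suc.IH[simplified] power2_eq_square)
      finally show ?thesis using False by simp
    qed
  qed
  also have "\<dots> = lifetime_mean t (heat t ?g y) (\<lambda>s. heat s (\<lambda>z. (trunc_pgf n ?g (t - s) z)\<^sup>2) y)"
    by (rule root_integral) (use Suc.prems in \<open>measurable; simp\<close>)+
  also have "(\<integral>\<^sup>+\<omega>. ?h (\<omega>, \<omega>) \<partial>M) = (\<integral>\<^sup>+\<omega>. ennreal (exp (- \<kappa> * trunc_count (Suc n) A u t y \<omega>)) \<partial>M)"
    by (intro nn_integral_cong)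
       (simp add: ennreal_mult[symmetric] exp_add[symmetric] distrib_left)
  finally show ?case by simp
qed

end

section \<open>Truncated counts and the actual particle system\<close>

lemma birth_time_snoc: "birth_time \<tau> (u @ [x]) \<omega> = birth_time \<tau> u \<omega> + \<tau> u \<omega>"
  by (simp add: birth_time_def)

lemma birth_position_snoc:
  "birth_position \<tau> W (u @ [x]) \<omega> = birth_position \<tau> W u \<omega> + W u (\<tau> u \<omega>) \<omega>"
  by (simp add: birth_position_def)

context dyadic_bbm
begin

lemma birth_time_append:
  assumes "\<omega> \<in> space M"
  shows "birth_time \<tau> u \<omega> \<le> birth_time \<tau> (u @ v) \<omega>"
proof (induction v rule: rev_induct)
  case (snoc x v)
  then show ?case
    using birth_time_snoc[of \<tau> "u @ v" x \<omega>] lifetime_nonneg[OF assms, of "u @ v"] by simp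
qed simp

definition alive_upto :: "nat \<Rightarrow> 'a set \<Rightarrow> particle \<Rightarrow> real \<Rightarrow> 'w \<Rightarrow> particle set" where
  "alive_upto n A u t \<omega> =
    {u @ v |v. length v < n \<and> u @ v \<in> alive \<tau> t \<omega> \<and> position \<tau> W t (u @ v) \<omega> \<in> A}"

lemma finite_alive_below [simp]: "finite (alive_upto n A u t \<omega>)"
proof (rule finite_subset)
  show "alive_upto n A u t \<omega> \<subseteq> (\<lambda>v. u @ v) ` {v. set v \<subseteq> UNIV \<and> length v \<le> n}"
    by (auto simp: alive_upto_def)
  show "finite ((\<lambda>v. u @ v) ` {v. set v \<subseteq> UNIV \<and> length v \<le> n})"
    by (intro finite_imageI finite_lists_length_le) simp
qed

text \<open>As long as \<open>u\<close> lives, none of its proper descendants has been born; after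
  its death the living descendants split into the disjoint populations of the two children. The
  recursion of \<open>trunc_count\<close> follows this dichotomy.\<close>

lemma trunc_count_eq_card:
  assumes w: "\<omega> \<in> space M" and "birth_time \<tau> u \<omega> \<le> t"
  shows "trunc_count n A u (t - birth_time \<tau> u \<omega>) (birth_position \<tau> W u \<omega>) \<omega> = real (card (alive_upto n A u t \<omega>))"
  using assms(2)
proof (induction n arbitrary: u)
  case 0
  then show ?case by (simp add: alive_upto_def)
next
  case (Suc n)
  show ?case
  proof (cases "t < birth_time \<tau> u \<omega> + \<tau> u \<omega>")
    case True
    have "v = []" if "u @ v \<in> alive \<tau> t \<omega>" for v
    proof (rule ccontr)
      assume "v \<noteq> []"
      then obtain x v' where "v = x # v'" by (cases v) auto
      then have "birth_time \<tau> u \<omega> + \<tau> u \<omega> \<le> birth_time \<tau> (u @ v) \<omega>"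
        using birth_time_append[OF w, of "u @ [x]" v'] by (simp add: birth_time_snoc)
      then show False using that True by (simp add: alive_def)
    qed
    moreover have "u \<in> alive \<tau> t \<omega>" using True Suc.prems by (simp add: alive_def)
    ultimately have "u @ v \<in> alive \<tau> t \<omega> \<longleftrightarrow> v = []" for v by auto
    then have "alive_upto (Suc n) A u t \<omega> = (if position \<tau> W t u \<omega> \<in> A then {u} else {})"
      unfolding alive_upto_def by simp
    then show ?thesis using True Suc.prems by (simp add: position_def V_def)
  next
    case False
    let ?S = "\<lambda>i. alive_upto n A (u @ [i]) t \<omega>"
    have nu: "u \<notin> alive \<tau> t \<omega>" using False by (simp add: alive_def)
    have "alive_upto (Suc n) A u t \<omega> = ?S False \<union> ?S True"
    proof (intro equalityI subsetI)
      fix x assume "x \<in> alive_upto (Suc n) A u t \<omega>"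
      then obtain v where v: "x = u @ v" "length v < Suc n" "x \<in> alive \<tau> t \<omega>" "position \<tau> W t x \<omega> \<in> A"
        by (auto simp: alive_upto_def)
      with nu obtain i v' where "v = i # v'" by (cases v) auto
      with v have "x \<in> ?S i" by (auto simp: alive_upto_def)
      then show "x \<in> ?S False \<union> ?S True" by (cases i) auto
    next
      fix x assume "x \<in> ?S False \<union> ?S True"
      then obtain i v' where "x = u @ i # v'" "length v' < n" "x \<in> alive \<tau> t \<omega>" "position \<tau> W t x \<omega> \<in> A"
        by (auto simp: alive_upto_def)
      then show "x \<in> alive_upto (Suc n) A u t \<omega>" by (auto simp: alive_upto_def)
    qed
    moreover have "?S False \<inter> ?S True = {}" by (auto simp: alive_upto_def)
    ultimately have "card (alive_upto (Suc n) A u t \<omega>) = card (?S False) + card (?S True)"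
      by (simp add: card_Un_disjoint)
    moreover have "trunc_count n A (u @ [i]) (t - birth_time \<tau> u \<omega> - \<tau> u \<omega>)
       (birth_position \<tau> W u \<omega> + V u (\<tau> u \<omega>) \<omega>) \<omega> = card (?S i)" for i
      using Suc.IH[of "u @ [i]"] False lifetime_nonneg[OF w, of u]
      by (simp add: birth_time_snoc birth_position_snoc V_def algebra_simps)
    ultimately show ?thesis using False by simp
  qed
qed

lemma trunc_count_root_eq_card:
  assumes "\<omega> \<in> space M" "0 \<le> t"
  shows "trunc_count n A [] t 0 \<omega> = real (card (alive_upto n A [] t \<omega>))"
  using trunc_count_eq_card[OF assms(1), of "[]" t n A] assms(2)
  by (simp add: birth_time_def birth_position_def)

text \<open>Every label has finite length, so the truncated populations increase to the whole one,
  and continuity from below of the counting measure applies, also for an infinite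
  population.\<close>

lemma particle_count_eq_SUP:
  assumes "\<omega> \<in> space M" "0 \<le> t"
  shows "particle_count \<tau> W t A \<omega> = (SUP n. ennreal (trunc_count n A [] t 0 \<omega>))"
proof -
  have "{u \<in> alive \<tau> t \<omega>. position \<tau> W t u \<omega> \<in> A} = (\<Union>n. alive_upto n A [] t \<omega>)"
    by (auto simp: alive_upto_def)
  moreover have "incseq (\<lambda>n. alive_upto n A [] t \<omega>)"
    by (auto simp: incseq_def alive_upto_def)
  ultimately have "particle_count \<tau> W t A \<omega> =
     (SUP n. emeasure (count_space UNIV) (alive_upto n A [] t \<omega>))"
    unfolding particle_count_def by (subst SUP_emeasure_incseq) auto
  then show ?thesis using assms by (simp add: trunc_count_root_eq_card ennreal_of_nat_eq_real_of_nat)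
qed

lemma trunc_count_root_mono:
  assumes "\<omega> \<in> space M" "0 \<le> t" "m \<le> n"
  shows "trunc_count m A [] t 0 \<omega> \<le> trunc_count n A [] t 0 \<omega>"
proof -
  have "alive_upto m A [] t \<omega> \<subseteq> alive_upto n A [] t \<omega>"
    using assms(3) by (auto simp: alive_upto_def)
  then show ?thesis using assms by (simp add: trunc_count_root_eq_card card_mono)
qed

lemma particle_count_measurable:
  assumes "A \<in> sets borel" "0 \<le> t"
  shows "particle_count \<tau> W t A \<in> borel_measurable M"
proof -
  have "(\<lambda>\<omega>. SUP n. ennreal (trunc_count n A [] t 0 \<omega>)) \<in> borel_measurable M"
    using assms by measurable
  then show ?thesis
    by (rule measurable_cong[THEN iffD1, rotated]) (simp add: particle_count_eq_SUP assms)
qed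

section \<open>Calculus of the recursion and the branching inequality\<close>

text \<open>Serves to check explicit solutions of the recursion: it suffices to exhibit an
  antiderivative \<open>F\<close> of the payoff weighted by the exponential density.\<close>

lemma lifetime_mean_FTC:
  assumes t: "0 \<le> t" and c: "0 \<le> c" and [measurable]: "\<phi> \<in> borel_measurable borel"
    and \<phi>: "\<And>s. 0 \<le> s \<Longrightarrow> s \<le> t \<Longrightarrow> 0 \<le> \<phi> s"
    and D: "\<And>s. 0 \<le> s \<Longrightarrow> s \<le> t \<Longrightarrow> (F has_real_derivative \<beta> * exp (- \<beta> * s) * \<phi> s) (at s)"
  shows "lifetime_mean t (ennreal c) (\<lambda>s. ennreal (\<phi> s)) = ennreal (exp (- \<beta> * t) * c + (F t - F 0))"
proof -
  have "(\<integral>\<^sup>+s. ennreal (\<beta> * exp (- \<beta> * s)) * ennreal (\<phi> s) * indicator {0..t} s \<partial>lborel)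
     = (\<integral>\<^sup>+s. ennreal (\<beta> * exp (- \<beta> * s) * \<phi> s) * indicator {0..t} s \<partial>lborel)"
    using rate_pos \<phi> by (intro nn_integral_cong) (auto simp: ennreal_mult indicator_def)
  also have "\<dots> = ennreal (F t - F 0)"
    using t rate_pos \<phi> by (intro nn_integral_FTC_Icc DERIV_subset[OF D]) auto
  finally have e: "(\<integral>\<^sup>+s. ennreal (\<beta> * exp (- \<beta> * s)) * ennreal (\<phi> s) * indicator {0..t} s \<partial>lborel) = ennreal (F t - F 0)" .
  have "F 0 \<le> F t"
    using t rate_pos by (intro DERIV_nonneg_imp_nondecreasing[OF t]) (auto intro!: exI D \<phi> mult_nonneg_nonneg)
  then show ?thesis unfolding lifetime_mean_def e using c by (simp add: ennreal_mult ennreal_plus)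
qed

lemma lifetime_mean_one:
  assumes "0 \<le> t" shows "lifetime_mean t 1 (\<lambda>_. 1) = 1"
proof -
  have "lifetime_mean t (ennreal 1) (\<lambda>_. ennreal 1) =
      ennreal (exp (- \<beta> * t) * 1 + (- exp (- \<beta> * t) - - exp (- \<beta> * 0)))"
    using assms by (rule lifetime_mean_FTC) (auto intro!: derivative_eq_intros)
  then show ?thesis by simp
qed

lemma lifetime_mean_le_one:
  assumes "0 \<le> t" "c \<le> 1" "\<And>s. 0 \<le> s \<Longrightarrow> s \<le> t \<Longrightarrow> F s \<le> 1"
  shows "lifetime_mean t c F \<le> 1"
  using lifetime_mean_mono[of c 1 t F "\<lambda>_. 1"] assms lifetime_mean_one by simp

text \<open>The lack of memory of the exponential law.\<close>

lemma lifetime_mean_add: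
  assumes [measurable]: "F \<in> borel_measurable borel" and ts: "0 \<le> t" "0 \<le> s"
  shows "lifetime_mean (t + s) c F = lifetime_mean t (lifetime_mean s c (\<lambda>r. F (t + r))) F"
proof -
  let ?f = "\<lambda>r. ennreal (\<beta> * exp (- \<beta> * r)) * F r"
  have "(\<integral>\<^sup>+r. ?f r * indicator {0..t + s} r \<partial>lborel) =
      (\<integral>\<^sup>+r. ?f r * indicator {t<..t + s} r + ?f r * indicator {0..t} r \<partial>lborel)"
    using ts by (intro nn_integral_cong) (auto simp: indicator_def)
  also have "\<dots> = (\<integral>\<^sup>+r. ?f r * indicator {t<..t + s} r \<partial>lborel) + (\<integral>\<^sup>+r. ?f r * indicator {0..t} r \<partial>lborel)"
    by (rule nn_integral_add) measurable
  also have "(\<integral>\<^sup>+r. ?f r * indicator {t<..t + s} r \<partial>lborel) =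
      (\<integral>\<^sup>+r. ?f (t + r) * indicator {t<..t + s} (t + r) \<partial>lborel)"
    using nn_integral_real_affine[of "\<lambda>r. ?f r * indicator {t<..t + s} r" 1 t] by simp
  also have "\<dots> = (\<integral>\<^sup>+r. ennreal (exp (- \<beta> * t)) * (ennreal (\<beta> * exp (- \<beta> * r)) * F (t + r) * indicator {0..s} r) \<partial>lborel)"
  proof (rule nn_integral_cong_AE)
    show "AE r in lborel. ?f (t + r) * indicator {t<..t + s} (t + r) =
       ennreal (exp (- \<beta> * t)) * (ennreal (\<beta> * exp (- \<beta> * r)) * F (t + r) * indicator {0..s} r)"
      using AE_lborel_singleton[of "0::real"]
    proof eventually_elim
      case (elim r)
      have "ennreal (\<beta> * exp (- \<beta> * (t + r))) = ennreal (exp (- \<beta> * t)) * ennreal (\<beta> * exp (- \<beta> * r))"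
        using rate_pos by (simp add: ennreal_mult[symmetric] exp_add[symmetric] algebra_simps)
      then show ?case using elim by (auto simp: indicator_def mult_ac)
    qed
  qed
  also have "\<dots> = ennreal (exp (- \<beta> * t)) * (\<integral>\<^sup>+r. ennreal (\<beta> * exp (- \<beta> * r)) * F (t + r) * indicator {0..s} r \<partial>lborel)"
    by (rule nn_integral_cmult) measurable
  finally have "(\<integral>\<^sup>+r. ?f r * indicator {0..t + s} r \<partial>lborel) =
     ennreal (exp (- \<beta> * t)) * (\<integral>\<^sup>+r. ennreal (\<beta> * exp (- \<beta> * r)) * F (t + r) * indicator {0..s} r \<partial>lborel)
     + (\<integral>\<^sup>+r. ?f r * indicator {0..t} r \<partial>lborel)" .
  moreover have "ennreal (exp (- \<beta> * (t + s))) = ennreal (exp (- \<beta> * t)) * ennreal (exp (- \<beta> * s))"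
    by (simp add: ennreal_mult[symmetric] exp_add[symmetric] algebra_simps)
  ultimately show ?thesis by (simp add: lifetime_mean_def distrib_left mult_ac add_ac)
qed

lemma heat_lifetime_mean:
  assumes [measurable]: "c \<in> borel_measurable borel" "case_prod F \<in> borel_measurable (borel \<Otimes>\<^sub>M borel)"
  shows "heat t (\<lambda>z. lifetime_mean s (c z) (\<lambda>r. F r z)) y = lifetime_mean s (heat t c y) (\<lambda>r. heat t (F r) y)"
proof -
  interpret L: pair_sigma_finite M "lborel :: real measure" ..
  let ?e = "\<lambda>r. ennreal (\<beta> * exp (- \<beta> * r))"
  have "(\<integral>\<^sup>+\<omega>. \<integral>\<^sup>+r. ?e r * F r (y + V [] t \<omega>) * indicator {0..s} r \<partial>lborel \<partial>M) =
      (\<integral>\<^sup>+r. \<integral>\<^sup>+\<omega>. ?e r * F r (y + V [] t \<omega>) * indicator {0..s} r \<partial>M \<partial>lborel)"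
    by (rule L.Fubini'[symmetric]) measurable
  also have "\<dots> = (\<integral>\<^sup>+r. ?e r * heat t (F r) y * indicator {0..s} r \<partial>lborel)"
    unfolding heat_def by (simp add: nn_integral_cmult nn_integral_multc)
  finally have "(\<integral>\<^sup>+\<omega>. \<integral>\<^sup>+r. ?e r * F r (y + V [] t \<omega>) * indicator {0..s} r \<partial>lborel \<partial>M) =
     (\<integral>\<^sup>+r. ?e r * heat t (F r) y * indicator {0..s} r \<partial>lborel)" .
  moreover have "(\<integral>\<^sup>+\<omega>. ennreal (exp (- \<beta> * s)) * c (y + V [] t \<omega>) \<partial>M) = ennreal (exp (- \<beta> * s)) * heat t c y"
    unfolding heat_def by (rule nn_integral_cmult) measurable
  moreover have "heat t (\<lambda>z. lifetime_mean s (c z) (\<lambda>r. F r z)) y =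
      (\<integral>\<^sup>+\<omega>. ennreal (exp (- \<beta> * s)) * c (y + V [] t \<omega>) \<partial>M) +
      (\<integral>\<^sup>+\<omega>. \<integral>\<^sup>+r. ?e r * F r (y + V [] t \<omega>) * indicator {0..s} r \<partial>lborel \<partial>M)"
    unfolding heat_def lifetime_mean_def by (rule nn_integral_add) measurable
  ultimately show ?thesis by (simp add: lifetime_mean_def)
qed

lemma ennreal_sq_mono: "(a :: ennreal) \<le> b \<Longrightarrow> a\<^sup>2 \<le> b\<^sup>2"
  by (simp add: power2_eq_square mult_mono)

lemma trunc_pgf_mono:
  assumes "\<And>z. g z \<le> g' z"
  shows "trunc_pgf n g t y \<le> trunc_pgf n g' t y"
  by (induction n arbitrary: t y)
     (auto intro!: lifetime_mean_mono heat_mono ennreal_sq_mono assms)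

lemma trunc_pgf_le_one:
  assumes "\<And>z. g z \<le> 1" "0 \<le> t"
  shows "trunc_pgf n g t y \<le> 1"
  using assms(2)
proof (induction n arbitrary: t y)
  case (Suc n)
  have "heat s (\<lambda>z. (trunc_pgf n g (t - s) z)\<^sup>2) y \<le> 1" if "s \<le> t" for s
    using heat_mono[of "\<lambda>z. (trunc_pgf n g (t - s) z)\<^sup>2" "\<lambda>_. 1" s y] ennreal_sq_mono[OF Suc.IH[of "t - s"]] that
    by simp
  moreover have "heat t g y \<le> 1" using heat_mono[of g "\<lambda>_. 1" t y] assms(1) by simp
  ultimately show ?case using Suc.prems by (auto intro!: lifetime_mean_le_one)
qed simp

text \<open>Further generations only bring in further factors, all at most one.\<close>

lemma trunc_pgf_antimono:
  assumes g: "\<And>z. g z \<le> 1" and "0 \<le> t" "m \<le> n"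
  shows "trunc_pgf n g t y \<le> trunc_pgf m g t y"
proof -
  have decr: "trunc_pgf (Suc k) g t y \<le> trunc_pgf k g t y" if "0 \<le> t" for k t y
    using that
  proof (induction k arbitrary: t y)
    case 0
    then show ?case using trunc_pgf_le_one[of g t "Suc 0" y] g by simp
  next
    case (Suc k)
    then show ?case unfolding trunc_pgf.simps(2)[of "Suc k"] trunc_pgf.simps(2)[of k]
      by (intro lifetime_mean_mono heat_mono ennreal_sq_mono) auto
  qed
  show ?thesis
    using assms(3)
  proof (induction n rule: dec_induct)
    case (step k)
    show ?case by (rule order.trans[OF decr[OF assms(2)] step.IH])
  qed simp
qed

text \<open>The Markov property of the root at time \<open>t\<close>: if it has not branched by
  then, its remaining lifetime is again exponential and its position is distributed according to
  \<open>heat t\<close>, so the future is a fresh copy of the recursion over time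
  \<open>s\<close>.\<close>

lemma trunc_pgf_Suc_add:
  assumes [measurable]: "g \<in> borel_measurable borel" and ts: "0 \<le> t" "0 \<le> s"
  shows "trunc_pgf (Suc k) g (t + s) y =
    lifetime_mean t (heat t (trunc_pgf (Suc k) g s) y) (\<lambda>r. heat r (\<lambda>z. (trunc_pgf k g (t + s - r) z)\<^sup>2) y)"
proof -
  have "heat t (trunc_pgf (Suc k) g s) y =
      lifetime_mean s (heat t (heat s g) y) (\<lambda>r. heat t (heat r (\<lambda>z. (trunc_pgf k g (s - r) z)\<^sup>2)) y)"
    unfolding trunc_pgf.simps by (rule heat_lifetime_mean) measurable
  also have "\<dots> = lifetime_mean s (heat (t + s) g y) (\<lambda>r. heat (t + r) (\<lambda>z. (trunc_pgf k g (t + s - (t + r)) z)\<^sup>2) y)"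
    using ts unfolding lifetime_mean_def
    by (intro arg_cong2[where f = "(+)"] nn_integral_cong)
       (auto simp: heat_heat indicator_def)
  finally show ?thesis
    unfolding trunc_pgf.simps by (subst lifetime_mean_add) (use ts in \<open>simp_all add: trunc_pgf.simps\<close>)
qed

text \<open>The branching property at time \<open>t\<close>. Truncation makes it an inequality:
  fewer than \<open>n\<close> generations before \<open>t\<close> followed by fewer than
  \<open>m\<close> after it give labels shorter than \<open>n + m\<close>, so the right side omits
  factors, all at most one. This is the direction that upper bounds require.\<close>

lemma trunc_pgf_branching:
  assumes [measurable]: "g \<in> borel_measurable borel" and g: "\<And>z. g z \<le> 1" and ts: "0 \<le> t" "0 \<le> s"
  shows "trunc_pgf (n + m) g (t + s) y \<le> trunc_pgf n (trunc_pgf m g s) t y"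
  using ts(1)
proof (induction n arbitrary: t y)
  case 0
  then show ?case using trunc_pgf_le_one[of g "t + s" m y] g ts by simp
next
  case (Suc n)
  have "trunc_pgf (Suc n + m) g (t + s) y =
      lifetime_mean t (heat t (trunc_pgf (Suc (n + m)) g s) y) (\<lambda>r. heat r (\<lambda>z. (trunc_pgf (n + m) g (t + s - r) z)\<^sup>2) y)"
    using trunc_pgf_Suc_add[of g t s "n + m" y] Suc.prems ts by simp
  also have "\<dots> \<le> lifetime_mean t (heat t (trunc_pgf m g s) y) (\<lambda>r. heat r (\<lambda>z. (trunc_pgf n (trunc_pgf m g s) (t - r) z)\<^sup>2) y)"
  proof (intro lifetime_mean_mono heat_mono ennreal_sq_mono)
    \<comment> \<open>A root alive at time \<open>t\<close> has used no generation yet; it is cut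
      back to \<open>m\<close> further ones.\<close>
    show "trunc_pgf (Suc (n + m)) g s z \<le> trunc_pgf m g s z" for z using g ts by (intro trunc_pgf_antimono) auto
    show "trunc_pgf (n + m) g (t + s - r) z \<le> trunc_pgf n (trunc_pgf m g s) (t - r) z" if "r \<le> t" for r z
      using Suc.IH[of "t - r" z] that by (simp add: algebra_simps)
  qed
  finally show ?case by simp
qed

end

subsection \<open>Deterministic bounds for the product functional\<close>

lemma DERIV_power_div_fact:
  assumes "(f has_real_derivative D) (at t)"
  shows "((\<lambda>t. f t ^ Suc n / fact (Suc n)) has_real_derivative D * (f t ^ n / fact n)) (at t)"
proof -
  have e: "(fact (Suc n) :: real) = (1 + real n) * fact n" by simp
  have "(1 + real n) * (D * f t ^ n) / fact (Suc n) = D * (f t ^ n / fact n)"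
    unfolding e by (subst mult_divide_mult_cancel_left) auto
  with DERIV_cdivide[OF DERIV_power_Suc[OF assms], of n "fact (Suc n)"] show ?thesis by simp
qed

text \<open>Differentiation drops the last term of the truncated exponential, just as one step of
  the recursion uses up one generation.\<close>

lemma DERIV_exp_partial_sum:
  "((\<lambda>t. \<Sum>k<Suc n. (c * t) ^ k / fact k) has_real_derivative c * (\<Sum>k<n. (c * t) ^ k / fact k)) (at (t :: real))"
proof (induction n)
  case (Suc n)
  have "((\<lambda>t. (c * t) ^ Suc n / fact (Suc n)) has_real_derivative c * ((c * t) ^ n / fact n)) (at t)"
    by (rule DERIV_power_div_fact) (auto intro!: derivative_eq_intros)
  from DERIV_add[OF Suc this] show ?case by (simp add: distrib_left)
qed simp

lemma exp_partial_sum_le: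
  assumes "0 \<le> (x :: real)" shows "(\<Sum>k<n. x ^ k / fact k) \<le> exp x"
proof -
  have "(\<Sum>k<n. x ^ k / fact k) \<le> (\<Sum>k. x ^ k / fact k)"
    using assms summable_exp_generic[of x] by (intro sum_le_suminf) (auto simp: divide_inverse mult.commute)
  then show ?thesis by (simp add: exp_def divide_inverse mult.commute)
qed

context dyadic_bbm
begin

text \<open>The generating function \<open>v\<close> of the Yule process solves the recursion without truncation; the
  second summand bounds the error made by cutting off at generation \<open>n\<close>.\<close>

lemma trunc_pgf_const_le:
  fixes q :: real
  assumes q: "0 \<le> q" "q < 1" and t: "0 \<le> t"
  shows "trunc_pgf n (\<lambda>_. ennreal q) t y \<le> ennreal (exp (- \<beta> * t) / (1 - q) + (2 * \<beta> * t) ^ n / fact n)"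
proof -
  define D where "D r = 1 - q + q * exp (- \<beta> * r)" for r
  define v where "v r = exp (- \<beta> * r) * q / D r" for r
  define d where "d n r = (2 * \<beta> * r) ^ n / fact n" for n and r :: real
  have D: "1 - q \<le> D r" "0 < D r" "D r \<noteq> 0" for r
  proof -
    show 1: "1 - q \<le> D r" using q by (simp add: D_def)
    then show "0 < D r" using q by linarith
    then show "D r \<noteq> 0" by simp
  qed
  have v: "0 \<le> v r" "v r \<le> exp (- \<beta> * r) / (1 - q)" "v r \<le> 1" for r
  proof -
    show "0 \<le> v r" using q D(2)[of r] by (simp add: v_def)
    have "exp (- \<beta> * r) * q \<le> exp (- \<beta> * r)" using q by simp
    then show "v r \<le> exp (- \<beta> * r) / (1 - q)"
      unfolding v_def using D(1)[of r] q by (intro frac_le) auto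
    show "v r \<le> 1" unfolding v_def using D(2)[of r] q by (simp add: D_def mult.commute)
  qed
  have d: "0 \<le> d n r" if "0 \<le> r" for n r using rate_pos that by (simp add: d_def)
  have "trunc_pgf n (\<lambda>_. ennreal q) t y \<le> ennreal (v t + d n t)" using t
  proof (induction n arbitrary: t y)
    case 0
    then show ?case using v(1)[of t] by (simp add: d_def)
  next
    case (Suc n)
    \<comment> \<open>The factor \<open>exp (\<beta> * s)\<close> enlarges the error so that it
      cancels the exponential weight, leaving the exact derivative of the next error term.\<close>
    let ?\<phi> = "\<lambda>s. (v (t - s))\<^sup>2 + exp (\<beta> * s) * (2 * d n (t - s))"
    \<comment> \<open>If \<open>v r + d n r \<le> 1\<close>, the excess
      \<open>d * (2 * v + d)\<close> of the square is at most \<open>2 * d\<close>. Otherwise the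
      trivial bound one suffices, since \<open>v\<^sup>2 + 2 * d\<close> exceeds
      \<open>1 + (1 - v)\<^sup>2\<close>.\<close>
    have sq: "(trunc_pgf n (\<lambda>_. ennreal q) r z)\<^sup>2 \<le> ennreal ((v r)\<^sup>2 + 2 * d n r)" if r: "0 \<le> r" for r z
    proof (cases "v r + d n r \<le> 1")
      case True
      have "(trunc_pgf n (\<lambda>_. ennreal q) r z)\<^sup>2 \<le> (ennreal (v r + d n r))\<^sup>2"
        by (intro ennreal_sq_mono Suc.IH r)
      also have "\<dots> = ennreal ((v r + d n r)\<^sup>2)"
        using v(1)[of r] d[OF r, of n] by (simp add: ennreal_power del: ennreal_plus)
      also have "(v r + d n r)\<^sup>2 \<le> (v r)\<^sup>2 + 2 * d n r"
        using mult_left_mono[of "2 * v r + d n r" 2 "d n r"] True v(3)[of r] d[OF r, of n]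
        by (simp add: power2_eq_square algebra_simps)
      finally show ?thesis by (simp add: ennreal_leI)
    next
      case False
      have "(trunc_pgf n (\<lambda>_. ennreal q) r z)\<^sup>2 \<le> 1\<^sup>2"
        using q r by (intro ennreal_sq_mono trunc_pgf_le_one) auto
      then have "(trunc_pgf n (\<lambda>_. ennreal q) r z)\<^sup>2 \<le> ennreal 1" by simp
      also have "1 \<le> (v r)\<^sup>2 + 2 * d n r"
        using zero_le_power2[of "1 - v r"] False by (simp add: power2_eq_square algebra_simps)
      finally show ?thesis by (simp add: ennreal_leI)
    qed
    have "trunc_pgf (Suc n) (\<lambda>_. ennreal q) t y \<le> lifetime_mean t (ennreal q) (\<lambda>s. ennreal (?\<phi> s))"
      unfolding trunc_pgf.simps
    proof (rule lifetime_mean_mono)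
      fix s assume s: "0 \<le> s" "s \<le> t"
      have "1 * (2 * d n (t - s)) \<le> exp (\<beta> * s) * (2 * d n (t - s))"
        using s rate_pos d[of "t - s" n] by (intro mult_right_mono) auto
      then have "(trunc_pgf n (\<lambda>_. ennreal q) (t - s) z)\<^sup>2 \<le> ennreal (?\<phi> s)" for z
        using sq[of "t - s" z] s by (intro order.trans[OF sq] ennreal_leI) auto
      then show "heat s (\<lambda>z. (trunc_pgf n (\<lambda>_. ennreal q) (t - s) z)\<^sup>2) y \<le> ennreal (?\<phi> s)"
        using heat_mono[of _ "\<lambda>_. ennreal (?\<phi> s)" s y] by simp
    qed simp
    also have "\<dots> = ennreal (exp (- \<beta> * t) * q +
        ((- (exp (- \<beta> * t) * q / D (t - t)) - d (Suc n) (t - t)) - (- (exp (- \<beta> * t) * q / D (t - 0)) - d (Suc n) (t - 0))))"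
    proof (rule lifetime_mean_FTC[OF Suc.prems q(1)])
      show "?\<phi> \<in> borel_measurable borel" unfolding v_def d_def D_def by measurable
      fix s assume s: "0 \<le> s" "s \<le> t"
      show "0 \<le> ?\<phi> s" using d[of "t - s" n] s by simp
      have D': "((\<lambda>s. D (t - s)) has_real_derivative \<beta> * (q * exp (- \<beta> * (t - s)))) (at s)"
        unfolding D_def by (auto intro!: derivative_eq_intros)
      have 1: "((\<lambda>s. - (exp (- \<beta> * t) * q / D (t - s))) has_real_derivative
          exp (- \<beta> * t) * q * (\<beta> * (q * exp (- \<beta> * (t - s)))) / (D (t - s))\<^sup>2) (at s)"
        using D(3)[of "t - s"] by (auto intro!: derivative_eq_intros D' simp: power2_eq_square)
      have e: "exp (- \<beta> * t) = exp (- \<beta> * s) * exp (- \<beta> * (t - s))"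
        by (simp add: exp_add[symmetric] algebra_simps)
      have "exp (- \<beta> * t) * q * (\<beta> * (q * exp (- \<beta> * (t - s)))) / (D (t - s))\<^sup>2
         = \<beta> * exp (- \<beta> * s) * (v (t - s))\<^sup>2"
        unfolding v_def e by (simp add: power2_eq_square)
      note 1 = 1[unfolded this]
      have 2: "((\<lambda>s. d (Suc n) (t - s)) has_real_derivative - (2 * \<beta> * d n (t - s))) (at s)"
      proof -
        have "((\<lambda>s. 2 * \<beta> * (t - s)) has_real_derivative - (2 * \<beta>)) (at s)"
          by (auto intro!: derivative_eq_intros)
        from DERIV_power_div_fact[OF this, of n] show ?thesis by (simp add: d_def)
      qed
      have "\<beta> * exp (- \<beta> * s) * (v (t - s))\<^sup>2 - - (2 * \<beta> * d n (t - s)) = \<beta> * exp (- \<beta> * s) * ?\<phi> s"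
        by (simp add: algebra_simps exp_minus)
      with DERIV_diff[OF 1 2]
      show "((\<lambda>s. - (exp (- \<beta> * t) * q / D (t - s)) - d (Suc n) (t - s)) has_real_derivative
          \<beta> * exp (- \<beta> * s) * ?\<phi> s) (at s)" by simp
    qed
    also have "\<dots> = ennreal (v t + d (Suc n) t)"
      by (simp add: D_def v_def d_def)
    finally show ?case .
  qed
  also have "\<dots> \<le> ennreal (exp (- \<beta> * t) / (1 - q) + d n t)"
    using v(2)[of t] by (intro ennreal_leI) simp
  finally show ?thesis by (simp add: d_def)
qed

section \<open>Growth of the deficit over one and over many time steps\<close>

lemma lifetime_mean_0: "lifetime_mean 0 c F = c"
proof -
  have "(\<integral>\<^sup>+s. ennreal (\<beta> * exp (- \<beta> * s)) * F s * indicator {0..0} s \<partial>lborel) = (\<integral>\<^sup>+(s::real). 0 \<partial>lborel)"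
    by (rule nn_integral_cong_AE, rule eventually_mono[OF AE_lborel_singleton[of 0]]) auto
  then show ?thesis by (simp add: lifetime_mean_def)
qed

lemma heat_0: "heat 0 f y = f y"
proof -
  have "heat 0 f y = (\<integral>\<^sup>+\<omega>. f y \<partial>M)"
    unfolding heat_def by (intro nn_integral_cong) simp
  then show ?thesis by (simp add: emeasure_space_1)
qed

definition hit_prob :: "'a set \<Rightarrow> real \<Rightarrow> 'a \<Rightarrow> real" where
  "hit_prob H t y = measure M {\<omega> \<in> space M. y + V [] t \<omega> \<in> H}"

lemma hit_prob_nonneg: "0 \<le> hit_prob H t y" and hit_prob_le_one: "hit_prob H t y \<le> 1"
  by (simp_all add: hit_prob_def)

lemma heat_indicator:
  assumes [measurable]: "H \<in> sets borel"
  shows "heat t (indicator H) y = ennreal (hit_prob H t y)"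
proof -
  have "heat t (indicator H) y = (\<integral>\<^sup>+\<omega>. indicator {\<omega> \<in> space M. y + V [] t \<omega> \<in> H} \<omega> \<partial>M)"
    unfolding heat_def by (intro nn_integral_cong) (auto simp: indicator_def)
  then show ?thesis by (simp add: hit_prob_def emeasure_eq_measure)
qed

lemma hit_prob_measurable [measurable]: "H \<in> sets borel \<Longrightarrow> hit_prob H t \<in> borel_measurable borel"
proof -
  assume [measurable]: "H \<in> sets borel"
  have "(\<lambda>y. enn2real (heat t (indicator H) y)) \<in> borel_measurable borel" by measurable
  then show ?thesis by (simp add: heat_indicator hit_prob_nonneg)
qed

text \<open>The semigroup preserves total mass and carries hitting probabilities at time
  \<open>s\<close> to those at \<open>r + s\<close>, so functions of this form stay of this form.
  The proof adds the complementary function, avoiding subtraction of integrals in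
  \<open>ennreal\<close>.\<close>

lemma heat_one_minus_hit_prob:
  assumes [measurable]: "H \<in> sets borel" and c: "0 \<le> c" "c \<le> 1" and rs: "0 \<le> r" "0 \<le> s"
  shows "heat r (\<lambda>z. ennreal (1 - c * hit_prob H s z)) y = ennreal (1 - c * hit_prob H (r + s) y)"
proof -
  have le: "c * hit_prob H s z \<le> 1" for s z
    using mult_mono[OF c(2) hit_prob_le_one[of H s z]] by (simp add: hit_prob_nonneg)
  have "heat s (indicator H) = (\<lambda>z. ennreal (hit_prob H s z))" by (auto simp: heat_indicator)
  then have "heat r (\<lambda>z. ennreal (hit_prob H s z)) y = ennreal (hit_prob H (r + s) y)"
    using heat_heat[OF rs, of "indicator H" y] by (simp add: heat_indicator)
  then have "heat r (\<lambda>z. ennreal (c * hit_prob H s z)) y = ennreal (c * hit_prob H (r + s) y)"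
    unfolding heat_def using c by (simp add: ennreal_mult hit_prob_nonneg nn_integral_cmult)
  moreover have "heat r (\<lambda>z. ennreal (1 - c * hit_prob H s z)) y + heat r (\<lambda>z. ennreal (c * hit_prob H s z)) y
     = heat r (\<lambda>z. ennreal (1 - c * hit_prob H s z) + ennreal (c * hit_prob H s z)) y"
    unfolding heat_def by (rule nn_integral_add[symmetric]) measurable
  moreover have "(\<lambda>z. ennreal (1 - c * hit_prob H s z) + ennreal (c * hit_prob H s z)) = (\<lambda>_. 1)"
    using le c by (auto simp: ennreal_plus[symmetric] hit_prob_nonneg simp del: ennreal_plus)
  ultimately have e: "heat r (\<lambda>z. ennreal (1 - c * hit_prob H s z)) y + ennreal (c * hit_prob H (r + s) y) = 1"
    by simp
  then have "heat r (\<lambda>z. ennreal (1 - c * hit_prob H s z)) y = 1 - ennreal (c * hit_prob H (r + s) y)"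
    by (metis ennreal_add_diff_cancel_right ennreal_neq_top)
  then show ?thesis using c by (simp add: ennreal_minus hit_prob_nonneg flip: ennreal_1)
qed

text \<open>The recursion is linearised by \<open>(1 - u)\<^sup>2 \<le> 1 - (2 - \<eta>) u\<close> for \<open>0 \<le> u \<le> \<eta>\<close>, and the linear recursion
  has an explicit solution.\<close>

lemma trunc_pgf_indicator_le:
  assumes [measurable]: "H \<in> sets borel" and p: "0 \<le> p" "p * exp (\<beta> * T) \<le> \<eta>" and \<eta>: "\<eta> \<le> 1"
    and t: "0 \<le> t" "t \<le> T"
  shows "trunc_pgf n (\<lambda>z. ennreal (1 - p * indicator H z)) t y \<le>
    ennreal (1 - p * exp (- \<beta> * t) * (\<Sum>k<n. ((2 - \<eta>) * \<beta> * t) ^ k / fact k) * hit_prob H t y)"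
  using t
proof (induction n arbitrary: t y)
  case (Suc n)
  \<comment> \<open>\<mu> is the effective number of offspring after linearisation: two children
    turn a deficit \<open>u \<le> \<eta>\<close> into at least \<open>\<mu> * u\<close>.\<close>
  define \<mu> where "\<mu> = 2 - \<eta>"
  define S where "S n r = (\<Sum>k<n. (\<mu> * \<beta> * r) ^ k / fact k)" for n and r :: real
  have p1: "p \<le> 1"
  proof -
    have "p * 1 \<le> p * exp (\<beta> * T)" using p rate_pos Suc.prems by (intro mult_left_mono) auto
    then show ?thesis using p \<eta> by simp
  qed
  have \<eta>0: "0 \<le> \<eta>" using p by (meson exp_ge_zero mult_nonneg_nonneg order.trans)
  have \<mu>: "1 \<le> \<mu>" "\<mu> \<le> 2" "\<mu> * \<eta> \<le> 1"
  proof -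
    show "1 \<le> \<mu>" "\<mu> \<le> 2" using \<eta> \<eta>0 by (auto simp: \<mu>_def)
    show "\<mu> * \<eta> \<le> 1" using zero_le_power2[of "1 - \<eta>"] by (simp add: \<mu>_def power2_eq_square algebra_simps)
  qed
  let ?c = "\<lambda>r. p * exp (- \<beta> * r) * S n r"
  have S0: "0 \<le> S n r" if "0 \<le> r" for r n
    unfolding S_def using that \<mu> rate_pos by (intro sum_nonneg) auto
  \<comment> \<open>Even the unlinearised growth \<open>exp (\<beta> * T)\<close> keeps the deficit
    below \<eta>, so the linearisation applies throughout \<open>[0, T]\<close>.\<close>
  have c: "0 \<le> ?c r" "?c r \<le> \<eta>" if r: "0 \<le> r" "r \<le> T" for r
  proof -
    show "0 \<le> ?c r" using S0 r p by simp
    have "S n r \<le> exp (\<mu> * \<beta> * r)"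
      unfolding S_def using r \<mu> rate_pos by (intro exp_partial_sum_le) simp
    also have "\<mu> * \<beta> * r \<le> 2 * \<beta> * r"
      using r \<mu> rate_pos by (intro mult_right_mono) auto
    finally have "S n r \<le> exp (2 * \<beta> * r)" by simp
    then have "?c r \<le> p * exp (- \<beta> * r) * exp (2 * \<beta> * r)"
      using p by (intro mult_left_mono) auto
    also have "\<dots> = p * exp (\<beta> * r)" by (simp add: exp_add[symmetric])
    also have "\<dots> \<le> p * exp (\<beta> * T)" using p r rate_pos by (intro mult_left_mono) auto
    finally show "?c r \<le> \<eta>" using p by simp
  qed
  let ?g = "\<lambda>z. ennreal (1 - p * indicator H z)"
  let ?h = "hit_prob H t y"
  let ?\<phi> = "\<lambda>s. 1 - \<mu> * ?c (t - s) * ?h"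
  have sq: "(trunc_pgf n ?g r z)\<^sup>2 \<le> ennreal (1 - \<mu> * ?c r * hit_prob H r z)" if r: "0 \<le> r" "r \<le> T" for r z
  proof -
    let ?u = "?c r * hit_prob H r z"
    have u: "0 \<le> ?u" "?u \<le> \<eta>"
      using c[OF r] hit_prob_nonneg[of H r z] mult_mono[OF c(2)[OF r] hit_prob_le_one[of H r z] \<eta>0 hit_prob_nonneg] by auto
    have "(trunc_pgf n ?g r z)\<^sup>2 \<le> (ennreal (1 - ?u))\<^sup>2"
      using Suc.IH[OF r, of z] by (intro ennreal_sq_mono) (simp add: S_def \<mu>_def)
    also have "\<dots> = ennreal ((1 - ?u)\<^sup>2)" using u \<eta> by (simp add: ennreal_power)
    also have "(1 - ?u)\<^sup>2 \<le> 1 - \<mu> * ?u"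
      using mult_left_mono[OF u(2) u(1)] by (simp add: \<mu>_def power2_eq_square algebra_simps)
    finally show ?thesis by (simp add: ennreal_leI mult_ac)
  qed
  have \<mu>c: "\<mu> * ?c r \<le> 1" if "0 \<le> r" "r \<le> T" for r
    using mult_left_mono[OF c(2)[OF that], of \<mu>] \<mu> by linarith
  have "trunc_pgf (Suc n) ?g t y \<le> lifetime_mean t (ennreal (1 - p * ?h)) (\<lambda>s. ennreal (?\<phi> s))"
    unfolding trunc_pgf.simps
  proof (rule lifetime_mean_mono)
    have "hit_prob H 0 z = indicator H z" for z
    proof -
      have "{\<omega> \<in> space M. z + V [] 0 \<omega> \<in> H} = (if z \<in> H then space M else {})" by auto
      then show ?thesis by (simp add: hit_prob_def prob_space)
    qed
    then show "heat t ?g y \<le> ennreal (1 - p * ?h)"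
      using heat_one_minus_hit_prob[of H p t 0 y] p p1 Suc.prems by simp
    fix s assume s: "0 \<le> s" "s \<le> t"
    have "heat s (\<lambda>z. (trunc_pgf n ?g (t - s) z)\<^sup>2) y \<le> heat s (\<lambda>z. ennreal (1 - \<mu> * ?c (t - s) * hit_prob H (t - s) z)) y"
      using s Suc.prems by (intro heat_mono sq) auto
    \<comment> \<open>Motion up to the branching time \<open>s\<close> followed by motion for
      \<open>t - s\<close> gives the hitting probability at \<open>t\<close> for every
      \<open>s\<close>; only a scalar integral in \<open>s\<close> remains.\<close>
    also have "\<dots> = ennreal (?\<phi> s)"
      using s Suc.prems \<mu> c(1)[of "t - s"] \<mu>c[of "t - s"] by (subst heat_one_minus_hit_prob) auto
    finally show "heat s (\<lambda>z. (trunc_pgf n ?g (t - s) z)\<^sup>2) y \<le> ennreal (?\<phi> s)" .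
  qed
  also have "\<dots> = ennreal (exp (- \<beta> * t) * (1 - p * ?h) +
     ((- exp (- \<beta> * t) + p * exp (- \<beta> * t) * ?h * S (Suc n) (t - t)) -
      (- exp (- \<beta> * 0) + p * exp (- \<beta> * t) * ?h * S (Suc n) (t - 0))))"
  proof (rule lifetime_mean_FTC[OF Suc.prems(1)])
    show "0 \<le> 1 - p * ?h" using mult_mono[OF p1 hit_prob_le_one[of H t y]] by (simp add: hit_prob_nonneg)
    show "?\<phi> \<in> borel_measurable borel" unfolding S_def by measurable
    fix s assume s: "0 \<le> s" "s \<le> t"
    show "0 \<le> ?\<phi> s"
      using mult_mono[OF \<mu>c[of "t - s"] hit_prob_le_one[of H t y]] s Suc.prems by (simp add: hit_prob_nonneg)
    have e: "exp (- \<beta> * t) = exp (- \<beta> * s) * exp (- \<beta> * (t - s))"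
      by (simp add: exp_add[symmetric] algebra_simps)
    have "((\<lambda>s. S (Suc n) (t - s)) has_real_derivative \<mu> * \<beta> * S n (t - s) * (0 - 1)) (at s)"
      unfolding S_def by (rule DERIV_chain2[OF DERIV_exp_partial_sum]) (auto intro!: derivative_eq_intros)
    then have "((\<lambda>s. - exp (- \<beta> * s) + p * exp (- \<beta> * t) * ?h * S (Suc n) (t - s)) has_real_derivative
       \<beta> * exp (- \<beta> * s) + p * exp (- \<beta> * t) * ?h * (\<mu> * \<beta> * S n (t - s) * (0 - 1))) (at s)"
      by (auto intro!: derivative_eq_intros)
    moreover have "\<beta> * exp (- \<beta> * s) + p * exp (- \<beta> * t) * ?h * (\<mu> * \<beta> * S n (t - s) * (0 - 1))
       = \<beta> * exp (- \<beta> * s) * ?\<phi> s"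
      unfolding e by (simp add: algebra_simps)
    ultimately show "((\<lambda>s. - exp (- \<beta> * s) + p * exp (- \<beta> * t) * ?h * S (Suc n) (t - s)) has_real_derivative
       \<beta> * exp (- \<beta> * s) * ?\<phi> s) (at s)" by simp
  qed
  also have "S (Suc n) (t - t) = 1"
    by (simp add: S_def sum.lessThan_Suc_shift del: sum.lessThan_Suc)
  finally show ?case by (simp add: S_def \<mu>_def algebra_simps)
qed simp

text \<open>Each step of length \<open>T\<close> multiplies the deficit by at least \<open>m\<close>
  and moves the half-space back by \<open>c * T\<close>. The cap \<open>q\<close> keeps the deficit
  in the range of the linearisation. The extra generation makes the induction start: at time 0 one
  generation returns the function itself, none returns 1.\<close>

lemma trunc_pgf_halfspace_le:
  fixes b :: 'a
  assumes T: "0 \<le> T" and \<eta>: "\<eta> \<le> 1" and p: "0 \<le> p0" "p0 \<le> q" "q * exp (\<beta> * T) \<le> \<eta>"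
    and Q: "\<And>\<xi> y. \<xi> - c * T \<le> y \<bullet> b \<Longrightarrow> Q \<le> hit_prob {z. \<xi> \<le> z \<bullet> b} T y"
    and m: "1 \<le> m" "m \<le> exp (- \<beta> * T) * (\<Sum>k<N. ((2 - \<eta>) * \<beta> * T) ^ k / fact k) * Q"
  shows "trunc_pgf (k * N + 1) (\<lambda>z. ennreal (1 - p0 * indicator {z. \<xi> \<le> z \<bullet> b} z)) (k * T) y \<le>
    ennreal (1 - min q (m ^ k * p0) * indicator {z. \<xi> - k * (c * T) \<le> z \<bullet> b} y)"
proof (induction k arbitrary: y)
  case 0
  then show ?case using p by (simp add: lifetime_mean_0 heat_0)
next
  case (Suc k)
  let ?g = "\<lambda>z. ennreal (1 - p0 * indicator {z. \<xi> \<le> z \<bullet> b} z)"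
  let ?p = "min q (m ^ k * p0)" and ?\<xi> = "\<xi> - k * (c * T)"
  let ?E = "exp (- \<beta> * T) * (\<Sum>k<N. ((2 - \<eta>) * \<beta> * T) ^ k / fact k)"
  have p_nonneg: "0 \<le> ?p" using p m by simp
  have E: "0 \<le> ?E" using T \<eta> rate_pos by (intro mult_nonneg_nonneg sum_nonneg) auto
  have "p0 \<le> 1"
  proof -
    have "p0 * 1 \<le> q * exp (\<beta> * T)" using p T rate_pos by (intro mult_mono) auto
    then show ?thesis using p \<eta> by simp
  qed
  have le1: "?g z \<le> 1" for z using p by (simp add: indicator_def)
  have [measurable]: "{z :: 'a. \<xi> \<le> z \<bullet> b} \<in> sets borel" for \<xi> by measurable
  have "trunc_pgf (Suc k * N + 1) ?g (Suc k * T) y = trunc_pgf (N + (k * N + 1)) ?g (T + k * T) y"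
    by (simp add: algebra_simps)
  also have "\<dots> \<le> trunc_pgf N (trunc_pgf (k * N + 1) ?g (k * T)) T y"
    using T le1 by (intro trunc_pgf_branching) auto
  also have "\<dots> \<le> trunc_pgf N (\<lambda>z. ennreal (1 - ?p * indicator {z. ?\<xi> \<le> z \<bullet> b} z)) T y"
    by (intro trunc_pgf_mono Suc.IH)
  also have "\<dots> \<le> ennreal (1 - ?p * exp (- \<beta> * T) * (\<Sum>k<N. ((2 - \<eta>) * \<beta> * T) ^ k / fact k) *
      hit_prob {z. ?\<xi> \<le> z \<bullet> b} T y)"
  proof (rule trunc_pgf_indicator_le)
    have "?p * exp (\<beta> * T) \<le> q * exp (\<beta> * T)" by (intro mult_right_mono) auto
    from this p(3) show "?p * exp (\<beta> * T) \<le> \<eta>" by (rule order.trans)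
  qed (use T \<eta> p_nonneg in auto)
  also have "\<dots> \<le> ennreal (1 - min q (m ^ Suc k * p0) * indicator {z. \<xi> - Suc k * (c * T) \<le> z \<bullet> b} y)"
  proof (intro ennreal_leI diff_left_mono)
    show "min q (m ^ Suc k * p0) * indicator {z. \<xi> - Suc k * (c * T) \<le> z \<bullet> b} y \<le>
       ?p * exp (- \<beta> * T) * (\<Sum>k<N. ((2 - \<eta>) * \<beta> * T) ^ k / fact k) * hit_prob {z. ?\<xi> \<le> z \<bullet> b} T y"
    proof (cases "\<xi> - Suc k * (c * T) \<le> y \<bullet> b")
      case True
      then have "Q \<le> hit_prob {z. ?\<xi> \<le> z \<bullet> b} T y" by (intro Q) (simp add: algebra_simps)
      then have "?E * Q \<le> ?E * hit_prob {z. ?\<xi> \<le> z \<bullet> b} T y" using E by (intro mult_left_mono)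
      then have "m \<le> ?E * hit_prob {z. ?\<xi> \<le> z \<bullet> b} T y" using m by linarith
      then have "?p * m \<le> ?p * (?E * hit_prob {z. ?\<xi> \<le> z \<bullet> b} T y)" using p_nonneg by (intro mult_left_mono)
      \<comment> \<open>A deficit that has reached the cap stays there because
        \<open>1 \<le> m\<close>.\<close>
      moreover have "min q (m ^ Suc k * p0) \<le> ?p * m"
      proof (cases "q \<le> m ^ k * p0")
        case True
        then show ?thesis using mult_left_mono[OF m(1), of q] p by (simp add: min_def)
      next
        case False
        then show ?thesis by (simp add: min_def mult_ac)
      qed
      ultimately show ?thesis using True by (simp add: mult_ac)
    next
      case False
      have "0 \<le> ?p * (?E * hit_prob {z. ?\<xi> \<le> z \<bullet> b} T y)"
        by (rule mult_nonneg_nonneg[OF p_nonneg mult_nonneg_nonneg[OF E hit_prob_nonneg]])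
      then show ?thesis using False by (simp add: mult_ac)
    qed
  qed
  finally show ?case .
qed

end

subsection \<open>Gaussian estimates\<close>

text \<open>Completing the square turns the tilt into a shift of the mean, leaving the total mass of
  a normal density.\<close>

lemma normal_density_exp_integral:
  assumes "0 < \<sigma>"
  shows "(\<integral>\<^sup>+x. ennreal (normal_density 0 \<sigma> x * exp (c * x)) \<partial>lborel) = ennreal (exp (c\<^sup>2 * \<sigma>\<^sup>2 / 2))"
proof -
  have "normal_density 0 \<sigma> x * exp (c * x) = exp (c\<^sup>2 * \<sigma>\<^sup>2 / 2) * normal_density (c * \<sigma>\<^sup>2) \<sigma> x" for x
  proof -
    have "- (x - 0)\<^sup>2 / (2 * \<sigma>\<^sup>2) + c * x = c\<^sup>2 * \<sigma>\<^sup>2 / 2 + - (x - c * \<sigma>\<^sup>2)\<^sup>2 / (2 * \<sigma>\<^sup>2)"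
      using assms by (simp add: field_simps power2_eq_square)
    then have "exp (- (x - 0)\<^sup>2 / (2 * \<sigma>\<^sup>2)) * exp (c * x) =
       exp (c\<^sup>2 * \<sigma>\<^sup>2 / 2) * exp (- (x - c * \<sigma>\<^sup>2)\<^sup>2 / (2 * \<sigma>\<^sup>2))"
      by (simp only: exp_add[symmetric])
    then show ?thesis by (simp add: normal_density_def)
  qed
  moreover have "(\<integral>\<^sup>+x. ennreal (normal_density (c * \<sigma>\<^sup>2) \<sigma> x) \<partial>lborel) = 1"
    using prob_space.emeasure_space_1[OF prob_space_normal_density[OF assms, of "c * \<sigma>\<^sup>2"]]
    by (simp add: emeasure_density)
  ultimately show ?thesis by (simp add: ennreal_mult nn_integral_cmult)
qed

text \<open>By compactness of the sphere. The net reduces tail bounds for the norm to exponential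
  moments of finitely many linear functionals.\<close>

lemma finite_net_sphere:
  assumes "0 < (\<epsilon> :: real)"
  obtains S :: "'b :: euclidean_space set" where "finite S" "S \<noteq> {}" "\<And>v. v \<in> S \<Longrightarrow> norm v = 1"
    "\<And>y. \<exists>v\<in>S. (1 - \<epsilon>) * norm y \<le> v \<bullet> y"
proof -
  let ?U = "\<lambda>v :: 'b. {y. 1 - \<epsilon> < v \<bullet> y}"
  have "\<exists>C' \<subseteq> sphere 0 1. finite C' \<and> sphere 0 1 \<subseteq> (\<Union>v\<in>C'. ?U v)"
  proof (rule compactE_image[OF compact_sphere[of "0 :: 'b" 1], where C = "sphere 0 1" and f = ?U])
    show "open (?U v)" for v by (intro open_Collect_less continuous_intros)
    show "sphere 0 1 \<subseteq> (\<Union>v\<in>sphere 0 1. ?U v)"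
      using assms by (auto simp: dot_square_norm intro!: bexI)
  qed blast
  then obtain S :: "'b set" where S: "S \<subseteq> sphere 0 1" "finite S" "sphere 0 1 \<subseteq> (\<Union>v\<in>S. ?U v)" by blast
  obtain e :: 'b where "e \<in> Basis" using nonempty_Basis by blast
  then have "e \<in> sphere 0 1" by simp
  then have ne: "S \<noteq> {}" using S(3) by blast
  have "\<exists>v\<in>S. (1 - \<epsilon>) * norm y \<le> v \<bullet> y" for y
  proof (cases "y = 0")
    case True
    then show ?thesis using ne by auto
  next
    case False
    then have "y /\<^sub>R norm y \<in> sphere 0 1" by simp
    then obtain v where "v \<in> S" "1 - \<epsilon> < v \<bullet> (y /\<^sub>R norm y)" using S(3) by blast
    then show ?thesis using False by (intro bexI[of _ v]) (simp_all add: field_simps)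
  qed
  moreover have "norm v = 1" if "v \<in> S" for v using S(1) that by auto
  ultimately show ?thesis using that[OF S(2) ne] by blast
qed

context dyadic_bbm
begin

lemma V_marginal:
  assumes b: "b \<in> Basis" and s: "0 < s" and [measurable]: "f \<in> borel_measurable borel"
  shows "(\<integral>\<^sup>+\<omega>. f (V u s \<omega> \<bullet> b) \<partial>M) = (\<integral>\<^sup>+x. ennreal (normal_density 0 (sqrt s) x) * f x \<partial>lborel)"
proof -
  let ?n = "normal_density 0 (sqrt s)"
  let ?f = "\<lambda>b' x. if b' = b then ennreal (?n x) * f x else ennreal (?n x)"
  have one: "(\<integral>\<^sup>+x. ennreal (?n x) \<partial>lborel) = 1"
    using normal_density_exp_integral[of "sqrt s" 0] s by simp
  have "(\<integral>\<^sup>+\<omega>. f (V u s \<omega> \<bullet> b) \<partial>M) =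
     (\<integral>\<^sup>+x. ennreal (\<Prod>b\<in>Basis. ?n (x \<bullet> b)) * f (x \<bullet> b) \<partial>(lborel :: 'a measure))"
    by (rule V_integral[OF s, of "\<lambda>x. f (x \<bullet> b)"]) measurable
  also have "\<dots> = (\<integral>\<^sup>+x. (\<Prod>b'\<in>Basis. ?f b' (x \<bullet> b')) \<partial>(lborel :: 'a measure))"
    using b by (intro nn_integral_cong)
      (simp add: prod.remove[OF finite_Basis b] prod_ennreal prod_nonneg ennreal_mult mult_ac)
  also have "\<dots> = (\<Prod>b'\<in>Basis. (\<integral>\<^sup>+x. ?f b' x \<partial>lborel))"
    by (rule nn_integral_lborel_prod) auto
  also have "\<dots> = (\<integral>\<^sup>+x. ennreal (?n x) * f x \<partial>lborel)"
    by (simp add: prod.remove[OF finite_Basis b] one)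
  finally show ?thesis .
qed

text \<open>It suffices that the coordinate moves by an amount in an interval of length one, between
  \<open>L\<close> and \<open>L + 1\<close> in the direction \<sigma>; there the normal density is
  smallest at distance \<open>L + 1\<close>.\<close>

lemma hit_prob_halfspace_ge:
  assumes b: "b \<in> Basis" and \<sigma>: "\<sigma> = 1 \<or> \<sigma> = -1" and T: "0 < T" and L: "0 \<le> L"
    and y: "\<xi> - L \<le> y \<bullet> (\<sigma> *\<^sub>R b)"
  shows "normal_density 0 (sqrt T) (L + 1) \<le> hit_prob {z. \<xi> \<le> z \<bullet> (\<sigma> *\<^sub>R b)} T y"
proof -
  let ?n = "normal_density 0 (sqrt T)"
  let ?H = "{z. \<xi> \<le> z \<bullet> (\<sigma> *\<^sub>R b)}"
  let ?I = "if \<sigma> = 1 then {L..L + 1} else {- (L + 1)..- L}"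
  have mono: "?n (L + 1) \<le> ?n x" if "x \<in> ?I" for x
  proof -
    have "\<bar>x\<bar> \<le> \<bar>L + 1\<bar>" using that L by (auto split: if_splits)
    then have "x\<^sup>2 \<le> (L + 1)\<^sup>2" by (simp only: abs_le_square_iff)
    then show ?thesis using T unfolding normal_density_def
      by (intro mult_left_mono) (auto simp: divide_right_mono)
  qed
  have [measurable]: "?H \<in> sets borel" by measurable
  have I: "emeasure lborel ?I = 1" by simp
  have "ennreal (?n (L + 1)) = (\<integral>\<^sup>+x. ennreal (?n (L + 1)) * indicator ?I x \<partial>lborel)"
    by (subst nn_integral_cmult_indicator) (simp_all add: I)
  also have "\<dots> \<le> (\<integral>\<^sup>+x. ennreal (?n x) * indicator ?I x \<partial>lborel)"
    using mono by (intro nn_integral_mono) (auto simp: indicator_def intro!: ennreal_leI)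
  also have "\<dots> = (\<integral>\<^sup>+\<omega>. indicator ?I (V [] T \<omega> \<bullet> b) \<partial>M)"
    by (rule V_marginal[OF b T, symmetric]) auto
  also have "\<dots> \<le> (\<integral>\<^sup>+\<omega>. indicator ?H (y + V [] T \<omega>) \<partial>M)"
    using \<sigma> y by (intro nn_integral_mono) (auto simp: indicator_def inner_add_left split: if_splits)
  also have "\<dots> = ennreal (hit_prob ?H T y)"
    using heat_indicator[of ?H T y] by (simp add: heat_def)
  finally show ?thesis by (simp add: hit_prob_nonneg)
qed

lemma heat_exp:
  assumes "0 \<le> s"
  shows "heat s (\<lambda>z. ennreal (exp (v \<bullet> z))) y = ennreal (exp (v \<bullet> y + (norm v)\<^sup>2 * s / 2))"
proof (cases "s = 0")
  case True
  then show ?thesis by (simp add: heat_0)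
next
  case False
  with assms have s: "0 < s" by simp
  let ?n = "normal_density 0 (sqrt s)"
  have "(\<integral>\<^sup>+\<omega>. ennreal (exp (v \<bullet> V [] s \<omega>)) \<partial>M) =
    (\<integral>\<^sup>+x. ennreal (\<Prod>b\<in>Basis. ?n (x \<bullet> b)) * ennreal (exp (v \<bullet> x)) \<partial>(lborel :: 'a measure))"
    by (rule V_integral[OF s, of "\<lambda>x. ennreal (exp (v \<bullet> x))"]) measurable
  also have "\<dots> = (\<integral>\<^sup>+x. (\<Prod>b\<in>Basis. ennreal (?n (x \<bullet> b) * exp ((v \<bullet> b) * (x \<bullet> b)))) \<partial>(lborel :: 'a measure))"
  proof (rule nn_integral_cong)
    fix x :: 'a
    have "exp (v \<bullet> x) = (\<Prod>b\<in>Basis. exp ((v \<bullet> b) * (x \<bullet> b)))"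
      by (simp add: exp_sum[symmetric] euclidean_inner[of v x])
    then show "ennreal (\<Prod>b\<in>Basis. ?n (x \<bullet> b)) * ennreal (exp (v \<bullet> x)) =
      (\<Prod>b\<in>Basis. ennreal (?n (x \<bullet> b) * exp ((v \<bullet> b) * (x \<bullet> b))))"
      by (simp add: prod_ennreal prod.distrib ennreal_mult[symmetric] prod_nonneg)
  qed
  also have "\<dots> = (\<Prod>b\<in>Basis. (\<integral>\<^sup>+x. ennreal (?n x * exp ((v \<bullet> b) * x)) \<partial>lborel))"
    by (rule nn_integral_lborel_prod) auto
  also have "\<dots> = (\<Prod>b\<in>Basis. ennreal (exp ((v \<bullet> b)\<^sup>2 * s / 2)))"
    using s by (simp add: normal_density_exp_integral)
  also have "\<dots> = ennreal (exp ((norm v)\<^sup>2 * s / 2))"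
  proof -
    have "(norm v)\<^sup>2 = (\<Sum>b\<in>Basis. (v \<bullet> b)\<^sup>2)"
      unfolding power2_norm_eq_inner by (subst euclidean_inner) (simp add: power2_eq_square)
    then show ?thesis
      by (simp add: prod_ennreal exp_sum[symmetric] sum_distrib_right sum_divide_distrib)
  qed
  finally have "ennreal (exp (v \<bullet> y)) * (\<integral>\<^sup>+\<omega>. ennreal (exp (v \<bullet> V [] s \<omega>)) \<partial>M) =
      ennreal (exp (v \<bullet> y + (norm v)\<^sup>2 * s / 2))"
    by (simp add: exp_add ennreal_mult)
  then show ?thesis
    unfolding heat_def by (simp add: inner_add_right exp_add ennreal_mult nn_integral_cmult)
qed

text \<open>For a net \<open>S\<close> of unit vectors and \<open>l \<ge> 0\<close>, a multiple of
  this function dominates the indicator of the outside of a ball, and the semigroup at time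
  \<open>s\<close> only multiplies it by \<open>exp (l\<^sup>2 * s / 2)\<close>.\<close>

definition expsum :: "'a set \<Rightarrow> real \<Rightarrow> 'a \<Rightarrow> real" where
  "expsum S l z = (\<Sum>v\<in>S. exp (l * (v \<bullet> z)))"

lemma expsum_nonneg: "0 \<le> expsum S l z"
  by (simp add: expsum_def sum_nonneg)

lemma expsum_measurable [measurable]: "expsum S l \<in> borel_measurable borel"
  unfolding expsum_def by measurable

text \<open>If the path is within \<open>R\<close> of its start at time \<open>r\<close>, the motion
  up to \<open>r\<close> costs a factor of at most \<open>exp (l * R)\<close>, by Cauchy-Schwarz.
  Only the increment over \<open>s - r\<close> then contributes a Gaussian exponential
  moment.\<close>

lemma expsum_integral_le:
  assumes S: "\<And>v. v \<in> S \<Longrightarrow> norm v = 1" and rs: "0 \<le> r" "r \<le> s" and l: "0 \<le> l"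
  shows "(\<integral>\<^sup>+\<omega>. indicator {\<omega>. norm (V u r \<omega>) \<le> R} \<omega> * ennreal (expsum S l (y + V u s \<omega>)) \<partial>M)
    \<le> ennreal (exp (l * R + l\<^sup>2 / 2 * (s - r)) * expsum S l y)"
proof -
  have "indicator {\<omega>. norm (V u r \<omega>) \<le> R} \<omega> * ennreal (expsum S l (y + V u s \<omega>)) \<le>
      (\<Sum>v\<in>S. ennreal (exp (l * (v \<bullet> y) + l * R)) * ennreal (exp ((l *\<^sub>R v) \<bullet> (V u s \<omega> - V u r \<omega>))))" for \<omega>
  proof (cases "norm (V u r \<omega>) \<le> R")
    case True
    have "exp (l * (v \<bullet> (y + V u s \<omega>))) \<le> exp (l * (v \<bullet> y) + l * R) * exp ((l *\<^sub>R v) \<bullet> (V u s \<omega> - V u r \<omega>))"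
      if v: "v \<in> S" for v
    proof -
      have "v \<bullet> V u r \<omega> \<le> R" using norm_cauchy_schwarz[of v "V u r \<omega>"] S[OF v] True by simp
      then have "l * (v \<bullet> V u r \<omega>) \<le> l * R" using l by (rule mult_left_mono)
      then show ?thesis by (simp add: exp_add[symmetric] inner_add_right inner_diff_right algebra_simps)
    qed
    then have "expsum S l (y + V u s \<omega>) \<le>
       (\<Sum>v\<in>S. exp (l * (v \<bullet> y) + l * R) * exp ((l *\<^sub>R v) \<bullet> (V u s \<omega> - V u r \<omega>)))"
      unfolding expsum_def by (rule sum_mono)
    then have "ennreal (expsum S l (y + V u s \<omega>)) \<le>
       ennreal (\<Sum>v\<in>S. exp (l * (v \<bullet> y) + l * R) * exp ((l *\<^sub>R v) \<bullet> (V u s \<omega> - V u r \<omega>)))"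
      by (rule ennreal_leI)
    also have "\<dots> = (\<Sum>v\<in>S. ennreal (exp (l * (v \<bullet> y) + l * R)) * ennreal (exp ((l *\<^sub>R v) \<bullet> (V u s \<omega> - V u r \<omega>))))"
      by (simp add: sum_ennreal[symmetric] ennreal_mult)
    finally show ?thesis using True by simp
  qed simp
  then have "(\<integral>\<^sup>+\<omega>. indicator {\<omega>. norm (V u r \<omega>) \<le> R} \<omega> * ennreal (expsum S l (y + V u s \<omega>)) \<partial>M) \<le>
     (\<integral>\<^sup>+\<omega>. (\<Sum>v\<in>S. ennreal (exp (l * (v \<bullet> y) + l * R)) * ennreal (exp ((l *\<^sub>R v) \<bullet> (V u s \<omega> - V u r \<omega>)))) \<partial>M)"
    by (intro nn_integral_mono)
  also have "\<dots> = (\<Sum>v\<in>S. ennreal (exp (l * (v \<bullet> y) + l * R)) * (\<integral>\<^sup>+\<omega>. ennreal (exp ((l *\<^sub>R v) \<bullet> (V u s \<omega> - V u r \<omega>))) \<partial>M))"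
    by (simp add: nn_integral_sum nn_integral_cmult)
  also have "\<dots> = (\<Sum>v\<in>S. ennreal (exp (l * (v \<bullet> y) + l * R)) * ennreal (exp (l\<^sup>2 * (s - r) / 2)))"
  proof (intro sum.cong refl arg_cong2[where f = "(*)"])
    fix v assume "v \<in> S"
    have "(\<integral>\<^sup>+\<omega>. ennreal (exp ((l *\<^sub>R v) \<bullet> (V u s \<omega> - V u r \<omega>))) \<partial>M) = heat (s - r) (\<lambda>z. ennreal (exp ((l *\<^sub>R v) \<bullet> z))) 0"
      by (rule increment_integral_heat[where f = "\<lambda>z. ennreal (exp ((l *\<^sub>R v) \<bullet> z))"]) (use rs in auto)
    then show "(\<integral>\<^sup>+\<omega>. ennreal (exp ((l *\<^sub>R v) \<bullet> (V u s \<omega> - V u r \<omega>))) \<partial>M) = ennreal (exp (l\<^sup>2 * (s - r) / 2))"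
      using rs S[OF \<open>v \<in> S\<close>] by (simp only: heat_exp) simp
  qed
  also have "\<dots> = ennreal (exp (l * R + l\<^sup>2 / 2 * (s - r)) * expsum S l y)"
    by (simp add: expsum_def ennreal_mult[symmetric] exp_add sum_distrib_left sum_distrib_right mult_ac)
  finally show ?thesis .
qed

subsection \<open>Lower bound\<close>

text \<open>The case \<open>r = 0\<close>, \<open>R = 0\<close> carries no restriction and drives the induction.\<close>

lemma trunc_count_first_moment:
  assumes S: "\<And>v. v \<in> S \<Longrightarrow> norm v = 1" and l: "0 \<le> l" and \<kappa>: "0 \<le> \<kappa>"
    and [measurable]: "A \<in> sets borel" and A: "\<And>z. z \<in> A \<Longrightarrow> 1 \<le> \<kappa> * expsum S l z"
    and "0 \<le> r" "r \<le> t" "0 \<le> R"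
  shows "(\<integral>\<^sup>+\<omega>. indicator {\<omega>. r \<le> \<tau> u \<omega> \<and> norm (V u r \<omega>) \<le> R} \<omega> * ennreal (trunc_count n A u t y \<omega>) \<partial>M)
    \<le> ennreal (exp (l * R + l\<^sup>2 / 2 * (t - r) + \<beta> * (t - 2 * r)) * (\<kappa> * expsum S l y))"
  using assms(6-8)
proof (induction n arbitrary: u r t R y)
  case 0
  then show ?case by simp
next
  case (Suc n)
  let ?c = "l\<^sup>2 / 2"
  let ?\<psi> = "\<lambda>z. \<kappa> * expsum S l z"
  have \<psi>: "0 \<le> ?\<psi> z" for z using \<kappa> expsum_nonneg by simp
  let ?B = "subtree (u @ [False]) \<union> subtree (u @ [True])"
  let ?A = "{Inl u, Inr u}"
  let ?I = "\<lambda>\<omega>. indicator {\<omega>. r \<le> \<tau> u \<omega>} \<omega> * indicator {\<omega>. norm (V u r \<omega>) \<le> R} \<omega> :: ennreal"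
  let ?C = "\<lambda>i p. ennreal (trunc_count n A (u @ [i]) (t - \<tau> u (fst p)) (y + V u (\<tau> u (fst p)) (fst p)) (snd p))"
  let ?h = "\<lambda>p. ?I (fst p) * (if t < \<tau> u (fst p) then indicator A (y + V u t (fst p)) else ?C False p + ?C True p)"
  let ?E = "\<lambda>s. 2 * exp ((?c + \<beta>) * (t - s))"
  have child: "(\<integral>\<^sup>+\<omega>. ennreal (trunc_count n A (u @ [i]) s z \<omega>) \<partial>M) \<le> ennreal (exp ((?c + \<beta>) * s) * ?\<psi> z)"
    if "0 \<le> s" for i s z
  proof -
    have "(\<integral>\<^sup>+\<omega>. ennreal (trunc_count n A (u @ [i]) s z \<omega>) \<partial>M) =
      (\<integral>\<^sup>+\<omega>. indicator {\<omega>. 0 \<le> \<tau> (u @ [i]) \<omega> \<and> norm (V (u @ [i]) 0 \<omega>) \<le> 0} \<omega> *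
         ennreal (trunc_count n A (u @ [i]) s z \<omega>) \<partial>M)"
      by (intro nn_integral_cong) (simp add: lifetime_nonneg)
    also have "\<dots> \<le> ennreal (exp (l * 0 + ?c * (s - 0) + \<beta> * (s - 2 * 0)) * ?\<psi> z)"
      using that by (intro Suc.IH) auto
    finally show ?thesis by (simp add: distrib_right)
  qed
  have hm: "?h \<in> borel_measurable (info ?A \<Otimes>\<^sub>M info ?B)"
  proof -
    have \<tau>m [measurable]: "\<tau> u \<in> borel_measurable (info ?A)"
      by (rule lifetime_measurable_info) simp
    note V [measurable (raw)] = V_measurable_info_comp[where u = u and A = ?A, simplified]
    have sub: "subtree (u @ [i]) \<subseteq> ?B" for i by (cases i) auto
    have C [measurable]: "(\<lambda>p. trunc_count n A (u @ [i]) (t - \<tau> u (fst p)) (y + V u (\<tau> u (fst p)) (fst p)) (snd p))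
        \<in> borel_measurable (info ?A \<Otimes>\<^sub>M info ?B)" for i
      by (rule trunc_count_measurable_info[OF _ sub]) measurable
    have [measurable]: "(\<lambda>\<omega>. indicator {\<omega>. r \<le> \<tau> u \<omega>} \<omega> :: ennreal) \<in> borel_measurable (info ?A)"
      "(\<lambda>\<omega>. indicator {\<omega>. norm (V u r \<omega>) \<le> R} \<omega> :: ennreal) \<in> borel_measurable (info ?A)"
      unfolding indicator_def mem_Collect_eq by measurable
    show ?thesis by measurable
  qed
  have "(\<integral>\<^sup>+\<omega>. indicator {\<omega>. r \<le> \<tau> u \<omega> \<and> norm (V u r \<omega>) \<le> R} \<omega> * ennreal (trunc_count (Suc n) A u t y \<omega>) \<partial>M)
     = (\<integral>\<^sup>+\<omega>. ?h (\<omega>, \<omega>) \<partial>M)"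
    by (intro nn_integral_cong) (auto simp: indicator_def ennreal_plus)
  also have "\<dots> = (\<integral>\<^sup>+\<omega>. \<integral>\<^sup>+\<omega>'. ?h (\<omega>, \<omega>') \<partial>M \<partial>M)"
    by (rule nn_integral_freeze[OF root_subtree_disjoint hm])
  also have "\<dots> \<le> (\<integral>\<^sup>+\<omega>. ?I \<omega> * (if t < \<tau> u \<omega> then ennreal (?\<psi> (y + V u t \<omega>))
      else ennreal (?E (\<tau> u \<omega>)) * ennreal (?\<psi> (y + V u (\<tau> u \<omega>) \<omega>))) \<partial>M)"
  proof (intro nn_integral_mono)
    fix \<omega> assume w: "\<omega> \<in> space M"
    show "(\<integral>\<^sup>+\<omega>'. ?h (\<omega>, \<omega>') \<partial>M) \<le> ?I \<omega> * (if t < \<tau> u \<omega> then ennreal (?\<psi> (y + V u t \<omega>))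
      else ennreal (?E (\<tau> u \<omega>)) * ennreal (?\<psi> (y + V u (\<tau> u \<omega>) \<omega>)))"
    proof (cases "t < \<tau> u \<omega>")
      case True
      have "(indicator A (y + V u t \<omega>) :: ennreal) \<le> ennreal (?\<psi> (y + V u t \<omega>))"
        using A[of "y + V u t \<omega>"] by (auto simp: indicator_def ennreal_leI simp flip: ennreal_1)
      then show ?thesis using True by (simp add: emeasure_space_1 mult_left_mono)
    next
      case False
      let ?z = "y + V u (\<tau> u \<omega>) \<omega>" and ?s = "t - \<tau> u \<omega>"
      have "(\<integral>\<^sup>+\<omega>'. ?h (\<omega>, \<omega>') \<partial>M) = ?I \<omega> * ((\<integral>\<^sup>+\<omega>'. ?C False (\<omega>, \<omega>') \<partial>M) + (\<integral>\<^sup>+\<omega>'. ?C True (\<omega>, \<omega>') \<partial>M))"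
        using False by (simp add: nn_integral_cmult nn_integral_add)
      also have "\<dots> \<le> ?I \<omega> * (ennreal (exp ((?c + \<beta>) * ?s) * ?\<psi> ?z) + ennreal (exp ((?c + \<beta>) * ?s) * ?\<psi> ?z))"
        using False child[of ?s] by (intro mult_left_mono add_mono) auto
      also have "\<dots> = ?I \<omega> * (ennreal (?E (\<tau> u \<omega>)) * ennreal (?\<psi> ?z))"
      proof -
        let ?a = "exp ((?c + \<beta>) * ?s) * ?\<psi> ?z"
        have "ennreal ?a + ennreal ?a = ennreal (?a + ?a)" using \<psi>[of ?z] by (subst ennreal_plus) auto
        also have "?a + ?a = ?E (\<tau> u \<omega>) * ?\<psi> ?z" by simp
        also have "ennreal \<dots> = ennreal (?E (\<tau> u \<omega>)) * ennreal (?\<psi> ?z)"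
          using \<psi>[of ?z] by (intro ennreal_mult) auto
        finally show ?thesis by simp
      qed
      finally show ?thesis using False by simp
    qed
  qed
  \<comment> \<open>A second freezing separates the lifetime of \<open>u\<close> from its path, so
    that \<open>expsum_integral_le\<close> applies at a fixed death time.\<close>
  also have "\<dots> = (\<integral>\<^sup>+\<omega>. \<integral>\<^sup>+\<omega>'. indicator {\<omega>. r \<le> \<tau> u \<omega>} \<omega> * indicator {\<omega>. norm (V u r \<omega>) \<le> R} \<omega>' *
      (if t < \<tau> u \<omega> then ennreal (?\<psi> (y + V u t \<omega>'))
      else ennreal (?E (\<tau> u \<omega>)) * ennreal (?\<psi> (y + V u (\<tau> u \<omega>) \<omega>'))) \<partial>M \<partial>M)"
  proof -
    let ?k = "\<lambda>p. indicator {\<omega>. r \<le> \<tau> u \<omega>} (fst p) * indicator {\<omega>. norm (V u r \<omega>) \<le> R} (snd p) *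
      (if t < \<tau> u (fst p) then ennreal (?\<psi> (y + V u t (snd p)))
      else ennreal (?E (\<tau> u (fst p))) * ennreal (?\<psi> (y + V u (\<tau> u (fst p)) (snd p))))"
    have [measurable]: "\<tau> u \<in> borel_measurable (info {Inl u})"
      by (rule lifetime_measurable_info) simp
    note [measurable (raw)] = V_measurable_info_comp[where u = u and A = "{Inr u}", simplified]
    have [measurable]: "(\<lambda>\<omega>. indicator {\<omega>. r \<le> \<tau> u \<omega>} \<omega> :: ennreal) \<in> borel_measurable (info {Inl u})"
      "(\<lambda>\<omega>. indicator {\<omega>. norm (V u r \<omega>) \<le> R} \<omega> :: ennreal) \<in> borel_measurable (info {Inr u})"
      unfolding indicator_def mem_Collect_eq by measurable
    have "?k \<in> borel_measurable (info {Inl u} \<Otimes>\<^sub>M info {Inr u})" by measurable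
    from nn_integral_freeze[OF _ this] show ?thesis by (simp cong: if_cong)
  qed
  also have "\<dots> \<le> (\<integral>\<^sup>+\<omega>. (if t < \<tau> u \<omega> then ennreal (exp (l * R + ?c * (t - r)) * ?\<psi> y)
      else ennreal (indicator {r..} (\<tau> u \<omega>) * (2 * exp (\<beta> * (t - \<tau> u \<omega>)) * (exp (l * R + ?c * (t - r)) * ?\<psi> y)))) \<partial>M)"
  proof (intro nn_integral_mono)
    fix \<omega> assume w: "\<omega> \<in> space M"
    have bd: "(\<integral>\<^sup>+\<omega>'. indicator {\<omega>. norm (V u r \<omega>) \<le> R} \<omega>' * ennreal (?\<psi> (y + V u s \<omega>')) \<partial>M) \<le>
        ennreal (exp (l * R + ?c * (s - r)) * ?\<psi> y)" if "r \<le> s" for s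
    proof -
      have [measurable]: "(\<lambda>\<omega>. indicator {\<omega>. norm (V u r \<omega>) \<le> R} \<omega> :: ennreal) \<in> borel_measurable M"
        unfolding indicator_def mem_Collect_eq by measurable
      have "(\<integral>\<^sup>+\<omega>'. indicator {\<omega>. norm (V u r \<omega>) \<le> R} \<omega>' * ennreal (?\<psi> (y + V u s \<omega>')) \<partial>M) =
         ennreal \<kappa> * (\<integral>\<^sup>+\<omega>'. indicator {\<omega>. norm (V u r \<omega>) \<le> R} \<omega>' * ennreal (expsum S l (y + V u s \<omega>')) \<partial>M)"
        using \<kappa> by (subst nn_integral_cmult[symmetric])
          (auto intro!: nn_integral_cong simp: ennreal_mult expsum_nonneg mult_ac)
      also have "\<dots> \<le> ennreal \<kappa> * ennreal (exp (l * R + ?c * (s - r)) * expsum S l y)"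
        using that Suc.prems l S by (intro mult_left_mono expsum_integral_le) auto
      also have "\<dots> = ennreal (exp (l * R + ?c * (s - r)) * ?\<psi> y)"
        using \<kappa> by (simp add: ennreal_mult[symmetric] expsum_nonneg mult_ac)
      finally show ?thesis .
    qed
    show "(\<integral>\<^sup>+\<omega>'. indicator {\<omega>. r \<le> \<tau> u \<omega>} \<omega> * indicator {\<omega>. norm (V u r \<omega>) \<le> R} \<omega>' *
      (if t < \<tau> u \<omega> then ennreal (?\<psi> (y + V u t \<omega>'))
      else ennreal (?E (\<tau> u \<omega>)) * ennreal (?\<psi> (y + V u (\<tau> u \<omega>) \<omega>'))) \<partial>M) \<le>
      (if t < \<tau> u \<omega> then ennreal (exp (l * R + ?c * (t - r)) * ?\<psi> y)
      else ennreal (indicator {r..} (\<tau> u \<omega>) * (2 * exp (\<beta> * (t - \<tau> u \<omega>)) * (exp (l * R + ?c * (t - r)) * ?\<psi> y))))"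
    proof (cases "t < \<tau> u \<omega>")
      case True
      then show ?thesis using bd[of t] Suc.prems by simp
    next
      case False
      show ?thesis
      proof (cases "r \<le> \<tau> u \<omega>")
        case True
        have [measurable]: "(\<lambda>\<omega>. indicator {\<omega>. norm (V u r \<omega>) \<le> R} \<omega> :: ennreal) \<in> borel_measurable M"
          unfolding indicator_def mem_Collect_eq by measurable
        have "(\<integral>\<^sup>+\<omega>'. indicator {\<omega>. norm (V u r \<omega>) \<le> R} \<omega>' * (ennreal (?E (\<tau> u \<omega>)) * ennreal (?\<psi> (y + V u (\<tau> u \<omega>) \<omega>'))) \<partial>M)
          = ennreal (?E (\<tau> u \<omega>)) * (\<integral>\<^sup>+\<omega>'. indicator {\<omega>. norm (V u r \<omega>) \<le> R} \<omega>' * ennreal (?\<psi> (y + V u (\<tau> u \<omega>) \<omega>')) \<partial>M)"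
          by (subst nn_integral_cmult[symmetric]) (auto intro!: nn_integral_cong simp: mult_ac)
        also have "\<dots> \<le> ennreal (?E (\<tau> u \<omega>)) * ennreal (exp (l * R + ?c * (\<tau> u \<omega> - r)) * ?\<psi> y)"
          by (intro mult_left_mono bd True) simp
        also have "\<dots> = ennreal (2 * exp (\<beta> * (t - \<tau> u \<omega>)) * (exp (l * R + ?c * (t - r)) * ?\<psi> y))"
        proof -
          have "?E (\<tau> u \<omega>) * (exp (l * R + ?c * (\<tau> u \<omega> - r)) * ?\<psi> y) =
              2 * (exp ((?c + \<beta>) * (t - \<tau> u \<omega>)) * exp (l * R + ?c * (\<tau> u \<omega> - r))) * ?\<psi> y" by simp
          also have "exp ((?c + \<beta>) * (t - \<tau> u \<omega>)) * exp (l * R + ?c * (\<tau> u \<omega> - r)) =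
              exp (\<beta> * (t - \<tau> u \<omega>)) * exp (l * R + ?c * (t - r))"
            unfolding exp_add[symmetric] by (rule arg_cong[of _ _ exp]) (simp add: field_simps)
          finally have "?E (\<tau> u \<omega>) * (exp (l * R + ?c * (\<tau> u \<omega> - r)) * ?\<psi> y) =
              2 * exp (\<beta> * (t - \<tau> u \<omega>)) * (exp (l * R + ?c * (t - r)) * ?\<psi> y)" by (simp only: mult.assoc)
          moreover have "ennreal (?E (\<tau> u \<omega>)) * ennreal (exp (l * R + ?c * (\<tau> u \<omega> - r)) * ?\<psi> y) =
              ennreal (?E (\<tau> u \<omega>) * (exp (l * R + ?c * (\<tau> u \<omega> - r)) * ?\<psi> y))"
            by (rule ennreal_mult[symmetric]) (use \<psi>[of y] in auto)
          ultimately show ?thesis by (simp only:)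
        qed
        finally show ?thesis using False True by simp
      next
        case r: False
        then show ?thesis using False by simp
      qed
    qed
  qed
  also have "\<dots> = lifetime_mean t (ennreal (exp (l * R + ?c * (t - r)) * ?\<psi> y))
      (\<lambda>s. ennreal (indicator {r..} s * (2 * exp (\<beta> * (t - s)) * (exp (l * R + ?c * (t - r)) * ?\<psi> y))))"
    by (rule lifetime_integral) (use Suc.prems in \<open>measurable; simp\<close>)+
  \<comment> \<open>The time integral of \<open>2 * \<beta> * exp (\<beta> * (t - 2 * s))\<close>
    over \<open>[r, t]\<close> is \<open>exp (\<beta> * (t - 2 * r)) - exp (- \<beta> * t)\<close>;
    the negative term cancels the contribution of a root surviving beyond \<open>t\<close>. The
    result is survival \<open>exp (- \<beta> * r)\<close> times mean growth
    \<open>exp (\<beta> * (t - r))\<close>.\<close>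
  also have "\<dots> = ennreal (exp (l * R + ?c * (t - r) + \<beta> * (t - 2 * r)) * ?\<psi> y)"
  proof -
    define K where "K = exp (l * R + ?c * (t - r)) * ?\<psi> y"
    have K: "0 \<le> K" using \<psi> by (simp add: K_def)
    have "(\<integral>\<^sup>+s. ennreal (\<beta> * exp (- \<beta> * s)) * ennreal (indicator {r..} s * (2 * exp (\<beta> * (t - s)) * K)) * indicator {0..t} s \<partial>lborel)
      = (\<integral>\<^sup>+s. ennreal (2 * K * \<beta> * exp (\<beta> * (t - 2 * s))) * indicator {r..t} s \<partial>lborel)"
    proof (intro nn_integral_cong)
      fix s
      have "\<beta> * exp (- \<beta> * s) * (2 * exp (\<beta> * (t - s)) * K) = 2 * K * \<beta> * (exp (- \<beta> * s) * exp (\<beta> * (t - s)))" by simp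
      also have "exp (- \<beta> * s) * exp (\<beta> * (t - s)) = exp (\<beta> * (t - 2 * s))"
        unfolding exp_add[symmetric] by (rule arg_cong[of _ _ exp]) (simp add: algebra_simps)
      finally show "ennreal (\<beta> * exp (- \<beta> * s)) * ennreal (indicator {r..} s * (2 * exp (\<beta> * (t - s)) * K)) * indicator {0..t} s
        = ennreal (2 * K * \<beta> * exp (\<beta> * (t - 2 * s))) * indicator {r..t} s"
        using Suc.prems K rate_pos by (auto simp: indicator_def ennreal_mult[symmetric])
    qed
    also have "\<dots> = ennreal (- K * exp (\<beta> * (t - 2 * t)) - - K * exp (\<beta> * (t - 2 * r)))"
    proof (rule nn_integral_FTC_Icc)
      fix s
      show "((\<lambda>s. - K * exp (\<beta> * (t - 2 * s))) has_real_derivative 2 * K * \<beta> * exp (\<beta> * (t - 2 * s))) (at s)"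
        by (auto intro!: derivative_eq_intros)
      show "0 \<le> 2 * K * \<beta> * exp (\<beta> * (t - 2 * s))" using K rate_pos by simp
    qed (use Suc.prems in auto)
    finally have e: "(\<integral>\<^sup>+s. ennreal (\<beta> * exp (- \<beta> * s)) * ennreal (indicator {r..} s * (2 * exp (\<beta> * (t - s)) * K)) * indicator {0..t} s \<partial>lborel)
      = ennreal (K * exp (\<beta> * (t - 2 * r)) - exp (- \<beta> * t) * K)" by (simp add: mult_ac)
    have "exp (- \<beta> * t) \<le> exp (\<beta> * (t - 2 * r))"
    proof -
      have "\<beta> * (2 * r) \<le> \<beta> * (2 * t)" using Suc.prems rate_pos by (intro mult_left_mono) auto
      then show ?thesis by (simp add: algebra_simps)
    qed
    then have "exp (- \<beta> * t) * K \<le> K * exp (\<beta> * (t - 2 * r))"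
      using K by (subst mult.commute) (intro mult_left_mono)
    then have "lifetime_mean t (ennreal K) (\<lambda>s. ennreal (indicator {r..} s * (2 * exp (\<beta> * (t - s)) * K))) =
       ennreal (K * exp (\<beta> * (t - 2 * r)))"
      unfolding lifetime_mean_def e using K by (simp add: ennreal_mult[symmetric] ennreal_plus[symmetric] del: ennreal_plus)
    also have "K * exp (\<beta> * (t - 2 * r)) = exp (l * R + ?c * (t - r) + \<beta> * (t - 2 * r)) * ?\<psi> y"
      by (simp add: K_def exp_add mult_ac)
    finally show ?thesis by (simp add: K_def)
  qed
  finally show ?case .
qed

definition below_event :: "'a set \<Rightarrow> real \<Rightarrow> real \<Rightarrow> 'w set" where
  "below_event A t K = {\<omega> \<in> space M. particle_count \<tau> W t A \<omega> < ennreal K}"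

lemma below_event_sets:
  assumes "A \<in> sets borel" "0 \<le> t" shows "below_event A t K \<in> sets M"
proof -
  note [measurable] = particle_count_measurable[OF assms]
  show ?thesis unfolding below_event_def by measurable
qed

text \<open>Let \<open>?H\<close> be the event that the root lives until \<open>r\<close> and is
  then within \<open>R\<close> of the origin. Independence and an exponential Markov bound with tilt
  \<open>l'\<close> estimate \<open>?H\<close> from below; the first moment with tilt
  \<open>l\<close> bounds the part of \<open>?H\<close> on which the count reaches \<open>K\<close>.
  The tilts remain free for later optimisation.\<close>

lemma prob_below_ge:
  fixes S :: "'a set"
  assumes S: "\<And>v. v \<in> S \<Longrightarrow> norm v = 1"
    and net: "\<And>y. \<exists>v\<in>S. (1 - \<epsilon>) * norm y \<le> v \<bullet> y" "finite S"
    and l: "0 \<le> l" "0 \<le> l'" and rt: "0 \<le> r" "r \<le> t" and R: "0 \<le> R" and K: "0 < K" and \<epsilon>: "\<epsilon> \<le> 1"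
  shows "exp (- \<beta> * r) * (1 - card S * exp (l'\<^sup>2 / 2 * r - l' * (1 - \<epsilon>) * R))
     - card S * exp (l * R + l\<^sup>2 / 2 * (t - r) + \<beta> * (t - 2 * r) - l * (1 - \<epsilon>) * X) / K
    \<le> measure M (below_event (- ball 0 X) t K)"
proof -
  let ?A = "- ball 0 X :: 'a set"
  have [measurable]: "?A \<in> sets borel" by measurable
  have exps: "1 \<le> exp (- (l * (1 - \<epsilon>) * X)) * expsum S l z" if z: "X \<le> norm z" and l: "0 \<le> l" for z X l
  proof -
    obtain v where v: "v \<in> S" "(1 - \<epsilon>) * norm z \<le> v \<bullet> z" using net by blast
    have "(1 - \<epsilon>) * X \<le> v \<bullet> z" using v z \<epsilon> by (meson diff_ge_0_iff_ge mult_left_mono order.trans)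
    then have "l * ((1 - \<epsilon>) * X) \<le> l * (v \<bullet> z)" using l by (rule mult_left_mono)
    then have "exp (l * (1 - \<epsilon>) * X) \<le> exp (l * (v \<bullet> z))" by (simp add: mult.assoc)
    also have "\<dots> \<le> expsum S l z"
      unfolding expsum_def using v net by (intro member_le_sum) auto
    finally have "exp (- (l * (1 - \<epsilon>) * X)) * exp (l * (1 - \<epsilon>) * X) \<le> exp (- (l * (1 - \<epsilon>) * X)) * expsum S l z"
      by (intro mult_left_mono) auto
    then show ?thesis by (simp add: exp_add[symmetric])
  qed
  have gen: "exp p * (exp (- q) * c) = c * exp (p - q)" for p q c :: real
    by (simp add: exp_diff exp_minus divide_inverse)
  have e0: "expsum S l 0 = card S" for l by (simp add: expsum_def)
  let ?N = "{\<omega> \<in> space M. norm (V [] r \<omega>) \<le> R}"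
  let ?H = "{\<omega> \<in> space M. r \<le> \<tau> [] \<omega> \<and> norm (V [] r \<omega>) \<le> R}"
  let ?Z = "particle_count \<tau> W t ?A"
  have [measurable]: "?Z \<in> borel_measurable M" using rt by (intro particle_count_measurable) auto
  have t: "0 \<le> t" using rt by simp

  \<comment> \<open>The first-moment bound is uniform in the number of generations, so monotone
    convergence transfers it to the full population.\<close>
  have "(\<integral>\<^sup>+\<omega>. indicator ?H \<omega> * ?Z \<omega> \<partial>M) = (\<integral>\<^sup>+\<omega>. (SUP n. indicator ?H \<omega> * ennreal (trunc_count n ?A [] t 0 \<omega>)) \<partial>M)"
    using t by (intro nn_integral_cong) (simp add: particle_count_eq_SUP SUP_mult_left_ennreal)
  also have "\<dots> = (SUP n. \<integral>\<^sup>+\<omega>. indicator ?H \<omega> * ennreal (trunc_count n ?A [] t 0 \<omega>) \<partial>M)"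
  proof (rule nn_integral_monotone_convergence_SUP_AE)
    show "AE \<omega> in M. indicator ?H \<omega> * ennreal (trunc_count n ?A [] t 0 \<omega>) \<le> indicator ?H \<omega> * ennreal (trunc_count (Suc n) ?A [] t 0 \<omega>)" for n
      using t trunc_count_root_mono[of _ t n "Suc n"] by (intro AE_I2 mult_left_mono ennreal_leI) auto
  qed measurable
  also have "\<dots> \<le> ennreal (exp (l * R + l\<^sup>2 / 2 * (t - r) + \<beta> * (t - 2 * r)) * (exp (- (l * (1 - \<epsilon>) * X)) * expsum S l 0))"
  proof (rule SUP_least)
    fix n
    have "(\<integral>\<^sup>+\<omega>. indicator ?H \<omega> * ennreal (trunc_count n ?A [] t 0 \<omega>) \<partial>M) =
      (\<integral>\<^sup>+\<omega>. indicator {\<omega>. r \<le> \<tau> [] \<omega> \<and> norm (V [] r \<omega>) \<le> R} \<omega> * ennreal (trunc_count n ?A [] t 0 \<omega>) \<partial>M)"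
      by (intro nn_integral_cong) (auto simp: indicator_def)
    also have "\<dots> \<le> ennreal (exp (l * R + l\<^sup>2 / 2 * (t - r) + \<beta> * (t - 2 * r)) * (exp (- (l * (1 - \<epsilon>) * X)) * expsum S l 0))"
      using rt R l S exps by (intro trunc_count_first_moment) auto
    finally show "(\<integral>\<^sup>+\<omega>. indicator ?H \<omega> * ennreal (trunc_count n ?A [] t 0 \<omega>) \<partial>M) \<le> \<dots>" .
  qed
  also have "exp (l * R + l\<^sup>2 / 2 * (t - r) + \<beta> * (t - 2 * r)) * (exp (- (l * (1 - \<epsilon>) * X)) * expsum S l 0) =
     card S * exp (l * R + l\<^sup>2 / 2 * (t - r) + \<beta> * (t - 2 * r) - l * (1 - \<epsilon>) * X)" (is "_ = ?U")
    by (simp only: e0 gen)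
  finally have U: "(\<integral>\<^sup>+\<omega>. indicator ?H \<omega> * ?Z \<omega> \<partial>M) \<le> ennreal ?U" .

  \<comment> \<open>Markov's inequality: the count is at least \<open>K\<close> on
    \<open>?H - below_event ?A t K\<close>.\<close>
  have "emeasure M (?H - below_event ?A t K) * ennreal K = (\<integral>\<^sup>+\<omega>. ennreal K * indicator (?H - below_event ?A t K) \<omega> \<partial>M)"
    using below_event_sets[of ?A t K] t by (subst nn_integral_cmult_indicator) (auto simp: mult.commute)
  also have "\<dots> \<le> (\<integral>\<^sup>+\<omega>. indicator ?H \<omega> * ?Z \<omega> \<partial>M)"
    by (intro nn_integral_mono) (auto simp: indicator_def below_event_def)
  also note U
  finally have "ennreal (measure M (?H - below_event ?A t K) * K) \<le> ennreal ?U"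
    using K by (simp add: emeasure_eq_measure ennreal_mult)
  then have "measure M (?H - below_event ?A t K) * K \<le> ?U"
    by (rule ennreal_le_iff[THEN iffD1, rotated]) simp
  then have far: "measure M (?H - below_event ?A t K) \<le> ?U / K" using K by (simp add: field_simps)

  \<comment> \<open>The tail of the displacement at time \<open>r\<close>, from
    \<open>expsum_integral_le\<close> with the restriction placed at time 0 and radius 0, where it
    holds surely.\<close>
  have "1 - measure M ?N = measure M (space M - ?N)" by (subst prob_compl) auto
  also have "ennreal \<dots> = (\<integral>\<^sup>+\<omega>. indicator (space M - ?N) \<omega> \<partial>M)"
    by (simp add: emeasure_eq_measure)
  also have "\<dots> \<le> (\<integral>\<^sup>+\<omega>. ennreal (exp (- (l' * (1 - \<epsilon>) * R))) *
      (indicator {\<omega>. norm (V [] 0 \<omega>) \<le> 0} \<omega> * ennreal (expsum S l' (0 + V [] r \<omega>))) \<partial>M)"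
  proof (intro nn_integral_mono)
    fix \<omega> assume "\<omega> \<in> space M"
    then show "indicator (space M - ?N) \<omega> \<le> ennreal (exp (- (l' * (1 - \<epsilon>) * R))) *
      (indicator {\<omega>. norm (V [] 0 \<omega>) \<le> 0} \<omega> * ennreal (expsum S l' (0 + V [] r \<omega>)))"
      using exps[of R "V [] r \<omega>" l'] l
      by (auto simp: indicator_def ennreal_mult[symmetric] expsum_nonneg simp flip: ennreal_1 intro!: ennreal_leI)
  qed
  also have "\<dots> = ennreal (exp (- (l' * (1 - \<epsilon>) * R))) *
      (\<integral>\<^sup>+\<omega>. indicator {\<omega>. norm (V [] 0 \<omega>) \<le> 0} \<omega> * ennreal (expsum S l' (0 + V [] r \<omega>)) \<partial>M)"
  proof (rule nn_integral_cmult)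
    have [measurable]: "(\<lambda>\<omega>. indicator {\<omega>. norm (V [] 0 \<omega>) \<le> 0} \<omega> :: ennreal) \<in> borel_measurable M"
      unfolding indicator_def mem_Collect_eq by measurable
    show "(\<lambda>\<omega>. indicator {\<omega>. norm (V [] 0 \<omega>) \<le> 0} \<omega> * ennreal (expsum S l' (0 + V [] r \<omega>))) \<in> borel_measurable M"
      by measurable
  qed
  also have "\<dots> \<le> ennreal (exp (- (l' * (1 - \<epsilon>) * R))) * ennreal (exp (l' * 0 + l'\<^sup>2 / 2 * (r - 0)) * expsum S l' 0)"
    using S rt l by (intro mult_left_mono expsum_integral_le) auto
  also have "\<dots> = ennreal (exp (l' * 0 + l'\<^sup>2 / 2 * (r - 0)) * (exp (- (l' * (1 - \<epsilon>) * R)) * card S))"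
    by (simp add: e0 ennreal_mult[symmetric] mult.left_commute)
  also have "\<dots> = ennreal (card S * exp (l'\<^sup>2 / 2 * r - l' * (1 - \<epsilon>) * R))"
    by (simp only: gen) simp
  finally have near: "1 - card S * exp (l'\<^sup>2 / 2 * r - l' * (1 - \<epsilon>) * R) \<le> measure M ?N"
    by simp

  \<comment> \<open>The lifetime and the path of the root are independent sources, so the
    probability of \<open>?H\<close> factorises from below.\<close>
  have "ennreal (exp (- \<beta> * r) * measure M ?N) = (\<integral>\<^sup>+\<omega>. indicator {r<..} (\<tau> [] \<omega>) \<partial>M) * (\<integral>\<^sup>+\<omega>. indicator {..R} (norm (V [] r \<omega>)) \<partial>M)"
  proof -
    have "(\<integral>\<^sup>+\<omega>. indicator {r<..} (\<tau> [] \<omega>) \<partial>M) = (\<integral>\<^sup>+\<omega>. indicator {\<omega> \<in> space M. r < \<tau> [] \<omega>} \<omega> \<partial>M)"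
      by (intro nn_integral_cong) (auto simp: indicator_def)
    also have "\<dots> = ennreal (exp (- \<beta> * r))"
      using exponential_distributedD_gt[OF lifetime_exponential rt(1) rate_pos, of "[]"]
      by (simp add: emeasure_eq_measure mult.commute)
    finally have 1: "(\<integral>\<^sup>+\<omega>. indicator {r<..} (\<tau> [] \<omega>) \<partial>M) = ennreal (exp (- \<beta> * r))" .
    have "(\<integral>\<^sup>+\<omega>. indicator {..R} (norm (V [] r \<omega>)) \<partial>M) = (\<integral>\<^sup>+\<omega>. indicator ?N \<omega> \<partial>M)"
      by (intro nn_integral_cong) (auto simp: indicator_def)
    also have "\<dots> = ennreal (measure M ?N)" by (simp add: emeasure_eq_measure)
    finally show ?thesis using 1 by (simp add: ennreal_mult)
  qed
  also have "\<dots> = (\<integral>\<^sup>+\<omega>. indicator {r<..} (\<tau> [] \<omega>) * indicator {..R} (norm (V [] r \<omega>)) \<partial>M)"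
  proof (rule indep_nn_integral_mult[symmetric])
    show "{Inl []} \<inter> {Inr [] :: particle + particle} = {}" by simp
    show "(\<lambda>\<omega>. indicator {r<..} (\<tau> [] \<omega>)) \<in> borel_measurable (info {Inl []})"
      by (rule measurable_compose[OF lifetime_measurable_info borel_measurable_indicator]) auto
    have "V [] r \<in> borel_measurable (info {Inr []})"
      using V_measurable_info_comp[of "[]" "{Inr []}" "\<lambda>_. r" "info {Inr []}" "\<lambda>\<omega>. \<omega>"] by simp
    then show "(\<lambda>\<omega>. indicator {..R} (norm (V [] r \<omega>))) \<in> borel_measurable (info {Inr []})"
      by measurable
  qed
  also have "\<dots> \<le> (\<integral>\<^sup>+\<omega>. indicator ?H \<omega> \<partial>M)"
    by (intro nn_integral_mono) (auto simp: indicator_def)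
  also have "\<dots> = ennreal (measure M ?H)" by (simp add: emeasure_eq_measure)
  finally have "exp (- \<beta> * r) * measure M ?N \<le> measure M ?H" by simp
  moreover have "measure M ?H \<le> measure M (?H - below_event ?A t K) + measure M (below_event ?A t K)"
  proof -
    have "measure M ?H \<le> measure M ((?H - below_event ?A t K) \<union> below_event ?A t K)"
      using below_event_sets[of ?A t K] t by (intro finite_measure_mono) auto
    also have "\<dots> \<le> measure M (?H - below_event ?A t K) + measure M (below_event ?A t K)"
      using below_event_sets[of ?A t K] t by (intro measure_Un_le) auto
    finally show ?thesis .
  qed
  moreover have "exp (- \<beta> * r) * (1 - card S * exp (l'\<^sup>2 / 2 * r - l' * (1 - \<epsilon>) * R)) \<le> exp (- \<beta> * r) * measure M ?N"
    using near by (intro mult_left_mono) auto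
  ultimately show ?thesis using far by linarith
qed

subsection \<open>Upper bound\<close>

text \<open>Exponential Markov: if the count is below \<open>K\<close>, then
  \<open>exp (1 - count / K)\<close> is at least 1. The expectation is split at time
  \<open>r\<close>: over the last \<open>k\<close> steps the deficit grows from \<open>p\<close> to
  \<open>q\<close> at every starting point, and over the first \<open>r\<close> time units the Yule
  estimate at \<open>1 - q\<close> applies.\<close>

lemma prob_below_le:
  assumes T: "0 < T" and \<eta>: "\<eta> \<le> 1" and K: "0 < K"
    and p: "0 \<le> p" "p \<le> 1 - exp (- 1 / K)" "p \<le> q" "q * exp (\<beta> * T) \<le> \<eta>" and q: "0 < q" "q < 1" and c: "0 \<le> c"
    and m: "1 \<le> m" "m \<le> exp (- \<beta> * T) * (\<Sum>k<N. ((2 - \<eta>) * \<beta> * T) ^ k / fact k) * normal_density 0 (sqrt T) (c * T + 1)"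
    and k: "q \<le> m ^ k * p" "X \<le> k * (c * T)" and r: "0 \<le> r"
  shows "measure M (below_event (- ball 0 X) (r + k * T) K) \<le> exp 1 * (exp (- \<beta> * r) / q)"
proof -
  let ?A = "- ball 0 X :: 'a set"
  let ?t = "r + k * T"
  let ?g = "\<lambda>z. ennreal (exp (- (1 / K) * indicator ?A z))"
  have [measurable]: "?A \<in> sets borel" by measurable
  have t: "0 \<le> ?t" using T r by simp
  have g1: "?g z \<le> 1" for z using K by (simp add: indicator_def)
  have far: "trunc_pgf (k * N + 1) ?g (k * T) y \<le> ennreal (1 - q)" for y
  proof -
    obtain b :: 'a where b: "b \<in> Basis" using nonempty_Basis by blast
    \<comment> \<open>The sign of the coordinate of \<open>y\<close> selects the half-space. At
      distance \<open>X\<close> from the origin it lies outside the ball, and moved back by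
      \<open>k * (c * T) \<ge> X\<close> it contains \<open>y\<close>.\<close>
    define \<sigma> :: real where "\<sigma> = (if 0 \<le> y \<bullet> b then 1 else - 1)"
    have \<sigma>: "\<sigma> = 1 \<or> \<sigma> = - 1" "0 \<le> y \<bullet> (\<sigma> *\<^sub>R b)" by (auto simp: \<sigma>_def)
    let ?b = "\<sigma> *\<^sub>R b"
    have nb: "norm ?b = 1" using \<sigma> b by auto
    have "?g z \<le> ennreal (1 - p * indicator {z. X \<le> z \<bullet> ?b} z)" for z
    proof (cases "X \<le> z \<bullet> ?b")
      case True
      have "z \<bullet> ?b \<le> norm z" using norm_cauchy_schwarz[of z ?b] nb by simp
      then have "z \<in> ?A" using True by simp
      then show ?thesis using True p by (simp add: ennreal_leI)
    next
      case False
      then show ?thesis using g1[of z] by simp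
    qed
    then have "trunc_pgf (k * N + 1) ?g (k * T) y \<le> trunc_pgf (k * N + 1) (\<lambda>z. ennreal (1 - p * indicator {z. X \<le> z \<bullet> ?b} z)) (k * T) y"
      by (rule trunc_pgf_mono)
    also have "\<dots> \<le> ennreal (1 - min q (m ^ k * p) * indicator {z. X - k * (c * T) \<le> z \<bullet> ?b} y)"
    proof (rule trunc_pgf_halfspace_le)
      show "normal_density 0 (sqrt T) (c * T + 1) \<le> hit_prob {z. \<xi> \<le> z \<bullet> ?b} T y"
        if "\<xi> - c * T \<le> y \<bullet> ?b" for \<xi> y
        using hit_prob_halfspace_ge[OF b \<sigma>(1) T _ that] c T by simp
    qed (use T \<eta> p m in auto)
    also have "\<dots> = ennreal (1 - q)" using k \<sigma>(2) by (simp add: min_def)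
    finally show ?thesis .
  qed
  have bound: "measure M (below_event ?A ?t K) \<le> exp 1 * (exp (- \<beta> * r) / q + (2 * \<beta> * r) ^ n / fact n)" for n
  proof -
    let ?n = "n + (k * N + 1)"
    have "ennreal (measure M (below_event ?A ?t K)) = (\<integral>\<^sup>+\<omega>. indicator (below_event ?A ?t K) \<omega> \<partial>M)"
      using below_event_sets[of ?A ?t K] t by (simp add: emeasure_eq_measure)
    also have "\<dots> \<le> (\<integral>\<^sup>+\<omega>. ennreal (exp 1) * ennreal (exp (- (1 / K) * trunc_count ?n ?A [] ?t 0 \<omega>)) \<partial>M)"
    proof (intro nn_integral_mono)
      fix \<omega> assume w: "\<omega> \<in> space M"
      show "indicator (below_event ?A ?t K) \<omega> \<le> ennreal (exp 1) * ennreal (exp (- (1 / K) * trunc_count ?n ?A [] ?t 0 \<omega>))"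
      proof (cases "\<omega> \<in> below_event ?A ?t K")
        case True
        have "ennreal (trunc_count ?n ?A [] ?t 0 \<omega>) \<le> particle_count \<tau> W ?t ?A \<omega>"
          unfolding particle_count_eq_SUP[OF w t] by (rule SUP_upper) simp
        also have "\<dots> < ennreal K" using True by (simp add: below_event_def)
        finally have "trunc_count ?n ?A [] ?t 0 \<omega> < K" by (simp add: ennreal_less_iff)
        then have "(1 / K) * trunc_count ?n ?A [] ?t 0 \<omega> \<le> 1" using K by simp
        then have "1 \<le> exp (1 + - (1 / K) * trunc_count ?n ?A [] ?t 0 \<omega>)" by simp
        then have "1 \<le> exp 1 * exp (- (1 / K) * trunc_count ?n ?A [] ?t 0 \<omega>)" by (simp only: exp_add)
        then have "ennreal 1 \<le> ennreal (exp 1 * exp (- (1 / K) * trunc_count ?n ?A [] ?t 0 \<omega>))" by (rule ennreal_leI)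
        then show ?thesis using True by (simp add: ennreal_mult)
      qed simp
    qed
    also have "\<dots> = ennreal (exp 1) * (\<integral>\<^sup>+\<omega>. ennreal (exp (- (1 / K) * trunc_count ?n ?A [] ?t 0 \<omega>)) \<partial>M)"
      by (rule nn_integral_cmult) measurable
    also have "\<dots> = ennreal (exp 1) * trunc_pgf ?n ?g ?t 0"
      using exp_trunc_count_integral[OF _ t, of ?A "1 / K" ?n "[]" 0] by simp
    also have "trunc_pgf ?n ?g ?t 0 \<le> trunc_pgf n (trunc_pgf (k * N + 1) ?g (k * T)) r 0"
      using r T g1 by (intro trunc_pgf_branching) auto
    also have "\<dots> \<le> trunc_pgf n (\<lambda>_. ennreal (1 - q)) r 0" by (intro trunc_pgf_mono far)
    also have "\<dots> \<le> ennreal (exp (- \<beta> * r) / (1 - (1 - q)) + (2 * \<beta> * r) ^ n / fact n)"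
      using q r by (intro trunc_pgf_const_le) auto
    finally have "ennreal (measure M (below_event ?A ?t K)) \<le>
        ennreal (exp 1) * ennreal (exp (- \<beta> * r) / q + (2 * \<beta> * r) ^ n / fact n)"
      by (simp add: mult_left_mono del: ennreal_plus)
    also have "\<dots> = ennreal (exp 1 * (exp (- \<beta> * r) / q + (2 * \<beta> * r) ^ n / fact n))"
      using q r rate_pos by (intro ennreal_mult[symmetric]) auto
    finally show ?thesis
      using q r rate_pos by (subst (asm) ennreal_le_iff) auto
  qed
  \<comment> \<open>The bound holds for every depth \<open>n\<close>, so the truncation error
    disappears in the limit.\<close>
  have "(\<lambda>n. (2 * \<beta> * r) ^ n / fact n) \<longlonglongrightarrow> 0"
    using summable_LIMSEQ_zero[OF summable_exp_generic[of "2 * \<beta> * r"]] by (simp add: divide_inverse mult.commute)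
  then have "(\<lambda>n. exp 1 * (exp (- \<beta> * r) / q + (2 * \<beta> * r) ^ n / fact n)) \<longlonglongrightarrow> exp 1 * (exp (- \<beta> * r) / q + 0)"
    by (intro tendsto_intros)
  then have "measure M (below_event ?A ?t K) \<le> exp 1 * (exp (- \<beta> * r) / q + 0)"
    by (rule LIMSEQ_le_const) (use bound in blast)
  then show ?thesis by simp
qed

end

section \<open>Choice of parameters and exponential bounds\<close>

text \<open>In one step branching gains \<open>exp (\<beta> * T)\<close>, while advancing at speed
  \<open>c\<close> costs \<open>exp (- c\<^sup>2 / 2 * T)\<close> up to a subexponential factor. A
  long step absorbs that factor as well as the loss from linearisation.\<close>

lemma exists_supercritical_step:
  fixes \<beta> c \<rho> :: real
  assumes \<beta>: "0 < \<beta>" and gap: "\<rho> < \<beta> - c\<^sup>2 / 2" and c: "0 \<le> c"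
  obtains T \<eta> N where "0 < T" "0 < \<eta>" "\<eta> \<le> 1"
    "exp (\<rho> * T) \<le> exp (- \<beta> * T) * (\<Sum>k<N. ((2 - \<eta>) * \<beta> * T) ^ k / fact k) * normal_density 0 (sqrt T) (c * T + 1)"
proof -
  \<comment> \<open>Half of the gap: one half pays for \<open>\<eta> * \<beta>\<close> in the
    exponent, the other outgrows the Gaussian prefactor.\<close>
  define \<gamma> where "\<gamma> = (\<beta> - c\<^sup>2 / 2 - \<rho>) / 2"
  define \<eta> where "\<eta> = min 1 (\<gamma> / \<beta>)"
  have \<gamma>: "0 < \<gamma>" using gap by (simp add: \<gamma>_def)
  have \<eta>: "0 < \<eta>" "\<eta> \<le> 1" "\<eta> * \<beta> \<le> \<gamma>" using \<gamma> \<beta> by (auto simp: \<eta>_def min_def field_simps)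
  have "filterlim (\<lambda>T. exp (\<gamma> * T) * (exp (- c - 1 / (2 * T)) / sqrt (2 * pi * T))) at_top at_top"
    using \<gamma> by real_asymp
  then have "\<forall>\<^sub>F T in at_top. 1 < exp (\<gamma> * T) * (exp (- c - 1 / (2 * T)) / sqrt (2 * pi * T))"
    by (simp add: filterlim_at_top_dense)
  from eventually_happens[OF eventually_conj[OF this eventually_gt_at_top[of 0]]]
  obtain T where T: "0 < T" "1 < exp (\<gamma> * T) * (exp (- c - 1 / (2 * T)) / sqrt (2 * pi * T))" by auto
  let ?Q = "normal_density 0 (sqrt T) (c * T + 1)"
  have Q: "?Q = exp (- c\<^sup>2 / 2 * T) * (exp (- c - 1 / (2 * T)) / sqrt (2 * pi * T))"
  proof -
    have "- (c * T + 1 - 0)\<^sup>2 / (2 * (sqrt T)\<^sup>2) = - c\<^sup>2 / 2 * T + (- c - 1 / (2 * T))"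
      using T by (simp add: power2_eq_square field_simps)
    then have "exp (- (c * T + 1 - 0)\<^sup>2 / (2 * (sqrt T)\<^sup>2)) = exp (- c\<^sup>2 / 2 * T) * exp (- c - 1 / (2 * T))"
      by (simp only: exp_add)
    then show ?thesis using T unfolding normal_density_def by simp
  qed
  have "exp (\<rho> * T) * 1 < exp (\<rho> * T) * (exp (\<gamma> * T) * (exp (- c - 1 / (2 * T)) / sqrt (2 * pi * T)))"
    using T(2) by (intro mult_strict_left_mono) auto
  also have "\<dots> = exp (\<rho> * T + \<gamma> * T) * (exp (- c - 1 / (2 * T)) / sqrt (2 * pi * T))" by (simp add: exp_add)
  also have "\<dots> \<le> exp ((1 - \<eta>) * \<beta> * T + - c\<^sup>2 / 2 * T) * (exp (- c - 1 / (2 * T)) / sqrt (2 * pi * T))"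
  proof (rule mult_right_mono)
    have "\<rho> + \<gamma> \<le> (1 - \<eta>) * \<beta> + - c\<^sup>2 / 2"
      using \<eta>(3) by (simp add: \<gamma>_def field_simps)
    then have "(\<rho> + \<gamma>) * T \<le> ((1 - \<eta>) * \<beta> + - c\<^sup>2 / 2) * T" using T by (intro mult_right_mono) auto
    then show "exp (\<rho> * T + \<gamma> * T) \<le> exp ((1 - \<eta>) * \<beta> * T + - c\<^sup>2 / 2 * T)" by (simp add: algebra_simps)
  qed (use T in simp)
  also have "\<dots> = exp (- \<beta> * T) * exp ((2 - \<eta>) * \<beta> * T) * ?Q"
    unfolding Q by (simp add: exp_add[symmetric] algebra_simps)
  finally have lim: "exp (\<rho> * T) < exp (- \<beta> * T) * exp ((2 - \<eta>) * \<beta> * T) * ?Q" by simp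
  \<comment> \<open>The depth \<open>N\<close> is chosen last: the strict inequality for the full
    exponential series survives a sufficiently late truncation.\<close>
  have "(\<lambda>N. \<Sum>k<N. ((2 - \<eta>) * \<beta> * T) ^ k / fact k) \<longlonglongrightarrow> exp ((2 - \<eta>) * \<beta> * T)"
    using exp_converges[of "(2 - \<eta>) * \<beta> * T"] by (simp add: sums_def divide_inverse mult.commute)
  then have "(\<lambda>N. exp (- \<beta> * T) * (\<Sum>k<N. ((2 - \<eta>) * \<beta> * T) ^ k / fact k) * ?Q) \<longlonglongrightarrow>
      exp (- \<beta> * T) * exp ((2 - \<eta>) * \<beta> * T) * ?Q" by (intro tendsto_intros)
  from order_tendstoD(1)[OF this lim] obtain N where
    "exp (\<rho> * T) < exp (- \<beta> * T) * (\<Sum>k<N. ((2 - \<eta>) * \<beta> * T) ^ k / fact k) * ?Q"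
    by (auto simp: eventually_sequentially)
  then show ?thesis by (intro that[OF T(1) \<eta>(1,2)] less_imp_le)
qed

lemma one_minus_exp_ge:
  assumes "0 \<le> (x :: real)" "x \<le> 1" shows "x / 2 \<le> 1 - exp (- x)"
proof -
  have "exp (- x) * (1 + x) \<le> exp (- x) * exp x" using assms by (intro mult_left_mono) auto
  then have "exp (- x) * (1 + x) \<le> 1" by (simp add: exp_add[symmetric])
  then have "exp (- x) \<le> 1 / (1 + x)" using assms by (simp add: field_simps)
  also have "1 / (1 + x) \<le> 1 - x / 2"
    using assms mult_left_mono[of x 1 x] by (simp add: field_simps power2_eq_square)
  finally show ?thesis by simp
qed

context dyadic_bbm
begin

text \<open>Within time \<open>u * t\<close> a particle of speed \<open>c\<close> covers the radius,
  and growth at rate \<rho> lifts a deficit of order \<open>exp (- \<beta> * a * t)\<close> to a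
  constant. The hypothesis \<open>gap\<close> is equivalent to \<rho> being below
  \<open>\<beta> - c\<^sup>2 / 2\<close>; the remaining time \<open>(1 - u) * t\<close> yields the
  decay.\<close>

lemma eventually_prob_below_le:
  assumes \<theta>: "0 < \<theta>" and a: "0 \<le> a" and u: "0 < u" "u < 1" and gap: "u * a + \<theta>\<^sup>2 < u\<^sup>2"
  shows "\<exists>C. \<forall>\<^sub>F t in at_top. measure M (below_event (- ball 0 (\<theta> * sqrt (2 * \<beta>) * t)) t (exp (\<beta> * a * t)))
    \<le> exp (C - \<beta> * (1 - u) * t)"
proof -
  define c where "c = \<theta> * sqrt (2 * \<beta>) / u"
  define \<rho> where "\<rho> = \<beta> * a / u"
  have c: "0 \<le> c" using \<theta> u rate_pos by (simp add: c_def)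
  have "\<rho> < \<beta> - c\<^sup>2 / 2"
  proof -
    have "c\<^sup>2 / 2 = \<beta> * \<theta>\<^sup>2 / u\<^sup>2" using rate_pos by (simp add: c_def power_divide power_mult_distrib)
    moreover have "\<beta> * ((u * a + \<theta>\<^sup>2) / u\<^sup>2) < \<beta> * 1"
      using gap u rate_pos by (intro mult_strict_left_mono) auto
    moreover have "\<beta> * ((u * a + \<theta>\<^sup>2) / u\<^sup>2) = \<rho> + \<beta> * \<theta>\<^sup>2 / u\<^sup>2"
      using u by (simp add: \<rho>_def field_simps power2_eq_square)
    ultimately show ?thesis by linarith
  qed
  from exists_supercritical_step[OF rate_pos this c] obtain T \<eta> N where T: "0 < T" and \<eta>: "0 < \<eta>" "\<eta> \<le> 1"
    and m: "exp (\<rho> * T) \<le> exp (- \<beta> * T) * (\<Sum>k<N. ((2 - \<eta>) * \<beta> * T) ^ k / fact k) * normal_density 0 (sqrt T) (c * T + 1)"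
    by blast
  \<comment> \<open>Chosen so that \<open>q * exp (\<beta> * T) = \<eta> / 2\<close>, within the
    range of the linearisation, and so that \<open>q \<le> 1 / 2\<close>.\<close>
  define q where "q = \<eta> * exp (- \<beta> * T) / 2"
  have q: "0 < q" "q \<le> 1 / 2" "q * exp (\<beta> * T) \<le> \<eta>"
  proof -
    show "0 < q" using \<eta> by (simp add: q_def)
    have "\<eta> * exp (- \<beta> * T) \<le> 1 * 1" using \<eta> T rate_pos by (intro mult_mono) auto
    then show "q \<le> 1 / 2" by (simp add: q_def)
    have "q * exp (\<beta> * T) = \<eta> / 2" by (simp add: q_def exp_add[symmetric])
    then show "q * exp (\<beta> * T) \<le> \<eta>" using \<eta> by simp
  qed
  have \<rho>: "0 \<le> \<rho>" using a u rate_pos by (simp add: \<rho>_def)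
  have "measure M (below_event (- ball 0 (\<theta> * sqrt (2 * \<beta>) * t)) t (exp (\<beta> * a * t)))
    \<le> exp (1 - ln q + \<beta> * T - \<beta> * (1 - u) * t)" if t: "T / (1 - u) < t" for t
  proof -
    have t0: "0 < t" using t T u by (meson diff_gt_0_iff_gt divide_pos_pos order.strict_trans)
    \<comment> \<open>Rounding up makes the steps cover \<open>u * t\<close>; the overshoot is at
      most \<open>T\<close>, which fits before \<open>t\<close> because
      \<open>T < (1 - u) * t\<close>.\<close>
    define k where "k = nat \<lceil>u * t / T\<rceil>"
    have k1: "u * t \<le> k * T"
    proof -
      have "u * t / T \<le> k" unfolding k_def by (rule of_nat_ceiling)
      then show ?thesis using T by (simp add: field_simps)
    qed
    have k2: "k * T \<le> u * t + T"
    proof -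
      have "0 \<le> u * t / T" using u t0 T by simp
      then have "k \<le> u * t / T + 1" unfolding k_def by linarith
      then show ?thesis using T by (simp add: field_simps)
    qed
    define r where "r = t - k * T"
    have r: "0 \<le> r" using t u k2 by (simp add: r_def field_simps)
    let ?K = "exp (\<beta> * a * t)"
    \<comment> \<open>An admissible initial deficit, since \<open>1 - exp (- 1 / K)\<close> is at
      least \<open>1 / (2 * K)\<close> and \<open>q \<le> 1 / 2\<close>.\<close>
    let ?p = "q * exp (- (\<beta> * a * t))"
    have x: "0 \<le> exp (- (\<beta> * a * t))" "exp (- (\<beta> * a * t)) \<le> 1" using a t0 rate_pos by auto
    have "measure M (below_event (- ball 0 (\<theta> * sqrt (2 * \<beta>) * t)) (r + k * T) ?K) \<le> exp 1 * (exp (- \<beta> * r) / q)"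
    proof (rule prob_below_le[OF T \<eta>(2), where p = ?p and m = "exp (\<rho> * T)" and N = N and c = c])
      show "?p \<le> 1 - exp (- 1 / ?K)"
      proof -
        have "?p \<le> 1 / 2 * exp (- (\<beta> * a * t))" using q x by (intro mult_right_mono) auto
        also have "\<dots> \<le> 1 - exp (- exp (- (\<beta> * a * t)))" using one_minus_exp_ge[OF x] by simp
        finally show ?thesis by (simp add: exp_minus divide_inverse)
      qed
      show "?p \<le> q" using mult_left_mono[OF x(2), of q] q by simp
      show "1 \<le> exp (\<rho> * T)" using \<rho> T by simp
      show "q \<le> exp (\<rho> * T) ^ k * ?p"
      proof -
        have "\<beta> * a * t = \<rho> * (u * t)" using u by (simp add: \<rho>_def)
        also have "\<dots> \<le> \<rho> * (k * T)" using k1 \<rho> by (rule mult_left_mono)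
        finally have "1 \<le> exp (k * (\<rho> * T) - \<beta> * a * t)" by (simp add: mult_ac)
        also have "\<dots> = exp (\<rho> * T) ^ k * exp (- (\<beta> * a * t))"
          by (simp add: exp_diff exp_of_nat_mult exp_minus divide_inverse)
        finally show ?thesis using mult_left_mono[of 1 "exp (\<rho> * T) ^ k * exp (- (\<beta> * a * t))" q] q by (simp add: mult_ac)
      qed
      show "\<theta> * sqrt (2 * \<beta>) * t \<le> k * (c * T)"
      proof -
        have "\<theta> * sqrt (2 * \<beta>) * t = c * (u * t)" using u by (simp add: c_def)
        also have "\<dots> \<le> c * (k * T)" using k1 c by (rule mult_left_mono)
        finally show ?thesis by (simp add: mult_ac)
      qed
    qed (use q c m r in auto)
    also have "exp 1 * (exp (- \<beta> * r) / q) = exp (1 - ln q - \<beta> * r)"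
      using q by (simp add: exp_diff exp_minus exp_add field_simps)
    also have "\<dots> \<le> exp (1 - ln q + \<beta> * T - \<beta> * (1 - u) * t)"
    proof -
      have "\<beta> * ((1 - u) * t - T) \<le> \<beta> * r"
        using k2 rate_pos by (intro mult_left_mono) (auto simp: r_def algebra_simps)
      then show ?thesis by (simp add: algebra_simps)
    qed
    finally show ?thesis by (simp add: r_def)
  qed
  then show ?thesis
    by (intro exI[of _ "1 - ln q + \<beta> * T"] eventually_mono[OF eventually_gt_at_top[of "T / (1 - u)"]]) auto
qed

text \<open>With \<open>r = (1 - u) * t\<close> and \<open>R = \<epsilon> * t\<close> in
  \<open>prob_below_ge\<close>, both error terms are exponentially small relative to
  \<open>exp (- \<beta> * r)\<close>.\<close>

lemma eventually_prob_below_ge: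
  assumes \<theta>: "0 < \<theta>" and u: "0 < u" "u < 1" and gap: "u\<^sup>2 < u * a + \<theta>\<^sup>2"
  shows "\<forall>\<^sub>F t in at_top. exp (- \<beta> * (1 - u) * t) / 2 \<le>
    measure M (below_event (- ball 0 (\<theta> * sqrt (2 * \<beta>) * t)) t (exp (\<beta> * a * t)))"
proof -
  define x where "x = \<theta> * sqrt (2 * \<beta>)"
  \<comment> \<open>The minimiser of \<open>l\<^sup>2 / 2 * u - l * x\<close>, that is, the optimal
    tilt for reaching distance \<open>x * t\<close> in time \<open>u * t\<close>. The constant
    \<open>g\<close> below is the rate at which the conditional mean count falls short of the
    threshold.\<close>
  define l where "l = x / u"
  define g where "g = \<beta> * ((u * a + \<theta>\<^sup>2) / u - u)"
  have x: "0 < x" using \<theta> rate_pos by (simp add: x_def)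
  have l: "0 < l" using x u by (simp add: l_def)
  have g: "0 < g"
  proof -
    have "(u * a + \<theta>\<^sup>2) / u - u = (u * a + \<theta>\<^sup>2 - u\<^sup>2) / u"
      using u by (simp add: field_simps power2_eq_square)
    then show ?thesis using gap u rate_pos by (simp add: g_def)
  qed
  \<comment> \<open>The slack \<open>l * \<epsilon>\<close> from the radius \<open>R\<close> and
    \<open>l * \<epsilon> * x\<close> from the net together use at most half of
    \<open>g\<close>.\<close>
  define \<epsilon> where "\<epsilon> = min (1 / 2) (g / (2 * l * (1 + x)))"
  have \<epsilon>: "0 < \<epsilon>" "\<epsilon> \<le> 1 / 2" "l * \<epsilon> * (1 + x) \<le> g / 2"
  proof -
    show "0 < \<epsilon>" using g l x by (simp add: \<epsilon>_def)
    show "\<epsilon> \<le> 1 / 2" unfolding \<epsilon>_def by (rule min.cobounded1)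
    have "\<epsilon> \<le> g / (2 * l * (1 + x))" unfolding \<epsilon>_def by (rule min.cobounded2)
    then have "\<epsilon> * (2 * l * (1 + x)) \<le> g" using l x by (simp add: pos_le_divide_eq)
    then show "l * \<epsilon> * (1 + x) \<le> g / 2" by (simp add: mult_ac)
  qed
  obtain S :: "'a set" where S: "finite S" "\<And>v. v \<in> S \<Longrightarrow> norm v = 1" "\<And>y. \<exists>v\<in>S. (1 - \<epsilon>) * norm y \<le> v \<bullet> y"
    using finite_net_sphere[OF \<epsilon>(1)] by metis
  have lim: "((\<lambda>t. exp (- c * t)) \<longlongrightarrow> 0) at_top" if "0 < c" for c :: real
    using that by real_asymp
  have "((\<lambda>t. card S * exp (- (\<epsilon>\<^sup>2 / 8) * t) + card S * exp (- (g / 2) * t)) \<longlongrightarrow>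
      real (card S) * 0 + real (card S) * 0) at_top"
    using \<epsilon> g by (intro tendsto_add tendsto_mult tendsto_const lim) auto
  then have "\<forall>\<^sub>F t in at_top. card S * exp (- (\<epsilon>\<^sup>2 / 8) * t) + card S * exp (- (g / 2) * t) < 1 / 2"
    by (rule order_tendstoD) simp
  then show ?thesis
    using eventually_gt_at_top[of 0]
  proof eventually_elim
    case (elim t)
    then have t: "0 < t" by simp
    define r where "r = (1 - u) * t"
    have r: "0 \<le> r" "r \<le> t" using u t by (auto simp: r_def mult_le_cancel_right1)
    \<comment> \<open>The tilt for the root is \<open>l' = \<epsilon> / 2\<close>; with radius
      \<open>\<epsilon> * t\<close> and \<open>\<epsilon> \<le> 1 / 2\<close> it gives the decay
      rate \<open>\<epsilon>\<^sup>2 / 8\<close>.\<close>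
    have "exp (- \<beta> * r) * (1 - card S * exp ((\<epsilon> / 2)\<^sup>2 / 2 * r - \<epsilon> / 2 * (1 - \<epsilon>) * (\<epsilon> * t)))
       - card S * exp (l * (\<epsilon> * t) + l\<^sup>2 / 2 * (t - r) + \<beta> * (t - 2 * r) - l * (1 - \<epsilon>) * (x * t)) / exp (\<beta> * a * t)
      \<le> measure M (below_event (- ball 0 (x * t)) t (exp (\<beta> * a * t)))"
      using S \<epsilon> l r t by (intro prob_below_ge) auto
    moreover have "exp (- \<beta> * r) * (1 - card S * exp (- (\<epsilon>\<^sup>2 / 8) * t)) \<le>
        exp (- \<beta> * r) * (1 - card S * exp ((\<epsilon> / 2)\<^sup>2 / 2 * r - \<epsilon> / 2 * (1 - \<epsilon>) * (\<epsilon> * t)))"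
    proof (intro mult_left_mono diff_left_mono)
      show "exp ((\<epsilon> / 2)\<^sup>2 / 2 * r - \<epsilon> / 2 * (1 - \<epsilon>) * (\<epsilon> * t)) \<le> exp (- (\<epsilon>\<^sup>2 / 8) * t)"
      proof -
      have "(\<epsilon> / 2)\<^sup>2 / 2 * r \<le> (\<epsilon> / 2)\<^sup>2 / 2 * t" using r by (intro mult_left_mono) auto
      moreover have "\<epsilon>\<^sup>2 * t / 2 * (1 / 2) \<le> \<epsilon>\<^sup>2 * t / 2 * (1 - \<epsilon>)" using \<epsilon> t by (intro mult_left_mono) auto
      ultimately show ?thesis by (simp add: power2_eq_square field_simps)
      qed
    qed auto
    moreover have "card S * exp (l * (\<epsilon> * t) + l\<^sup>2 / 2 * (t - r) + \<beta> * (t - 2 * r) - l * (1 - \<epsilon>) * (x * t)) / exp (\<beta> * a * t)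
       \<le> card S * (exp (- \<beta> * r) * exp (- (g / 2) * t))"
      unfolding times_divide_eq_right[symmetric]
    proof (rule mult_left_mono)
      show "exp (l * (\<epsilon> * t) + l\<^sup>2 / 2 * (t - r) + \<beta> * (t - 2 * r) - l * (1 - \<epsilon>) * (x * t)) / exp (\<beta> * a * t)
       \<le> exp (- \<beta> * r) * exp (- (g / 2) * t)"
      proof -
      have lu: "l * u = x" using u by (simp add: l_def)
      have xx: "x\<^sup>2 = 2 * \<beta> * \<theta>\<^sup>2" using rate_pos by (simp add: x_def power_mult_distrib)
      have "l\<^sup>2 / 2 * u - l * x = - (x\<^sup>2 / (2 * u))"
        using u by (simp add: l_def power2_eq_square field_simps)
      also have "\<dots> = - (\<beta> * \<theta>\<^sup>2 / u)" by (simp add: xx)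
      finally have "l\<^sup>2 / 2 * u - l * x + \<beta> * u - \<beta> * a = - g"
        using u by (simp add: g_def field_simps power2_eq_square)
      then have "l * \<epsilon> + l\<^sup>2 / 2 * u + \<beta> * u - l * (1 - \<epsilon>) * x - \<beta> * a \<le> - (g / 2)"
        using \<epsilon>(3) by (simp add: algebra_simps)
      then have "(l * \<epsilon> + l\<^sup>2 / 2 * u + \<beta> * u - l * (1 - \<epsilon>) * x - \<beta> * a) * t \<le> - (g / 2) * t"
        using t by (intro mult_right_mono) auto
      then have "l * (\<epsilon> * t) + l\<^sup>2 / 2 * (t - r) + \<beta> * (t - 2 * r) - l * (1 - \<epsilon>) * (x * t) - \<beta> * a * t
        \<le> - \<beta> * r + - (g / 2) * t"
        by (simp add: r_def algebra_simps)
      then show ?thesis by (simp only: exp_diff[symmetric] exp_add[symmetric] exp_le_cancel_iff)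
      qed
    qed simp
    ultimately have "exp (- \<beta> * r) * (1 - card S * exp (- (\<epsilon>\<^sup>2 / 8) * t)) - card S * (exp (- \<beta> * r) * exp (- (g / 2) * t))
      \<le> measure M (below_event (- ball 0 (x * t)) t (exp (\<beta> * a * t)))"
      by linarith
    moreover have "exp (- \<beta> * r) * (1 / 2) \<le> exp (- \<beta> * r) * (1 - (card S * exp (- (\<epsilon>\<^sup>2 / 8) * t) + card S * exp (- (g / 2) * t)))"
      by (rule mult_left_mono) (use elim(1) in linarith, simp)
    moreover have "exp (- \<beta> * r) * (1 - (card S * exp (- (\<epsilon>\<^sup>2 / 8) * t) + card S * exp (- (g / 2) * t))) =
      exp (- \<beta> * r) * (1 - card S * exp (- (\<epsilon>\<^sup>2 / 8) * t)) - card S * (exp (- \<beta> * r) * exp (- (g / 2) * t))"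
      by (simp only: right_diff_distrib distrib_left) simp
    ultimately have "exp (- \<beta> * r) * (1 / 2) \<le> measure M (below_event (- ball 0 (x * t)) t (exp (\<beta> * a * t)))"
      by linarith
    then show ?case by (simp add: r_def x_def mult.assoc)
  qed
qed

subsection \<open>The limit\<close>

text \<open>Every \<open>u\<close> in \<open>(0, u0)\<close> gives a lower bound with exponent
  \<open>- \<beta> * (1 - u)\<close> and every \<open>u\<close> in \<open>(u0, 1)\<close> an upper
  bound; letting \<open>u\<close> approach \<open>u0\<close> from either side gives the
  limit.\<close>

lemma rate_limit:
  assumes \<theta>: "0 < \<theta>" and a: "0 \<le> a" "a < 1 - \<theta>\<^sup>2"
  shows "((\<lambda>t. 1 / t * ln (measure M (below_event (- ball 0 (\<theta> * sqrt (2 * \<beta>) * t)) t (exp (\<beta> * a * t)))))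
    \<longlongrightarrow> - \<beta> * (1 - a / 2 - sqrt (\<theta>\<^sup>2 + (a / 2)\<^sup>2))) at_top"
    (is "((\<lambda>t. 1 / t * ln (?P t)) \<longlongrightarrow> _) at_top")
proof -
  define s where "s = sqrt (\<theta>\<^sup>2 + (a / 2)\<^sup>2)"
  define u0 where "u0 = a / 2 + s"
  have s2: "s\<^sup>2 = \<theta>\<^sup>2 + (a / 2)\<^sup>2" by (simp add: s_def)
  have sa: "a / 2 < s" unfolding s_def using \<theta> a by (intro real_less_rsqrt) simp
  \<comment> \<open>Since \<open>(1 - a / 2)\<^sup>2 - (a / 2)\<^sup>2 = 1 - a\<close>, the
    condition on \<open>a\<close> is what places \<open>u0\<close> below 1.\<close>
  have s1: "s < 1 - a / 2" unfolding s_def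
  proof (rule real_less_lsqrt)
    have "0 \<le> \<theta>\<^sup>2" by simp
    then show "0 \<le> 1 - a / 2" using a by linarith
    show "\<theta>\<^sup>2 + (a / 2)\<^sup>2 < (1 - a / 2)\<^sup>2" using a by (simp add: power2_eq_square algebra_simps)
  qed
  have u0: "0 < u0" "u0 < 1" using sa s1 a by (auto simp: u0_def)
  \<comment> \<open>The second root \<open>a / 2 - s\<close> is negative, so for positive
    \<open>u\<close> the sign is that of \<open>u - u0\<close>.\<close>
  have factor: "u\<^sup>2 - (u * a + \<theta>\<^sup>2) = (u - u0) * (u + (s - a / 2))" for u
    using s2 by (simp add: u0_def power2_eq_square algebra_simps)
  have below: "u\<^sup>2 < u * a + \<theta>\<^sup>2" if "0 < u" "u < u0" for u
    using mult_neg_pos[of "u - u0" "u + (s - a / 2)"] that sa factor[of u] by linarith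
  have above: "u * a + \<theta>\<^sup>2 < u\<^sup>2" if "u0 < u" for u
    using mult_pos_pos[of "u - u0" "u + (s - a / 2)"] that u0 sa factor[of u] by linarith
  have lim: "((\<lambda>t. c / t - \<beta> * (1 - u)) \<longlongrightarrow> - \<beta> * (1 - u)) at_top" for c u
    by real_asymp
  have "((\<lambda>t. 1 / t * ln (?P t)) \<longlongrightarrow> - \<beta> * (1 - u0)) at_top"
  proof (rule order_tendstoI)
    fix y assume y: "y < - \<beta> * (1 - u0)"
    then have "1 + y / \<beta> < u0" using rate_pos by (simp add: field_simps)
    then obtain u where u: "max 0 (1 + y / \<beta>) < u" "u < u0"
      using dense[of "max 0 (1 + y / \<beta>)" u0] u0 by auto
    have "y < - \<beta> * (1 - u)" using u rate_pos by (simp add: field_simps)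
    from order_tendstoD(1)[OF lim this, of "- ln 2"]
    have "\<forall>\<^sub>F t in at_top. y < - ln 2 / t - \<beta> * (1 - u)" .
    moreover have "\<forall>\<^sub>F t in at_top. exp (- \<beta> * (1 - u) * t) / 2 \<le> ?P t"
      using u u0 \<theta> below[of u] by (intro eventually_prob_below_ge) auto
    ultimately show "\<forall>\<^sub>F t in at_top. y < 1 / t * ln (?P t)"
      using eventually_gt_at_top[of 0]
    proof eventually_elim
      case (elim t)
      have "ln (exp (- \<beta> * (1 - u) * t) / 2) \<le> ln (?P t)"
        using elim(2) by (intro ln_mono) (auto intro: order.strict_trans2[rotated])
      then have "- \<beta> * (1 - u) * t - ln 2 \<le> ln (?P t)" by (simp add: ln_div)
      then have "(- \<beta> * (1 - u) * t - ln 2) / t \<le> ln (?P t) / t"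
        using elim(3) by (intro divide_right_mono) auto
      then show ?case using elim(1,3) by (simp add: diff_divide_distrib)
    qed
  next
    fix y assume y: "- \<beta> * (1 - u0) < y"
    then have "u0 < 1 + y / \<beta>" using rate_pos by (simp add: field_simps)
    then obtain u where u: "u0 < u" "u < min 1 (1 + y / \<beta>)"
      using dense[of u0 "min 1 (1 + y / \<beta>)"] u0 by auto
    have "- \<beta> * (1 - u) < y" using u rate_pos by (simp add: field_simps)
    note lim_less = order_tendstoD(2)[OF lim this]
    obtain C where "\<forall>\<^sub>F t in at_top. ?P t \<le> exp (C - \<beta> * (1 - u) * t)"
      using eventually_prob_below_le[OF \<theta> a(1), of u] u u0 above[of u] by auto
    \<comment> \<open>The lower bound at \<open>u0 / 2\<close> ensures that the probability is
      positive, so that monotonicity of \<open>ln\<close> applies.\<close>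
    moreover have "\<forall>\<^sub>F t in at_top. exp (- \<beta> * (1 - u0 / 2) * t) / 2 \<le> ?P t"
      using u0 \<theta> below[of "u0 / 2"] by (intro eventually_prob_below_ge) auto
    ultimately show "\<forall>\<^sub>F t in at_top. 1 / t * ln (?P t) < y"
      using eventually_gt_at_top[of 0] lim_less[of C]
    proof eventually_elim
      case (elim t)
      have "0 < exp (- \<beta> * (1 - u0 / 2) * t) / 2" by simp
      with elim(2) have "0 < ?P t" by linarith
      then have "ln (?P t) \<le> C - \<beta> * (1 - u) * t" using elim(1) ln_mono[of "?P t" "exp (C - \<beta> * (1 - u) * t)"] by simp
      then have "ln (?P t) / t \<le> (C - \<beta> * (1 - u) * t) / t"
        using elim(3) by (intro divide_right_mono) auto
      then show ?case using elim(3,4) by (simp add: diff_divide_distrib)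
    qed
  qed
  then show ?thesis by (simp add: u0_def s_def algebra_simps)
qed

end

theorem theorem2:
  fixes M :: "'w measure" and \<beta> \<theta> a :: real
    and \<tau> :: "particle \<Rightarrow> 'w \<Rightarrow> real"
    and W :: "particle \<Rightarrow> real \<Rightarrow> 'w \<Rightarrow> 'a::euclidean_space"
    and x :: "real \<Rightarrow> real"
  assumes "dyadic_bbm M \<beta> \<tau> W"
    and "0 < \<theta>" and "\<theta> < 1"
    and "\<And>t. x t = \<theta> * sqrt (2 * \<beta>) * t"
    and "0 \<le> a" and "a < 1 - \<theta>\<^sup>2"
  shows "((\<lambda>t. 1 / t * ln (measure M
             {\<omega> \<in> space M. particle_count \<tau> W t (- ball 0 (x t)) \<omega> < ennreal (exp (\<beta> * a * t))}))
          \<longlongrightarrow> - \<beta> * (1 - a / 2 - sqrt (\<theta>\<^sup>2 + (a / 2)\<^sup>2))) at_top"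
proof -
  interpret dyadic_bbm M \<beta> \<tau> W by fact
  show ?thesis
    using rate_limit[OF assms(2,5,6)] unfolding below_event_def assms(4) .
qed

end
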